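(* Under the standing setup and Assumptions A1, A2 and A3, the free-boundary $b(x)=\sup\{y>0:v(x,y)=1\}$ is the unique positive nondecreasing solution on $\mathcal{I}$ of the integral equation \[ \psi_r(x)\int_x^{\overline{x}}\Big(\int_{\underline{x}}^{z}\pi_c(y,b(z))\psi_r(y)\,m(dy)\Big)\frac{s(dz)}{\psi_r^2(z)}=1,\qquad x\in\mathcal{I}. \]
   Context: Standing setup: $W$ Brownian motion with augmented filtration, $\mathcal{T}$ stopping times; $X^x$ the strong solution of $dX^x=\mu(X^x)dt+\sigma(X^x)dW$, $X^x(0)=x$, with state space an interval $\mathcal{I}$ with endpoints $-\infty\le\underline{x}<\overline{x}\le\infty$, $\mu$ Lipschitz, $\sigma>0$, $|\sigma(x)-\sigma(y)|\le h(|x-y|)$, $h$ strictly increasing, $h(0)=0$, $\int_0^\epsilon h^{-2}=\infty$; $X$ is a regular one-dimensional diffusion with infinitesimal generator $\mathcal{G}=\frac12\sigma^2\frac{d^2}{dx^2}+\mu\frac{d}{dx}$, speed measure $m(dx)$ and scale function measure $s(dx)$. $\psi_r$ denotes the (positive) strictly increasing solution of $\mathcal{G}u=ru$ (unique up to a multiplicative constant). Discount rate $r>0$. Assumption A1: $c\mapsto\pi(x,c)$ strictly increasing, strictly concave, continuous derivative $\pi_c$ on $\mathcal{I}\times(0,\infty)$, $\pi_c(x,0+)=\infty$, $\lim_{c\to\infty}\pi_c(x,c)=\kappa\in[0,\infty)$; $\pi_c(X^x(t),y)$ is $\mathbb{P}\otimes e^{-rt}dt$-integrable for each $y>0$. Assumption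 A2: $r>\kappa$. Assumption A3: $x\mapsto\pi_c(x,c)$ nondecreasing for every $c>0$. $v(x,y)=\inf_{\tau\in\mathcal{T}}\mathbb{E}\{\int_0^\tau e^{-rs}\pi_c(X^x(s),y)ds+e^{-r\tau}\}$. *)

theory Defs
  imports "HOL-Probability.Probability"
begin

definition state_int :: "ereal \<Rightarrow> ereal \<Rightarrow> real set" where
  "state_int lo hi = {x. lo < ereal x \<and> ereal x < hi}"

definition strictly_concave_on :: "real set \<Rightarrow> (real \<Rightarrow> real) \<Rightarrow> bool" where
  "strictly_concave_on S f \<longleftrightarrow>
     (\<forall>x\<in>S. \<forall>y\<in>S. \<forall>t. x \<noteq> y \<and> 0 < t \<and> t < 1 \<longrightarrow>
        f (t * x + (1 - t) * y) > t * f x + (1 - t) * f y)"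

definition aug_filtration :: "'a measure \<Rightarrow> (real \<Rightarrow> 'a \<Rightarrow> real) \<Rightarrow> real \<Rightarrow> 'a set set" where
  "aug_filtration M W t = sigma_sets (space M)
     ((\<Union>s\<in>{0..t}. {W s -` B \<inter> space M | B. B \<in> sets borel}) \<union> null_sets M)"

definition nat_sigma :: "'a measure \<Rightarrow> (real \<Rightarrow> 'a \<Rightarrow> real) \<Rightarrow> real \<Rightarrow> 'a set set" where
  "nat_sigma M W t = sigma_sets (space M)
     (\<Union>s\<in>{0..t}. {W s -` B \<inter> space M | B. B \<in> sets borel})"

definition brownian_motion :: "'a measure \<Rightarrow> (real \<Rightarrow> 'a \<Rightarrow> real) \<Rightarrow> bool" where
  "brownian_motion M W \<longleftrightarrow>
     (\<forall>t\<ge>0. W t \<in> borel_measurable M) \<and>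
     (\<forall>\<omega>\<in>space M. W 0 \<omega> = 0 \<and> continuous_on {0..} (\<lambda>t. W t \<omega>)) \<and>
     (\<forall>s t. 0 \<le> s \<and> s < t \<longrightarrow>
        distributed M lborel (\<lambda>\<omega>. W t \<omega> - W s \<omega>) (\<lambda>u. ennreal (normal_density 0 (sqrt (t - s)) u))) \<and>
     (\<forall>s t. 0 \<le> s \<and> s \<le> t \<longrightarrow>
        (\<forall>A\<in>nat_sigma M W s. \<forall>B\<in>sets borel.
           measure M (A \<inter> {\<omega>\<in>space M. W t \<omega> - W s \<omega> \<in> B})
             = measure M A * measure M {\<omega>\<in>space M. W t \<omega> - W s \<omega> \<in> B}))"

definition stopping_time_e :: "'a measure \<Rightarrow> (real \<Rightarrow> 'a set set) \<Rightarrow> ('a \<Rightarrow> ereal) \<Rightarrow> bool" where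
  "stopping_time_e M F \<tau> \<longleftrightarrow>
     (\<forall>\<omega>\<in>space M. 0 \<le> \<tau> \<omega>) \<and> (\<forall>t\<ge>0. {\<omega>\<in>space M. \<tau> \<omega> \<le> ereal t} \<in> F t)"

definition adapted_proc :: "'a measure \<Rightarrow> (real \<Rightarrow> 'a set set) \<Rightarrow> (real \<Rightarrow> 'a \<Rightarrow> real) \<Rightarrow> bool" where
  "adapted_proc M F Y \<longleftrightarrow> (\<forall>t\<ge>0. Y t \<in> borel_measurable (sigma (space M) (F t)))"

definition martingale_proc :: "'a measure \<Rightarrow> (real \<Rightarrow> 'a set set) \<Rightarrow> (real \<Rightarrow> 'a \<Rightarrow> real) \<Rightarrow> bool" where
  "martingale_proc M F Y \<longleftrightarrow> adapted_proc M F Y \<and> (\<forall>t\<ge>0. integrable M (Y t)) \<and>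
     (\<forall>s t. 0 \<le> s \<and> s \<le> t \<longrightarrow>
        (\<forall>A\<in>F s. (\<integral>\<omega>. indicator A \<omega> * Y t \<omega> \<partial>M) = (\<integral>\<omega>. indicator A \<omega> * Y s \<omega> \<partial>M)))"

definition stopped_proc :: "(real \<Rightarrow> 'a \<Rightarrow> real) \<Rightarrow> ('a \<Rightarrow> ereal) \<Rightarrow> real \<Rightarrow> 'a \<Rightarrow> real" where
  "stopped_proc Y \<tau> t \<omega> = Y (real_of_ereal (min (ereal t) (\<tau> \<omega>))) \<omega>"

definition cont_local_martingale :: "'a measure \<Rightarrow> (real \<Rightarrow> 'a set set) \<Rightarrow> (real \<Rightarrow> 'a \<Rightarrow> real) \<Rightarrow> bool" where
  "cont_local_martingale M F Y \<longleftrightarrow>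
     adapted_proc M F Y \<and>
     (\<forall>\<omega>\<in>space M. continuous_on {0..} (\<lambda>t. Y t \<omega>)) \<and>
     (\<exists>\<tau> :: nat \<Rightarrow> 'a \<Rightarrow> ereal. (\<forall>n. stopping_time_e M F (\<tau> n)) \<and>
        (\<forall>\<omega>\<in>space M. incseq (\<lambda>n. \<tau> n \<omega>) \<and> (\<lambda>n. \<tau> n \<omega>) \<longlonglongrightarrow> \<infinity>) \<and>
        (\<forall>n. martingale_proc M F (stopped_proc Y (\<tau> n))))"

text \<open>X is a continuous adapted process started at x with values in I such that
  M_t = X_t - x - \<integral>_0^t \<mu>(X_s) ds satisfies M = \<integral> \<sigma>(X) dW. Since the library has no
  stochastic integral, the latter is expressed equivalently through brackets:
  M, M W - \<integral>\<sigma>(X)ds and M^2 - \<integral>\<sigma>(X)^2ds are continuous local martingales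
  (i.e. \<langle>M,W\<rangle> = \<integral>\<sigma>(X)ds and \<langle>M\<rangle> = \<integral>\<sigma>(X)^2ds, which forces \<langle>M - \<integral>\<sigma>(X)dW\<rangle> = 0).\<close>
definition strong_solution ::
  "'a measure \<Rightarrow> (real \<Rightarrow> 'a set set) \<Rightarrow> (real \<Rightarrow> 'a \<Rightarrow> real) \<Rightarrow> real set \<Rightarrow>
   (real \<Rightarrow> real) \<Rightarrow> (real \<Rightarrow> real) \<Rightarrow> real \<Rightarrow> (real \<Rightarrow> 'a \<Rightarrow> real) \<Rightarrow> bool" where
  "strong_solution M F W I \<mu> \<sigma> x Y \<longleftrightarrow>
     adapted_proc M F Y \<and>
     (\<lambda>(\<omega>, t). Y t \<omega>) \<in> borel_measurable (M \<Otimes>\<^sub>M restrict_space lborel {0..}) \<and>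
     (\<forall>\<omega>\<in>space M. Y 0 \<omega> = x \<and> continuous_on {0..} (\<lambda>t. Y t \<omega>) \<and> (\<forall>t\<ge>0. Y t \<omega> \<in> I)) \<and>
     (let Mart = (\<lambda>t \<omega>. Y t \<omega> - x - (LINT s:{0..t}|lborel. \<mu> (Y s \<omega>))) in
        cont_local_martingale M F Mart \<and>
        cont_local_martingale M F (\<lambda>t \<omega>. Mart t \<omega> * W t \<omega> - (LINT s:{0..t}|lborel. \<sigma> (Y s \<omega>))) \<and>
        cont_local_martingale M F (\<lambda>t \<omega>. (Mart t \<omega>)\<^sup>2 - (LINT s:{0..t}|lborel. (\<sigma> (Y s \<omega>))\<^sup>2)))"

definition disc :: "real \<Rightarrow> ereal \<Rightarrow> real" where
  "disc r \<tau> = (if \<tau> = \<infinity> then 0 else exp (- r * real_of_ereal \<tau>))"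

definition value_fun ::
  "'a measure \<Rightarrow> (real \<Rightarrow> 'a set set) \<Rightarrow> (real \<Rightarrow> real \<Rightarrow> 'a \<Rightarrow> real) \<Rightarrow> (real \<Rightarrow> real \<Rightarrow> real) \<Rightarrow>
   real \<Rightarrow> real \<Rightarrow> real \<Rightarrow> real" where
  "value_fun M F X pic r x y =
     (INF \<tau> \<in> {\<tau>. stopping_time_e M F \<tau>}.
        \<integral>\<omega>. (LINT s:{s. 0 \<le> s \<and> ereal s < \<tau> \<omega>}|lborel. exp (- r * s) * pic (X x s \<omega>) y)
              + disc r (\<tau> \<omega>) \<partial>M)"

definition free_boundary ::
  "'a measure \<Rightarrow> (real \<Rightarrow> 'a set set) \<Rightarrow> (real \<Rightarrow> real \<Rightarrow> 'a \<Rightarrow> real) \<Rightarrow> (real \<Rightarrow> real \<Rightarrow> real) \<Rightarrow>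
   real \<Rightarrow> real \<Rightarrow> real" where
  "free_boundary M F X pic r x = Sup {y. 0 < y \<and> value_fun M F X pic r x y = 1}"

definition hitting_time :: "(real \<Rightarrow> 'a \<Rightarrow> real) \<Rightarrow> real \<Rightarrow> 'a \<Rightarrow> ereal" where
  "hitting_time Y z \<omega> = Inf (ereal ` {t. 0 \<le> t \<and> Y t \<omega> = z})"

definition scale_dens :: "(real \<Rightarrow> real) \<Rightarrow> (real \<Rightarrow> real) \<Rightarrow> real \<Rightarrow> real \<Rightarrow> real" where
  "scale_dens \<mu> \<sigma> x0 x = exp (- (LBINT u = ereal x0..ereal x. 2 * \<mu> u / (\<sigma> u)\<^sup>2))"

definition speed_dens :: "(real \<Rightarrow> real) \<Rightarrow> (real \<Rightarrow> real) \<Rightarrow> real \<Rightarrow> real \<Rightarrow> real" where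
  "speed_dens \<mu> \<sigma> x0 x = 2 / ((\<sigma> x)\<^sup>2 * scale_dens \<mu> \<sigma> x0 x)"

text \<open>Left-hand side of the integral equation (nonnegative integrands, so nonnegative integrals):
  \<psi>(x) \<integral>_x^{hi} (\<integral>_{lo}^z \<pi>_c(y,b(z)) \<psi>(y) m(dy)) s(dz)/\<psi>(z)^2.\<close>
definition int_eq_lhs ::
  "ereal \<Rightarrow> ereal \<Rightarrow> (real \<Rightarrow> real) \<Rightarrow> (real \<Rightarrow> real) \<Rightarrow> real \<Rightarrow> (real \<Rightarrow> real) \<Rightarrow>
   (real \<Rightarrow> real \<Rightarrow> real) \<Rightarrow> (real \<Rightarrow> real) \<Rightarrow> real \<Rightarrow> ennreal" where
  "int_eq_lhs lo hi \<mu> \<sigma> x0 \<psi> pic b x =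
     ennreal (\<psi> x) *
     (\<integral>\<^sup>+ z\<in>{z. ereal x < ereal z \<and> ereal z < hi}.
        (\<integral>\<^sup>+ y\<in>{y. lo < ereal y \<and> ereal y < ereal z}.
            ennreal (pic y (b z) * \<psi> y * speed_dens \<mu> \<sigma> x0 y) \<partial>lborel)
        * ennreal (scale_dens \<mu> \<sigma> x0 z / (\<psi> z)\<^sup>2) \<partial>lborel)"

end

theory Submission
  imports Defs
begin

text \<open>
Since \<open>e\<^bsup>-r \<tau>\<^esup> = 1 - \<integral>\<^sub>0\<^sup>\<tau> r e\<^bsup>-r s\<^esup> ds\<close>, one has \<open>v(x,y) = 1\<close> iff \<open>E \<integral>\<^sub>0\<^sup>\<tau> e\<^bsup>-r s\<^esup> g(X\<^sub>s) ds \<ge> 0\<close> for all stopping times \<open>\<tau>\<close>,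
where \<open>g = \<pi>\<^sub>c(\<cdot>,y) - r\<close> is nondecreasing. For \<open>\<Gamma>(z) = \<integral>\<^sub>l\<^sub>o\<^sup>z g \<psi> dm\<close> the function \<open>u = \<psi> \<integral>\<^sub>q\<^sup>z \<Gamma> ds / \<psi>\<^sup>2\<close>
solves \<open>(\<G> - r) u = - g\<close>, and Dynkin's formula shows that \<open>v(x,y) = 1\<close> iff \<open>\<Gamma>(x) \<ge> 0\<close>: if \<open>\<Gamma>(x) < 0\<close>, running
up to a level slightly above \<open>x\<close> is profitable; if \<open>\<Gamma>(x) \<ge> 0\<close>, then lowering \<open>g\<close> by the constant that makes
\<open>\<Gamma>(x)\<close> vanish gives a supersolution \<open>u \<le> 0\<close> with \<open>u(x) = 0\<close>, by the single crossing of \<open>\<Gamma>\<close>.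

With \<open>p = \<psi>'/s'\<close> one has \<open>r \<integral>\<^sub>l\<^sub>o\<^sup>x \<psi> dm = p(x)\<close>, because \<open>p\<close> tends to \<open>0\<close> at the unattainable end \<open>lo\<close>. Hence
\<open>b(x)\<close> is the unique root of \<open>\<integral>\<^sub>l\<^sub>o\<^sup>x \<pi>\<^sub>c(u,b) \<psi>(u) m(du) = p(x)\<close>, and the left-hand side of the integral equation
becomes \<open>\<psi>(x) \<integral>\<^sub>x\<^sup>h\<^sup>i \<psi>'/\<psi>\<^sup>2 = 1\<close>, because \<open>\<psi>\<close> is unbounded at the unattainable end \<open>hi\<close>. Conversely, if a nondecreasing
solution differed from \<open>b\<close> at \<open>x\<close>, monotonicity would keep the inner integral strictly on one side of \<open>p\<close> on an interval
with endpoint \<open>x\<close>, and the difference of the equations at its two ends would be violated.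
\<close>

section \<open>Optional stopping for continuous local martingales\<close>

text \<open>Two gaps remain between the overview and a proof. First, the equation for
  \<open>X\<close> is encoded by local martingales rather than by a stochastic integral, and it
  enters through \<open>N\<close> and \<open>N^2 - A\<close>, with \<open>N\<close> the martingale
  part and \<open>A\<close> its bracket. Dynkin's formula is therefore derived from a Taylor
  expansion along a grid: under the expectation the squared increments of \<open>N\<close> are
  exchanged for increments of \<open>A\<close>, and the error is paid by fourth powers of
  increments. Secondly, the behaviour of \<open>p\<close> at \<open>lo\<close> and of
  \<open>\<psi>\<close> at \<open>hi\<close> is not a hypothesis. Both are extracted from the fact
  that paths never leave the open interval. Estimates are made up to bounded exit times from compact
  subintervals; sending the lower level to \<open>lo\<close> is possible because
  \<open>\<bar>\<Gamma>\<bar> \<le> c * p\<close> bounds the candidate \<open>\<psi> K\<close>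
  uniformly down to \<open>lo\<close>. Sending the upper level to \<open>hi\<close> needs no such
  bound: there the candidate is nonpositive, and only its sign is used.\<close>

locale filtered_prob_space = prob_space M for M :: "'a measure" +
  fixes F :: "real \<Rightarrow> 'a set set"
  assumes F_algebra: "0 \<le> t \<Longrightarrow> sigma_algebra (space M) (F t)"
    and F_sub: "0 \<le> t \<Longrightarrow> F t \<subseteq> sets M"
    and F_mono: "0 \<le> s \<Longrightarrow> s \<le> t \<Longrightarrow> F s \<subseteq> F t"
begin

text \<open>The bare set system \<open>F t\<close> becomes a measure object (carrying the zero
  measure), so that \<open>borel_measurable\<close>, \<open>subalgebra\<close> and
  \<open>real_cond_exp\<close> apply; \<open>adapted_proc\<close> uses the same encoding.\<close>

definition G :: "real \<Rightarrow> 'a measure" where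
  "G t = sigma (space M) (F t)"

lemma space_G [simp]: "space (G t) = space M"
  by (simp add: G_def space_measure_of_conv)

lemma sets_G: "0 \<le> t \<Longrightarrow> sets (G t) = F t"
  unfolding G_def using sigma_algebra.sets_measure_of_eq[OF F_algebra] by simp

lemma subalgebra_G: "0 \<le> t \<Longrightarrow> subalgebra M (G t)"
  using F_sub sets_G by (auto simp: subalgebra_def)

lemma subalgebra_G_mono: "0 \<le> s \<Longrightarrow> s \<le> t \<Longrightarrow> subalgebra (G t) (G s)"
  using F_mono[of s t] sets_G[of s] sets_G[of t] by (auto simp: subalgebra_def)

lemma measurable_G_M: "0 \<le> t \<Longrightarrow> f \<in> borel_measurable (G t) \<Longrightarrow> f \<in> borel_measurable M"
  using measurable_from_subalg[OF subalgebra_G] by blast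

lemma measurable_G_mono: "0 \<le> s \<Longrightarrow> s \<le> t \<Longrightarrow> f \<in> borel_measurable (G s) \<Longrightarrow> f \<in> borel_measurable (G t)"
  using measurable_from_subalg[OF subalgebra_G_mono] by blast

lemma adapted_procD: "adapted_proc M F Y \<Longrightarrow> 0 \<le> t \<Longrightarrow> Y t \<in> borel_measurable (G t)"
  by (simp add: adapted_proc_def G_def)

text \<open>Hypothesis \<open>null\<close> says that the conditional expectation of \<open>D\<close>
  given \<open>F t\<close> is zero, and a bounded factor known at time \<open>t\<close> can be
  pulled through it. Martingale identities, which are given against indicators only, thereby extend
  to bounded weights.\<close>

lemma expectation_mult_eq_0:
  fixes c D :: "'a \<Rightarrow> real"
  assumes t: "0 \<le> t" and D: "integrable M D"
    and null: "\<And>A. A \<in> F t \<Longrightarrow> (\<integral>\<omega>. indicator A \<omega> * D \<omega> \<partial>M) = 0"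
    and c: "c \<in> borel_measurable (G t)" and C: "\<And>\<omega>. \<omega> \<in> space M \<Longrightarrow> \<bar>c \<omega>\<bar> \<le> C"
  shows "(\<integral>\<omega>. c \<omega> * D \<omega> \<partial>M) = 0"
proof -
  interpret S: finite_measure_subalgebra M "G t"
    by (standard) (rule subalgebra_G[OF t])
  have [measurable]: "c \<in> borel_measurable M" using c measurable_G_M t by blast
  have [measurable]: "D \<in> borel_measurable M" using D by (rule borel_measurable_integrable)
  have int: "integrable M (\<lambda>\<omega>. c \<omega> * D \<omega>)"
  proof (rule Bochner_Integration.integrable_bound[of M "\<lambda>\<omega>. C * D \<omega>"])
    show "AE \<omega> in M. norm (c \<omega> * D \<omega>) \<le> norm (C * D \<omega>)"
    proof (rule AE_I2)
      fix \<omega> assume "\<omega> \<in> space M"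
      then have "\<bar>c \<omega>\<bar> \<le> \<bar>C\<bar>" using C by (meson abs_ge_self order_trans)
      then show "norm (c \<omega> * D \<omega>) \<le> norm (C * D \<omega>)" by (simp add: abs_mult mult_right_mono)
    qed
  qed (use D in auto)
  have "AE \<omega> in M. real_cond_exp M (G t) D \<omega> = 0"
  proof (rule S.real_cond_exp_charact)
    fix A assume "A \<in> sets (G t)"
    then show "(\<integral>x\<in>A. D x \<partial>M) = (\<integral>x\<in>A. 0 \<partial>M)"
      using null[of A] sets_G[OF t] by (simp add: set_lebesgue_integral_def)
  qed (use D in auto)
  then have "(\<integral>\<omega>. c \<omega> * real_cond_exp M (G t) D \<omega> \<partial>M) = (\<integral>\<omega>. c \<omega> * 0 \<partial>M)"
    by (intro integral_cong_AE) auto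
  then show ?thesis
    using S.real_cond_exp_intg(2)[OF int c] by simp
qed

text \<open>Rounding \<open>R\<close> down to a grid of mesh 1/(k+1) gives countably many sampling
  times, and path continuity does the rest. The measure \<open>N\<close> is left open because the
  result is used for \<open>M\<close> as well as for \<open>G t\<close>.\<close>

lemma measurable_random_time:
  fixes Z :: "real \<Rightarrow> 'a \<Rightarrow> real"
  assumes t: "0 \<le> t" and Z: "\<And>q. 0 \<le> q \<Longrightarrow> q \<le> t \<Longrightarrow> Z q \<in> borel_measurable N"
    and cont: "\<And>\<omega>. \<omega> \<in> space N \<Longrightarrow> continuous_on {0..} (\<lambda>q. Z q \<omega>)"
    and R: "R \<in> borel_measurable N" "\<And>\<omega>. \<omega> \<in> space N \<Longrightarrow> 0 \<le> R \<omega>" "\<And>\<omega>. \<omega> \<in> space N \<Longrightarrow> R \<omega> \<le> t"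
  shows "(\<lambda>\<omega>. Z (R \<omega>) \<omega>) \<in> borel_measurable N"
proof (rule borel_measurable_LIMSEQ_real)
  note [measurable] = R(1)
  let ?g = "\<lambda>k \<omega>. nat \<lfloor>real (Suc k) * R \<omega>\<rfloor>"
  \<comment> \<open>The minimum with \<open>t\<close> does not alter the index that actually occurs,
    but keeps every candidate of the countable family inside \<open>[0, t]\<close>, where
    \<open>Z\<close> is known to be measurable.\<close>
  let ?r = "\<lambda>k \<omega>. min t (real (?g k \<omega>) / real (Suc k))"
  show "(\<lambda>\<omega>. Z (?r k \<omega>) \<omega>) \<in> borel_measurable N" for k
  proof (rule measurable_compose_countable[where f = "\<lambda>i \<omega>. Z (min t (real i / real (Suc k))) \<omega>"])
    show "?g k \<in> measurable N (count_space UNIV)" by measurable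
    show "(\<lambda>\<omega>. Z (min t (real i / real (Suc k))) \<omega>) \<in> borel_measurable N" for i
      using t by (intro Z) auto
  qed
  fix \<omega> assume w: "\<omega> \<in> space N"
  have bnd: "R \<omega> - 1 / real (Suc k) \<le> ?r k \<omega>" "?r k \<omega> \<le> R \<omega>" for k
  proof -
    have e: "real (?g k \<omega>) = of_int \<lfloor>real (Suc k) * R \<omega>\<rfloor>" 
      using R(2)[OF w] by simp
    have "real (?g k \<omega>) \<le> real (Suc k) * R \<omega>" unfolding e by simp
    then have "real (?g k \<omega>) / real (Suc k) \<le> R \<omega>" by (simp add: divide_simps mult.commute)
    then show "?r k \<omega> \<le> R \<omega>" by linarith
    have "real (Suc k) * R \<omega> - 1 \<le> real (?g k \<omega>)" unfolding e by linarith
    then have "R \<omega> - 1 / real (Suc k) \<le> real (?g k \<omega>) / real (Suc k)" 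
      by (simp add: divide_simps mult.commute)
    moreover have "0 < 1 / real (Suc k)" by simp
    ultimately show "R \<omega> - 1 / real (Suc k) \<le> ?r k \<omega>" using R(3)[OF w] by linarith
  qed
  have "(\<lambda>k. R \<omega> - 1 / real (Suc k)) \<longlonglongrightarrow> R \<omega> - 0"
    by (intro tendsto_intros LIMSEQ_Suc[OF lim_1_over_n])
  then have lim: "(\<lambda>k. ?r k \<omega>) \<longlonglongrightarrow> R \<omega>"
    using tendsto_sandwich[OF always_eventually always_eventually _ tendsto_const, 
        of "\<lambda>k. R \<omega> - 1 / real (Suc k)" "\<lambda>k. ?r k \<omega>" "R \<omega>"] bnd by simp
  show "(\<lambda>k. Z (?r k \<omega>) \<omega>) \<longlonglongrightarrow> Z (R \<omega>) \<omega>"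
  proof (rule continuous_on_tendsto_compose[OF cont[OF w] lim])
    show "R \<omega> \<in> {0..}" using R(2)[OF w] by simp
    have "0 \<le> ?r k \<omega>" for k using t by simp
    then show "\<forall>\<^sub>F k in sequentially. ?r k \<omega> \<in> {0..}" by (intro always_eventually) auto
  qed
qed

lemma measurable_min_stopping:
  assumes "0 \<le> t" "\<And>q. 0 \<le> q \<Longrightarrow> {\<omega>\<in>space M. S \<omega> \<le> q} \<in> F q" "\<And>\<omega>. \<omega> \<in> space M \<Longrightarrow> 0 \<le> S \<omega>"
  shows "(\<lambda>\<omega>. min t (S \<omega>)) \<in> borel_measurable (G t)"
proof (rule borel_measurableI_le)
  fix q
  show "{\<omega> \<in> space (G t). min t (S \<omega>) \<le> q} \<in> sets (G t)"
  proof (cases "0 \<le> q \<and> q < t")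
    case True
    then have "{\<omega> \<in> space (G t). min t (S \<omega>) \<le> q} = {\<omega>\<in>space M. S \<omega> \<le> q}" by auto
    also have "\<dots> \<in> F t" using assms(2)[of q] F_mono[of q t] True by auto
    finally show ?thesis using sets_G assms(1) by simp
  next
    case False
    then consider "q < 0" | "t \<le> q" by linarith
    then show ?thesis
    proof cases
      case 1
      then have "{\<omega> \<in> space (G t). min t (S \<omega>) \<le> q} = {}" using assms(1,3) by force
      then show ?thesis by (metis sets.empty_sets)
    next
      case 2
      then have "{\<omega> \<in> space (G t). min t (S \<omega>) \<le> q} = space (G t)" by auto
      then show ?thesis by (metis sets.top)
    qed
  qed
qed

text \<open>\<open>R n\<close> is \<open>Z\<close> at the grid time following \<open>S\<close>. Since \<open>R n - Z t\<close> is orthogonal to every bounded function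
  of \<open>R n\<close>, truncating at a level above the bound of \<open>Z\<close> at time \<open>S\<close> makes uniform integrability superfluous.\<close>
lemma optional_stopping:
  fixes Z :: "real \<Rightarrow> 'a \<Rightarrow> real"
  assumes mart: "martingale_proc M F Z"
    and cont: "\<And>\<omega>. \<omega> \<in> space M \<Longrightarrow> continuous_on {0..} (\<lambda>t. Z t \<omega>)"
    and S: "\<And>q. 0 \<le> q \<Longrightarrow> {\<omega>\<in>space M. S \<omega> \<le> q} \<in> F q"
    and st: "0 \<le> s" "s < t" and S_le: "\<And>\<omega>. \<omega> \<in> space M \<Longrightarrow> S \<omega> \<le> t" 
    and S_nn: "\<And>\<omega>. \<omega> \<in> space M \<Longrightarrow> 0 \<le> S \<omega>"
    and B: "\<And>\<omega>. \<omega> \<in> space M \<Longrightarrow> \<bar>Z (S \<omega>) \<omega>\<bar> \<le> B"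
    and A: "A \<in> F s"  and AS: "\<And>\<omega>. \<omega> \<in> A \<Longrightarrow> s < S \<omega>"
  shows "(\<integral>\<omega>. indicator A \<omega> * Z (S \<omega>) \<omega> \<partial>M) = (\<integral>\<omega>. indicator A \<omega> * Z t \<omega> \<partial>M)"
proof -
  have adZ: "Z q \<in> borel_measurable (G q)" if "0 \<le> q" for q
    using mart adapted_procD that by (auto simp: martingale_proc_def)
  have Zm: "Z q \<in> borel_measurable M" if "0 \<le> q" for q
    using adZ[OF that] measurable_G_M that by blast
  have Zi: "integrable M (Z q)" if "0 \<le> q" for q
    using mart that by (auto simp: martingale_proc_def)
  have t0: "0 \<le> t" using st by simp
  have "(\<lambda>\<omega>. min t (S \<omega>)) \<in> borel_measurable M"
    using measurable_G_M[OF t0 measurable_min_stopping[OF t0 S S_nn]] by blast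
  then have Sm: "S \<in> borel_measurable M"
    using S_le by (subst measurable_cong[where g = "\<lambda>\<omega>. min t (S \<omega>)"]) (simp_all add: min_absorb2)
  have Am: "A \<in> sets M" using A F_sub st by blast
  note [measurable] = Sm Am Zm[OF t0]
  define d where "d n = (t - s) / real (Suc n)" for n
  have d0: "0 < d n" for n using st by (simp add: d_def)
  \<comment> \<open>The index of the first grid point at or after \<open>S\<close>. On
    \<open>A\<close>, where \<open>s < S\<close>, it lies between 1 and \<open>Suc n\<close>, so
    only finitely many grid times occur.\<close>
  define j where "j n \<omega> = nat \<lceil>(S \<omega> - s) / d n\<rceil>" for n \<omega>
  define g where "g n i = s + d n * real i" for n i
  define R where "R n \<omega> = Z (g n (j n \<omega>)) \<omega>" for n \<omega>
  have g0: "0 \<le> g n i" for n i using st d0[of n] by (auto simp: g_def less_imp_le)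
  have jm[measurable]: "j n \<in> measurable M (count_space UNIV)" for n
    unfolding j_def by measurable
  have Rm[measurable]: "R n \<in> borel_measurable M" for n
    unfolding R_def by (rule measurable_compose_countable[where f = "\<lambda>i. Z (g n i)"]) 
       (auto intro: Zm g0)
  have Z_S[measurable]: "(\<lambda>\<omega>. Z (S \<omega>) \<omega>) \<in> borel_measurable M"
    by (rule measurable_random_time[OF t0]) (auto intro: Zm cont S_nn S_le)
  have jprop: "S \<omega> \<le> g n (j n \<omega>)" "g n (j n \<omega>) < S \<omega> + d n" "j n \<omega> \<le> Suc n" "1 \<le> j n \<omega>"
    if "\<omega> \<in> A" for n \<omega>
  proof -
    have w: "\<omega> \<in> space M" using that Am sets.sets_into_space by blast
    have p: "0 < (S \<omega> - s) / d n" using AS[OF that] d0[of n] by simp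
    have e: "real (j n \<omega>) = of_int \<lceil>(S \<omega> - s) / d n\<rceil>" unfolding j_def using p 
      by (simp add: of_nat_nat)
    have "(S \<omega> - s) / d n \<le> real (j n \<omega>)" unfolding e by linarith
    then show "S \<omega> \<le> g n (j n \<omega>)" using d0[of n] unfolding g_def by (simp add: field_simps)
    have "real (j n \<omega>) < (S \<omega> - s) / d n + 1" unfolding e by linarith
    then show "g n (j n \<omega>) < S \<omega> + d n" using d0[of n] unfolding g_def by (simp add: field_simps)
    have "(S \<omega> - s) / d n \<le> (t - s) / d n" using S_le[OF w] d0[of n] by (simp add: divide_right_mono)
    also have "\<dots> = real (Suc n)" unfolding d_def using st by (simp del: of_nat_Suc)
    finally have "(S \<omega> - s) / d n \<le> of_int (int (Suc n))" by simp
    then show "j n \<omega> \<le> Suc n" unfolding j_def by (metis ceiling_le nat_le_iff)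
    show "1 \<le> j n \<omega>" using p unfolding j_def by linarith
  qed
  have jle: "j n \<omega> \<le> i \<longleftrightarrow> S \<omega> \<le> g n i" if "\<omega> \<in> space M" "i \<ge> 1" for n i \<omega>
  proof -
    have "j n \<omega> \<le> i \<longleftrightarrow> (S \<omega> - s) / d n \<le> real i"
      unfolding j_def by (simp add: nat_le_iff ceiling_le_iff)
    also have "\<dots> \<longleftrightarrow> S \<omega> \<le> g n i" using d0[of n] unfolding g_def by (auto simp: field_simps)
    finally show ?thesis .
  qed
  \<comment> \<open>The cut at \<open>B + 1\<close> instead of \<open>B\<close> leaves a margin:
    \<open>R n\<close> converges to a value of modulus at most \<open>B\<close>, so
    \<open>\<phi> (R n)\<close> is eventually 1.\<close>
  define \<phi> :: "real \<Rightarrow> real" where "\<phi> z = (if \<bar>z\<bar> \<le> B + 1 then 1 else 0)" for z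
  have [measurable]: "\<phi> \<in> borel_measurable borel" unfolding \<phi>_def by measurable
  have \<phi>1: "\<bar>\<phi> z\<bar> \<le> 1" for z by (simp add: \<phi>_def)
  have B0: "0 \<le> B" using not_empty B by (meson abs_ge_zero all_not_in_conv order_trans)
  have \<phi>z: "\<bar>\<phi> z * z\<bar> \<le> B + 1" for z using B0 by (auto simp: \<phi>_def)
  \<comment> \<open>The event is a difference of two level sets of \<open>S\<close>. For
    \<open>i = 1\<close> nothing has to be subtracted, because \<open>A\<close> already forces
    \<open>s < S\<close>.\<close>
  have E[measurable]: "A \<inter> {\<omega>\<in>space M. j n \<omega> = i} \<in> F (g n i)" if "1 \<le> i" for n i
  proof -
    interpret sigma_algebra "space M" "F (g n i)" by (rule F_algebra[OF g0])
    have 1: "A \<in> F (g n i)" using A F_mono[of s "g n i"] st d0[of n] by (auto simp: g_def less_imp_le)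
    have 2: "{\<omega>\<in>space M. S \<omega> \<le> g n i} \<in> F (g n i)" using S g0 by auto
    show ?thesis
    proof (cases "i = 1")
      case True
      have "A \<inter> {\<omega>\<in>space M. j n \<omega> = i} = A \<inter> {\<omega>\<in>space M. S \<omega> \<le> g n i}"
        using jle[of _ i n] jprop(4)[of _ n] True by force
      then show ?thesis using 1 2 by auto
    next
      case False
      then have i: "1 \<le> i - 1" using that by simp
      have 3: "{\<omega>\<in>space M. S \<omega> \<le> g n (i - 1)} \<in> F (g n i)" 
        using S[OF g0[of n "i - 1"]] F_mono[OF g0[of n "i-1"], of "g n i"] d0[of n] by (auto simp: g_def)
      have "A \<inter> {\<omega>\<in>space M. j n \<omega> = i} = A \<inter> {\<omega>\<in>space M. S \<omega> \<le> g n i} - {\<omega>\<in>space M. S \<omega> \<le> g n (i - 1)}"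
        using jle[of _ i n] jle[of _ "i-1" n] that i by force
      then show ?thesis using 1 2 3 by auto
    qed
  qed
  \<comment> \<open>Split by the value \<open>i\<close> of \<open>j n\<close>. On each piece
    \<open>R n\<close> is \<open>Z\<close> at the fixed time \<open>g n i\<close>, the weight is
    bounded and known at that time, and the increment up to \<open>t\<close> is orthogonal to
    it.\<close>
  have key: "(\<integral>\<omega>. indicator A \<omega> * \<phi> (R n \<omega>) * (R n \<omega> - Z t \<omega>) \<partial>M) = 0" for n
  proof -
    let ?f = "\<lambda>i \<omega>. (indicator (A \<inter> {\<omega>\<in>space M. j n \<omega> = i}) \<omega> * \<phi> (Z (g n i) \<omega>)) * (Z (g n i) \<omega> - Z t \<omega>)"
    have gt: "g n i \<le> t" if "i \<le> Suc n" for i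
    proof -
      have "d n * real i \<le> d n * real (Suc n)" using that d0[of n] by (intro mult_left_mono) auto
      also have "\<dots> = t - s" by (simp add: d_def)
      finally show ?thesis by (simp add: g_def)
    qed
    have f0: "integrable M (?f i) \<and> integral\<^sup>L M (?f i) = 0" if i: "i \<in> {1..Suc n}" for i
    proof
      have c: "(\<lambda>\<omega>. indicator (A \<inter> {\<omega>\<in>space M. j n \<omega> = i}) \<omega> * \<phi> (Z (g n i) \<omega>)) \<in> borel_measurable (G (g n i))"
      proof (rule borel_measurable_times)
        show "indicator (A \<inter> {\<omega>\<in>space M. j n \<omega> = i}) \<in> borel_measurable (G (g n i))"
          using E[of i n] i sets_G[OF g0[of n i]] by (intro borel_measurable_indicator) simp
        show "(\<lambda>\<omega>. \<phi> (Z (g n i) \<omega>)) \<in> borel_measurable (G (g n i))"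
          by (rule measurable_compose[OF adZ[OF g0]]) measurable
      qed
      have D: "integrable M (\<lambda>\<omega>. Z (g n i) \<omega> - Z t \<omega>)" using Zi g0 t0 by auto
      have C: "\<bar>indicator (A \<inter> {\<omega>\<in>space M. j n \<omega> = i}) \<omega> * \<phi> (Z (g n i) \<omega>)\<bar> \<le> 1" for \<omega>
        using \<phi>1 by (auto simp: indicator_def)
      show "integral\<^sup>L M (?f i) = 0"
      proof (rule expectation_mult_eq_0[OF g0 D _ c C])
        fix D assume "D \<in> F (g n i)"
        then have "(\<integral>\<omega>. indicator D \<omega> * Z t \<omega> \<partial>M) = (\<integral>\<omega>. indicator D \<omega> * Z (g n i) \<omega> \<partial>M)"
          using mart gt[of i] i g0[of n i] unfolding martingale_proc_def by auto
        moreover have "D \<in> sets M" using \<open>D \<in> F (g n i)\<close> F_sub g0 by blast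
        ultimately show "(\<integral>\<omega>. indicator D \<omega> * (Z (g n i) \<omega> - Z t \<omega>) \<partial>M) = 0"
          using integrable_real_mult_indicator[OF _ Zi] g0 t0 by (simp add: right_diff_distrib mult.commute)
      qed
      show "integrable M (?f i)"
      proof (rule Bochner_Integration.integrable_bound[OF D])
        show "?f i \<in> borel_measurable M" using measurable_G_M[OF g0 c] D by measurable
        show "AE \<omega> in M. norm (?f i \<omega>) \<le> norm (Z (g n i) \<omega> - Z t \<omega>)"
          using C by (intro AE_I2) (auto simp: abs_mult[of "_ * _"] intro!: mult_left_le_one_le[of "\<bar>_\<bar>"])
      qed
    qed
    have "(\<integral>\<omega>. indicator A \<omega> * \<phi> (R n \<omega>) * (R n \<omega> - Z t \<omega>) \<partial>M) = (\<integral>\<omega>. (\<Sum>i\<in>{1..Suc n}. ?f i \<omega>) \<partial>M)"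
    proof (rule Bochner_Integration.integral_cong[OF refl])
      fix \<omega> assume w: "\<omega> \<in> space M"
      show "indicator A \<omega> * \<phi> (R n \<omega>) * (R n \<omega> - Z t \<omega>) = (\<Sum>i\<in>{1..Suc n}. ?f i \<omega>)"
      proof (cases "\<omega> \<in> A")
        case True
        have "(\<Sum>i\<in>{1..Suc n}. ?f i \<omega>) = (\<Sum>i\<in>{1..Suc n}. if i = j n \<omega> then \<phi> (R n \<omega>) * (R n \<omega> - Z t \<omega>) else 0)"
          by (rule sum.cong) (use True w in \<open>auto simp: R_def indicator_def\<close>)
        also have "\<dots> = \<phi> (R n \<omega>) * (R n \<omega> - Z t \<omega>)"
          using jprop(3,4)[OF True, of n] by (subst sum.delta) auto
        finally show ?thesis using True by simp
      next
        case False then show ?thesis by simp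
      qed
    qed
    also have "\<dots> = (\<Sum>i\<in>{1..Suc n}. integral\<^sup>L M (?f i))"
      using f0 by (intro Bochner_Integration.integral_sum) auto
    also have "\<dots> = 0" using f0 by simp
    finally show ?thesis .
  qed
  have lim: "(\<lambda>n. R n \<omega>) \<longlonglongrightarrow> Z (S \<omega>) \<omega>" if "\<omega> \<in> A" for \<omega>
  proof -
    have w: "\<omega> \<in> space M" using that Am sets.sets_into_space by blast
    have "(\<lambda>n. S \<omega> + d n) \<longlonglongrightarrow> S \<omega> + 0" unfolding d_def
      by (intro tendsto_intros LIMSEQ_Suc[OF lim_const_over_n])
    then have "(\<lambda>n. g n (j n \<omega>)) \<longlonglongrightarrow> S \<omega>"
      using tendsto_sandwich[OF always_eventually always_eventually tendsto_const, 
        of "S \<omega>" "\<lambda>n. g n (j n \<omega>)" "\<lambda>n. S \<omega> + d n"] jprop(1,2)[OF that] by (simp add: less_imp_le)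
    then show ?thesis unfolding R_def
      by (rule continuous_on_tendsto_compose[OF cont[OF w]]) (use S_nn[OF w] g0 in \<open>simp_all add: always_eventually\<close>)
  qed
  have lim\<phi>: "(\<lambda>n. \<phi> (R n \<omega>)) \<longlonglongrightarrow> 1" if "\<omega> \<in> A" for \<omega>
  proof -
    have w: "\<omega> \<in> space M" using that Am sets.sets_into_space by blast
    have "\<forall>\<^sub>F n in sequentially. \<bar>R n \<omega>\<bar> < B + 1"
      by (rule order_tendstoD(2)[OF tendsto_rabs[OF lim[OF that]]]) (use B[OF w] in auto)
    then have "\<forall>\<^sub>F n in sequentially. \<phi> (R n \<omega>) = 1" by eventually_elim (auto simp: \<phi>_def)
    then show ?thesis by (rule tendsto_eventually)
  qed
  have L1: "(\<lambda>n. \<integral>\<omega>. indicator A \<omega> * (\<phi> (R n \<omega>) * R n \<omega>) \<partial>M) \<longlonglongrightarrow> (\<integral>\<omega>. indicator A \<omega> * (1 * Z (S \<omega>) \<omega>) \<partial>M)"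
  proof (rule integral_dominated_convergence[where w = "\<lambda>_. B + 1"])
    show "AE \<omega> in M. (\<lambda>n. indicator A \<omega> * (\<phi> (R n \<omega>) * R n \<omega>)) \<longlonglongrightarrow> indicator A \<omega> * (1 * Z (S \<omega>) \<omega>)"
      using tendsto_mult[OF lim\<phi> lim] by (intro AE_I2) (auto simp: indicator_def)
    show "\<And>n. AE \<omega> in M. norm (indicator A \<omega> * (\<phi> (R n \<omega>) * R n \<omega>)) \<le> B + 1"
      using \<phi>z B0 by (intro AE_I2) (auto simp: indicator_def)
  qed auto
  \<comment> \<open>Orthogonality has moved the untruncated factor to the fixed integrable variable
    \<open>Z t\<close>, which dominates the whole sequence.\<close>
  have L2: "(\<lambda>n. \<integral>\<omega>. indicator A \<omega> * (\<phi> (R n \<omega>) * Z t \<omega>) \<partial>M) \<longlonglongrightarrow> (\<integral>\<omega>. indicator A \<omega> * (1 * Z t \<omega>) \<partial>M)"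
  proof (rule integral_dominated_convergence[where w = "\<lambda>\<omega>. \<bar>Z t \<omega>\<bar>"])
    show "AE \<omega> in M. (\<lambda>n. indicator A \<omega> * (\<phi> (R n \<omega>) * Z t \<omega>)) \<longlonglongrightarrow> indicator A \<omega> * (1 * Z t \<omega>)"
      using tendsto_mult[OF lim\<phi> tendsto_const] by (intro AE_I2) (fastforce simp: indicator_def)
    show "\<And>n. AE \<omega> in M. norm (indicator A \<omega> * (\<phi> (R n \<omega>) * Z t \<omega>)) \<le> \<bar>Z t \<omega>\<bar>"
      by (intro AE_I2) (auto simp: indicator_def \<phi>_def)
    show "integrable M (\<lambda>\<omega>. \<bar>Z t \<omega>\<bar>)" using Zi[OF t0] by simp
  qed auto
  have eq: "(\<integral>\<omega>. indicator A \<omega> * (\<phi> (R n \<omega>) * R n \<omega>) \<partial>M) = (\<integral>\<omega>. indicator A \<omega> * (\<phi> (R n \<omega>) * Z t \<omega>) \<partial>M)" for n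
  proof -
    have i1: "integrable M (\<lambda>\<omega>. indicator A \<omega> * (\<phi> (R n \<omega>) * R n \<omega>))"
      by (rule integrable_const_bound[where B = "B + 1"]) (use \<phi>z B0 in \<open>auto simp: indicator_def\<close>)
    have i2: "integrable M (\<lambda>\<omega>. indicator A \<omega> * (\<phi> (R n \<omega>) * Z t \<omega>))"
      by (rule Bochner_Integration.integrable_bound[OF Zi[OF t0]]) (auto simp: indicator_def \<phi>_def)
    have "(\<integral>\<omega>. indicator A \<omega> * (\<phi> (R n \<omega>) * R n \<omega>) - indicator A \<omega> * (\<phi> (R n \<omega>) * Z t \<omega>) \<partial>M) = 0"
      using key[of n] by (simp add: algebra_simps)
    then show ?thesis using i1 i2 by simp
  qed
  show ?thesis using LIMSEQ_unique[OF L1 L2[folded eq]] by simp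
qed


text \<open>Boundedness undoes the localisation. On the part of \<open>A\<close> where
  \<open>s < S\<close>, optional stopping at \<open>min t (S \<omega>)\<close> and the martingale
  property between \<open>s\<close> and \<open>t\<close> apply to each localised process; on the
  rest the two stopped values coincide. The bound \<open>B\<close> then permits the limit along the
  localising sequence.\<close>

lemma local_martingale_stopped:
  fixes N :: "real \<Rightarrow> 'a \<Rightarrow> real"
  assumes mart: "cont_local_martingale M F N"
    and S: "\<And>q. 0 \<le> q \<Longrightarrow> {\<omega>\<in>space M. S \<omega> \<le> q} \<in> F q" "\<And>\<omega>. \<omega> \<in> space M \<Longrightarrow> 0 \<le> S \<omega>"
    and st: "0 \<le> s" "s \<le> t"
    and B: "\<And>\<omega> q. \<omega> \<in> space M \<Longrightarrow> 0 \<le> q \<Longrightarrow> q \<le> t \<Longrightarrow> \<bar>N (min q (S \<omega>)) \<omega>\<bar> \<le> B"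
    and A: "A \<in> F s"
  shows "(\<integral>\<omega>. indicator A \<omega> * (N (min t (S \<omega>)) \<omega> - N (min s (S \<omega>)) \<omega>) \<partial>M) = 0"
proof (cases "s = t")
  case False
  then have st': "s < t" using st by simp
  have t0: "0 \<le> t" using st by simp
  obtain \<tau> :: "nat \<Rightarrow> 'a \<Rightarrow> ereal" where \<tau>: "\<And>n. stopping_time_e M F (\<tau> n)"
    "\<And>\<omega>. \<omega> \<in> space M \<Longrightarrow> (\<lambda>n. \<tau> n \<omega>) \<longlonglongrightarrow> \<infinity>" "\<And>n. martingale_proc M F (stopped_proc N (\<tau> n))"
    using mart unfolding cont_local_martingale_def by blast
  have contN: "continuous_on {0..} (\<lambda>t. N t \<omega>)" if "\<omega> \<in> space M" for \<omega>
    using mart that unfolding cont_local_martingale_def by blast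
  have adN: "N q \<in> borel_measurable (G q)" if "0 \<le> q" for q
    using mart adapted_procD that unfolding cont_local_martingale_def by blast
  have \<tau>0: "0 \<le> \<tau> n \<omega>" if "\<omega> \<in> space M" for n \<omega>
    using \<tau>(1)[of n] that unfolding stopping_time_e_def by blast
  define \<rho> where "\<rho> n \<omega> q = real_of_ereal (min (ereal q) (\<tau> n \<omega>))" for n \<omega> q
  have \<rho>_alt: "\<rho> n \<omega> q = (if \<tau> n \<omega> = \<infinity> then q else min q (real_of_ereal (\<tau> n \<omega>)))" if "\<omega> \<in> space M" for n \<omega> q
    using \<tau>0[OF that, of n] unfolding \<rho>_def by (cases "\<tau> n \<omega>") (auto simp: min_def)
  have real0: "0 \<le> real_of_ereal (\<tau> n \<omega>)" if "\<omega> \<in> space M" for n \<omega>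
    using \<tau>0[OF that, of n] by (simp add: real_of_ereal_pos)
  have \<rho>b: "0 \<le> \<rho> n \<omega> q" "\<rho> n \<omega> q \<le> q" if "\<omega> \<in> space M" "0 \<le> q" for n \<omega> q
    using \<rho>_alt[OF that(1)] real0[OF that(1), of n] that by auto
  have \<rho>ev: "\<forall>\<^sub>F n in sequentially. \<rho> n \<omega> q = q" if "\<omega> \<in> space M" for \<omega> q
  proof -
    have "\<forall>\<^sub>F n in sequentially. ereal q < \<tau> n \<omega>"
      using order_tendstoD(1)[OF \<tau>(2)[OF that], of "ereal q"] by simp
    then show ?thesis by eventually_elim (auto simp: \<rho>_def min_def)
  qed
  define Z where "Z n = stopped_proc N (\<tau> n)" for n
  have Z_eq: "Z n q \<omega> = N (\<rho> n \<omega> q) \<omega>" for n q \<omega>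
    by (simp add: Z_def stopped_proc_def \<rho>_def)
  have contZ: "continuous_on {0..} (\<lambda>t. Z n t \<omega>)" if "\<omega> \<in> space M" for n \<omega>
  proof -
    have "continuous_on {0..} (\<lambda>q. \<rho> n \<omega> q)"
      unfolding \<rho>_alt[OF that] by (cases "\<tau> n \<omega> = \<infinity>") (auto intro!: continuous_intros)
    then show ?thesis unfolding Z_eq
      by (rule continuous_on_compose2[OF contN[OF that]]) (use \<rho>b[OF that] in auto)
  qed
  define T where "T \<omega> = min t (S \<omega>)" for \<omega>
  have Tst: "{\<omega>\<in>space M. T \<omega> \<le> q} \<in> F q" if "0 \<le> q" for q
  proof (cases "q < t")
    case True
    then have "{\<omega>\<in>space M. T \<omega> \<le> q} = {\<omega>\<in>space M. S \<omega> \<le> q}" by (auto simp: T_def)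
    then show ?thesis using S(1)[OF that] by simp
  next
    case False
    then have "{\<omega>\<in>space M. T \<omega> \<le> q} = space M" by (auto simp: T_def)
    then show ?thesis using sets_G[OF that] sets.top[of "G q"] by simp
  qed
  define A' where "A' = A \<inter> {\<omega>\<in>space M. s < S \<omega>}"
  have Asp: "A \<in> sets M" using A F_sub st by blast
  have A': "A' \<in> F s"
  proof -
    interpret sigma_algebra "space M" "F s" by (rule F_algebra[OF st(1)])
    have "A' = A - {\<omega>\<in>space M. S \<omega> \<le> s}" unfolding A'_def using Asp sets.sets_into_space[of A M] by auto
    then show ?thesis using A S(1)[OF st(1)] by auto
  qed
  have A'M: "A' \<in> sets M" using A' F_sub st by blast
  have T0: "0 \<le> T \<omega>" "T \<omega> \<le> t" if "\<omega> \<in> space M" for \<omega> using S(2)[OF that] t0 by (auto simp: T_def)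
  \<comment> \<open>Cutting at the localising time after cutting at \<open>S\<close> still evaluates
    \<open>N\<close> at a time of the form \<open>min q (S \<omega>)\<close>, and this is the form
    in which the bound \<open>B\<close> is available.\<close>
  have ZT: "Z n (T \<omega>) \<omega> = N (min (\<rho> n \<omega> (T \<omega>)) (S \<omega>)) \<omega>" if "\<omega> \<in> space M" for n \<omega>
    using \<rho>b(2)[OF that T0(1)[OF that], of n] by (simp add: Z_eq T_def min_absorb1)
  have Z_bd: "\<bar>Z n (T \<omega>) \<omega>\<bar> \<le> B" if "\<omega> \<in> space M" for n \<omega>
    unfolding ZT[OF that] using \<rho>b[OF that T0(1)[OF that], of n] T0(2)[OF that]
    by (intro B[OF that]) auto
  define U where "U \<omega> = min s (S \<omega>)" for \<omega>
  have U0: "0 \<le> U \<omega>" "U \<omega> \<le> s" if "\<omega> \<in> space M" for \<omega> using S(2)[OF that] st by (auto simp: U_def)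
  have ZU: "Z n (U \<omega>) \<omega> = N (min (\<rho> n \<omega> (U \<omega>)) (S \<omega>)) \<omega>" if "\<omega> \<in> space M" for n \<omega>
    using \<rho>b(2)[OF that U0(1)[OF that], of n] by (simp add: Z_eq U_def min_absorb1)
  have Z_bdU: "\<bar>Z n (U \<omega>) \<omega>\<bar> \<le> B" if "\<omega> \<in> space M" for n \<omega>
    unfolding ZU[OF that] using \<rho>b[OF that U0(1)[OF that], of n] U0(2)[OF that] st
    by (intro B[OF that]) auto
  have Zm: "Z n q \<in> borel_measurable M" if "0 \<le> q" for n q
    using \<tau>(3)[of n] adapted_procD measurable_G_M that unfolding Z_def martingale_proc_def by blast
  have Zi: "integrable M (Z n q)" if "0 \<le> q" for n q
    using \<tau>(3)[of n] that unfolding Z_def martingale_proc_def by blast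
  have Tm[measurable]: "T \<in> borel_measurable M" and Um[measurable]: "U \<in> borel_measurable M"
    unfolding T_def U_def using measurable_G_M measurable_min_stopping[OF _ S] st t0 by blast+
  have ZTm[measurable]: "(\<lambda>\<omega>. Z n (T \<omega>) \<omega>) \<in> borel_measurable M" for n
    by (rule measurable_random_time[OF t0]) (auto intro: Zm contZ T0)
  have ZUm[measurable]: "(\<lambda>\<omega>. Z n (U \<omega>) \<omega>) \<in> borel_measurable M" for n
    by (rule measurable_random_time[OF st(1)]) (auto intro: Zm contZ U0)
  note [measurable] = Asp A'M Zm[OF st(1)]
  have step: "(\<integral>\<omega>. indicator A \<omega> * (Z n (T \<omega>) \<omega> - Z n (U \<omega>) \<omega>) \<partial>M) = 0" for n
  proof -
    have "(\<integral>\<omega>. indicator A' \<omega> * Z n (T \<omega>) \<omega> \<partial>M) = (\<integral>\<omega>. indicator A' \<omega> * Z n t \<omega> \<partial>M)"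
      by (rule optional_stopping[OF _ _ Tst st(1) st'])
        (use \<tau>(3) contZ T0 Z_bd A' st' in \<open>auto simp: Z_def[symmetric] A'_def T_def\<close>)
    also have "\<dots> = (\<integral>\<omega>. indicator A' \<omega> * Z n s \<omega> \<partial>M)"
      using \<tau>(3)[of n] A' st unfolding martingale_proc_def Z_def by blast
    finally have eq: "(\<integral>\<omega>. indicator A' \<omega> * Z n (T \<omega>) \<omega> \<partial>M) = (\<integral>\<omega>. indicator A' \<omega> * Z n s \<omega> \<partial>M)" .
    have i1: "integrable M (\<lambda>\<omega>. indicator A' \<omega> * Z n (T \<omega>) \<omega>)"
    proof (rule integrable_const_bound[where B = "\<bar>B\<bar>"])
      show "AE \<omega> in M. norm (indicator A' \<omega> * Z n (T \<omega>) \<omega>) \<le> \<bar>B\<bar>"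
        by (intro AE_I2) (use Z_bd in \<open>auto simp: indicator_def intro: order_trans[OF _ abs_ge_self]\<close>)
    qed measurable
    have i2: "integrable M (\<lambda>\<omega>. indicator A' \<omega> * Z n s \<omega>)"
      using integrable_real_mult_indicator[OF A'M Zi[OF st(1)]] by (simp add: mult.commute)
    have "(\<integral>\<omega>. indicator A \<omega> * (Z n (T \<omega>) \<omega> - Z n (U \<omega>) \<omega>) \<partial>M) = 
      (\<integral>\<omega>. indicator A' \<omega> * Z n (T \<omega>) \<omega> - indicator A' \<omega> * Z n s \<omega> \<partial>M)"
      by (intro Bochner_Integration.integral_cong) 
         (use st' in \<open>auto simp: A'_def T_def U_def min_def indicator_def\<close>)
    also have "\<dots> = 0" using i1 i2 eq by simp
    finally show ?thesis .
  qed
  have "(\<lambda>n. \<integral>\<omega>. indicator A \<omega> * (Z n (T \<omega>) \<omega> - Z n (U \<omega>) \<omega>) \<partial>M) \<longlonglongrightarrow>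
    (\<integral>\<omega>. indicator A \<omega> * (N (T \<omega>) \<omega> - N (U \<omega>) \<omega>) \<partial>M)"
  proof (rule integral_dominated_convergence[where w = "\<lambda>_. 2 * B"])
    have Nm: "N q \<in> borel_measurable M" if "0 \<le> q" for q using adN measurable_G_M that by blast
    have [measurable]: "(\<lambda>\<omega>. N (T \<omega>) \<omega>) \<in> borel_measurable M"
      by (rule measurable_random_time[OF t0]) (auto intro: Nm contN T0)
    have [measurable]: "(\<lambda>\<omega>. N (U \<omega>) \<omega>) \<in> borel_measurable M"
      by (rule measurable_random_time[OF st(1)]) (auto intro: Nm contN U0)
    show "(\<lambda>\<omega>. indicator A \<omega> * (N (T \<omega>) \<omega> - N (U \<omega>) \<omega>)) \<in> borel_measurable M" by measurable
    show "AE \<omega> in M. (\<lambda>n. indicator A \<omega> * (Z n (T \<omega>) \<omega> - Z n (U \<omega>) \<omega>)) \<longlonglongrightarrow> indicator A \<omega> * (N (T \<omega>) \<omega> - N (U \<omega>) \<omega>)"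
    proof (rule AE_I2)
      fix \<omega> assume w: "\<omega> \<in> space M"
      have "\<forall>\<^sub>F n in sequentially. indicator A \<omega> * (Z n (T \<omega>) \<omega> - Z n (U \<omega>) \<omega>) = indicator A \<omega> * (N (T \<omega>) \<omega> - N (U \<omega>) \<omega>)"
        using \<rho>ev[OF w, of "T \<omega>"] \<rho>ev[OF w, of "U \<omega>"] by eventually_elim (simp add: Z_eq)
      then show "(\<lambda>n. indicator A \<omega> * (Z n (T \<omega>) \<omega> - Z n (U \<omega>) \<omega>)) \<longlonglongrightarrow> indicator A \<omega> * (N (T \<omega>) \<omega> - N (U \<omega>) \<omega>)"
        by (rule tendsto_eventually)
    qed
    show "AE \<omega> in M. norm (indicator A \<omega> * (Z n (T \<omega>) \<omega> - Z n (U \<omega>) \<omega>)) \<le> 2 * B" for n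
    proof (rule AE_I2)
      fix \<omega> assume w: "\<omega> \<in> space M"
      show "norm (indicator A \<omega> * (Z n (T \<omega>) \<omega> - Z n (U \<omega>) \<omega>)) \<le> 2 * B"
        using Z_bd[OF w, of n] Z_bdU[OF w, of n] by (auto simp: indicator_def)
    qed
  qed auto
  then have "(\<lambda>n. 0::real) \<longlonglongrightarrow> (\<integral>\<omega>. indicator A \<omega> * (N (T \<omega>) \<omega> - N (U \<omega>) \<omega>) \<partial>M)" unfolding step .
  then have "(\<integral>\<omega>. indicator A \<omega> * (N (T \<omega>) \<omega> - N (U \<omega>) \<omega>) \<partial>M) = 0"
    using LIMSEQ_unique tendsto_const by blast
  then show ?thesis by (simp add: T_def U_def)
qed simp

end

section \<open>Second-order Taylor expansion of one increment\<close>

lemma compact_interval_bound: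
  fixes f :: "real \<Rightarrow> real"
  assumes "continuous_on {a..b} f"
  obtains K where "0 \<le> K" "\<And>x. x \<in> {a..b} \<Longrightarrow> \<bar>f x\<bar> \<le> K"
proof -
  have "bounded (f ` {a..b})" using assms compact_continuous_image compact_imp_bounded by blast
  then obtain K where K: "\<And>x. x \<in> {a..b} \<Longrightarrow> \<bar>f x\<bar> \<le> K" unfolding bounded_iff real_norm_def by blast
  show thesis
    by (rule that[of "\<bar>K\<bar>"]) (auto intro: order_trans[OF K abs_ge_self])
qed

text \<open>With \<open>u2\<close> merely continuous the remainder has no rate. Uniform continuity
  pays for small increments with a small multiple of \<open>dn^2\<close>; large increments are
  pushed into \<open>dn ^ 4\<close> by a crude bound on \<open>u2\<close>; the drift part
  \<open>dd\<close> is of order \<open>\<delta>\<close> and costs \<open>\<delta>^2\<close>. The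
  sums of these three quantities over a grid can be controlled.\<close>

lemma second_order_remainder_bound:
  fixes u u1 u2 :: "real \<Rightarrow> real"
  assumes u: "\<And>x. x \<in> {a..b} \<Longrightarrow> (u has_real_derivative u1 x) (at x)"
    and u1: "\<And>x. x \<in> {a..b} \<Longrightarrow> (u1 has_real_derivative u2 x) (at x)"
    and cont: "continuous_on {a..b} u2" and \<eta>: "0 < \<eta>" and T: "0 \<le> T"
  obtains D where "0 \<le> D" 
    "\<And>y y' dn dd \<delta>. y \<in> {a..b} \<Longrightarrow> y' \<in> {a..b} \<Longrightarrow> y' - y = dn + dd \<Longrightarrow> \<bar>dd\<bar> \<le> C * \<delta> \<Longrightarrow> 0 \<le> \<delta> \<Longrightarrow> \<delta> \<le> T \<Longrightarrow>
      \<bar>u y' - u y - u1 y * (dn + dd) - u2 y / 2 * dn\<^sup>2\<bar> \<le> \<eta> * dn\<^sup>2 + D * (\<delta>\<^sup>2 + dn ^ 4)"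
proof -
  obtain H where H: "0 \<le> H" "\<And>x. x \<in> {a..b} \<Longrightarrow> \<bar>u2 x\<bar> \<le> H"
    by (rule compact_interval_bound[OF cont]) blast
  \<comment> \<open>The coefficient of \<open>dn^2\<close> collected at the end is
    \<open>e + H * e / 2\<close>, one part from the oscillation of \<open>u2\<close> and one from
    replacing \<open>x^2\<close> by \<open>dn^2\<close>; dividing by \<open>1 + H\<close> brings it
    below \<open>\<eta>\<close>.\<close>
  define e where "e = \<eta> / (1 + H)"
  have e0: "0 < e" using \<eta> H by (simp add: e_def)
  have "uniformly_continuous_on {a..b} u2" using cont compact_uniformly_continuous by blast
  then obtain k where k: "0 < k" "\<And>x x'. x \<in> {a..b} \<Longrightarrow> x' \<in> {a..b} \<Longrightarrow> \<bar>x' - x\<bar> < k \<Longrightarrow> \<bar>u2 x' - u2 x\<bar> < e"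
    unfolding uniformly_continuous_on_def dist_real_def using e0 by metis
  \<comment> \<open>Where \<open>\<bar>x\<bar> \<ge> k\<close>, the quotient
    \<open>x^2 / k^2\<close> is at least 1, so the trivial bound \<open>2 * H\<close> on the
    oscillation of \<open>u2\<close> is at most \<open>h * x^2\<close>.\<close>
  define h where "h = 2 * H / k\<^sup>2"
  have h0: "0 \<le> h" using H by (simp add: h_def)
  \<comment> \<open>The summands collect the coefficient of \<open>dn ^ 4\<close>, the contribution
    of \<open>dd ^ 4\<close>, and the contributions of \<open>dd^2\<close> from the Taylor term and
    from the cross term.\<close>
  define D where "D = 4 * h + 4 * h * C ^ 4 * T\<^sup>2 + e * C\<^sup>2 + H * (C\<^sup>2 + C\<^sup>2 / e) / 2"
  show thesis
  proof (rule that[of D])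
    show "0 \<le> D" using H e0 h0 by (simp add: D_def)
    fix y y' dn dd \<delta> :: real 
    assume A: "y \<in> {a..b}" "y' \<in> {a..b}" "y' - y = dn + dd" "\<bar>dd\<bar> \<le> C * \<delta>" "0 \<le> \<delta>" "\<delta> \<le> T"
    define x where "x = dn + dd"
    have y': "y' - y = x" using A by (simp add: x_def)
    have tay: "\<bar>u y' - u y - u1 y * x - u2 y / 2 * x\<^sup>2\<bar> \<le> (e / 2) * x\<^sup>2 + h / 2 * x ^ 4"
    proof (cases "x = 0")
      case True then show ?thesis using y' by simp
    next
      case False
      define diff where "diff m = (if m = 0 then u else if m = 1 then u1 else u2)" for m :: nat
      have "\<exists>t. (if y' < y then y' < t \<and> t < y else y < t \<and> t < y') \<and>
        u y' = (\<Sum>m<2. diff m y / fact m * (y' - y) ^ m) + diff 2 t / fact 2 * (y' - y) ^ 2"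
        by (rule Taylor[of 2 diff u a b]) (use A u u1 y' False in \<open>auto simp: diff_def less_2_cases_iff\<close>)
      then obtain t where t0: "(if y' < y then y' < t \<and> t < y else y < t \<and> t < y')"
          "u y' = (\<Sum>m<2. diff m y / fact m * (y' - y) ^ m) + diff 2 t / fact 2 * (y' - y) ^ 2"
        by blast
      have "(\<Sum>m<2. diff m y / fact m * (y' - y) ^ m) = u y + u1 y * x"
        using y' by (simp add: diff_def eval_nat_numeral lessThan_Suc)
      then have eq: "u y' = u y + u1 y * x + u2 t / 2 * x\<^sup>2" using t0(2) y' by (simp add: diff_def)
      have t: "t \<in> {a..b}" "\<bar>t - y\<bar> \<le> \<bar>x\<bar>" using t0(1) y' A(1,2) by (auto split: if_splits)
      have "\<bar>u2 t - u2 y\<bar> \<le> e + h * x\<^sup>2"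
      proof (cases "\<bar>x\<bar> < k")
        case True
        then have "\<bar>u2 t - u2 y\<bar> < e" using k(2)[OF A(1) t(1)] t(2) by linarith
        moreover have "0 \<le> h * x\<^sup>2" using h0 by simp
        ultimately show ?thesis by linarith
      next
        case False
        then have "k\<^sup>2 \<le> x\<^sup>2" using k(1) by (simp add: abs_le_square_iff[symmetric])
        then have "2 * H * 1 \<le> 2 * H * (x\<^sup>2 / k\<^sup>2)" using H k by (intro mult_left_mono) auto
        then have "2 * H \<le> h * x\<^sup>2" by (simp add: h_def)
        moreover have "\<bar>u2 t - u2 y\<bar> \<le> 2 * H" using H(2)[OF t(1)] H(2)[OF A(1)] by linarith
        ultimately show ?thesis using e0 by linarith
      qed
      then have "\<bar>u2 t - u2 y\<bar> * x\<^sup>2 \<le> (e + h * x\<^sup>2) * x\<^sup>2" by (intro mult_right_mono) auto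
      moreover have "u y' - u y - u1 y * x - u2 y / 2 * x\<^sup>2 = (u2 t - u2 y) * x\<^sup>2 / 2"
        unfolding eq by (simp add: field_simps)
      moreover have "\<bar>(u2 t - u2 y) * x\<^sup>2 / 2\<bar> = \<bar>u2 t - u2 y\<bar> * x\<^sup>2 / 2" by (simp add: abs_mult)
      ultimately show ?thesis by (simp add: algebra_simps power2_eq_square power4_eq_xxxx)
    qed
    have dd2: "dd\<^sup>2 \<le> C\<^sup>2 * \<delta>\<^sup>2"
      using power_mono[OF A(4), of 2] by (simp add: power_mult_distrib)
    have dd4: "dd ^ 4 \<le> C ^ 4 * T\<^sup>2 * \<delta>\<^sup>2"
    proof -
      have "dd ^ 4 \<le> C ^ 4 * (\<delta>\<^sup>2 * \<delta>\<^sup>2)"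
        using power_mono[OF A(4), of 4] by (simp add: power_mult_distrib power4_eq_xxxx power2_eq_square mult_ac)
      also have "\<dots> \<le> C ^ 4 * (T\<^sup>2 * \<delta>\<^sup>2)" using A(5,6)
        by (intro mult_left_mono mult_right_mono power_mono) auto
      finally show ?thesis by (simp add: mult_ac)
    qed
    have x2: "x\<^sup>2 \<le> 2 * dn\<^sup>2 + 2 * dd\<^sup>2"
      using sum_squares_ge_zero[of "dn - dd" 0] by (simp add: x_def power2_eq_square algebra_simps)
    have x4: "x ^ 4 \<le> 8 * dn ^ 4 + 8 * dd ^ 4"
    proof -
      have "x ^ 4 = (x\<^sup>2)\<^sup>2" by simp
      also have "\<dots> \<le> (2 * dn\<^sup>2 + 2 * dd\<^sup>2)\<^sup>2" using x2 by (intro power_mono) auto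
      also have "\<dots> \<le> 8 * dn ^ 4 + 8 * dd ^ 4"
        using sum_squares_ge_zero[of "dn\<^sup>2 - dd\<^sup>2" 0]
        by (simp add: power2_eq_square power4_eq_xxxx algebra_simps)
      finally show ?thesis .
    qed
    \<comment> \<open>Young's inequality with weight \<open>e\<close> for the mixed product of
      \<open>dn\<close> and \<open>dd\<close>.\<close>
    have cross: "\<bar>x\<^sup>2 - dn\<^sup>2\<bar> \<le> (1 + 1 / e) * dd\<^sup>2 + e * dn\<^sup>2"
    proof -
      have "0 \<le> (dd / e - dn)\<^sup>2 * e" "0 \<le> (dd / e + dn)\<^sup>2 * e" using e0 by auto
      moreover have "(dd / e - dn)\<^sup>2 * e = dd\<^sup>2 / e - 2 * dn * dd + e * dn\<^sup>2"
        "(dd / e + dn)\<^sup>2 * e = dd\<^sup>2 / e + 2 * dn * dd + e * dn\<^sup>2"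
        using e0 by (simp_all add: power2_eq_square field_simps)
      ultimately have "\<bar>2 * dn * dd\<bar> \<le> dd\<^sup>2 / e + e * dn\<^sup>2" by (simp add: abs_le_iff)
      moreover have "x\<^sup>2 - dn\<^sup>2 = dd\<^sup>2 + 2 * dn * dd" by (simp add: x_def power2_eq_square algebra_simps)
      moreover have "(1 + 1 / e) * dd\<^sup>2 = dd\<^sup>2 + dd\<^sup>2 / e" by (simp add: algebra_simps)
      ultimately show ?thesis using abs_triangle_ineq[of "dd\<^sup>2" "2 * dn * dd"] by simp
    qed
    have "\<bar>u y' - u y - u1 y * x - u2 y / 2 * dn\<^sup>2\<bar> \<le>
       \<bar>u y' - u y - u1 y * x - u2 y / 2 * x\<^sup>2\<bar> + \<bar>u2 y / 2 * (x\<^sup>2 - dn\<^sup>2)\<bar>"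
      by (simp add: algebra_simps)
    also have "\<bar>u2 y / 2 * (x\<^sup>2 - dn\<^sup>2)\<bar> \<le> H / 2 * ((1 + 1 / e) * dd\<^sup>2 + e * dn\<^sup>2)"
      unfolding abs_mult using H(1) H(2)[OF A(1)] cross by (intro mult_mono) auto
    also note tay
    also have "e / 2 * x\<^sup>2 + h / 2 * x ^ 4 \<le> e / 2 * (2 * dn\<^sup>2 + 2 * dd\<^sup>2) + h / 2 * (8 * dn ^ 4 + 8 * dd ^ 4)"
      using e0 h0 x2 x4 by (intro add_mono mult_left_mono) auto
    also have "e / 2 * (2 * dn\<^sup>2 + 2 * dd\<^sup>2) + h / 2 * (8 * dn ^ 4 + 8 * dd ^ 4) + H / 2 * ((1 + 1 / e) * dd\<^sup>2 + e * dn\<^sup>2)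
       = (e + H * e / 2) * dn\<^sup>2 + (4 * h) * dn ^ 4 + (e + H / 2 * (1 + 1 / e)) * dd\<^sup>2 + (4 * h) * dd ^ 4"
      by (simp add: algebra_simps add_divide_distrib)
    also have "\<dots> \<le> \<eta> * dn\<^sup>2 + D * dn ^ 4 + (e + H / 2 * (1 + 1 / e)) * (C\<^sup>2 * \<delta>\<^sup>2) + (4 * h) * (C ^ 4 * T\<^sup>2 * \<delta>\<^sup>2)"
    proof (intro add_mono mult_left_mono mult_right_mono dd2 dd4)
      have "e + H * e / 2 \<le> e * (1 + H)" using e0 H by (simp add: algebra_simps)
      also have "\<dots> = \<eta>" using H by (simp add: e_def)
      finally show "e + H * e / 2 \<le> \<eta>" .
      have "0 \<le> 4 * h * C ^ 4 * T\<^sup>2 + e * C\<^sup>2 + H * (C\<^sup>2 + C\<^sup>2 / e) / 2" using H e0 h0 by simp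
      then show "4 * h \<le> D" by (simp add: D_def)
    qed (use H e0 h0 in auto)
    also have "\<dots> \<le> \<eta> * dn\<^sup>2 + D * dn ^ 4 + D * \<delta>\<^sup>2"
    proof -
      have "(e + H / 2 * (1 + 1 / e)) * (C\<^sup>2 * \<delta>\<^sup>2) + (4 * h) * (C ^ 4 * T\<^sup>2 * \<delta>\<^sup>2) = (D - 4 * h) * \<delta>\<^sup>2"
        by (simp add: D_def algebra_simps add_divide_distrib)
      also have "\<dots> \<le> D * \<delta>\<^sup>2" using h0 by (intro mult_right_mono) auto
      finally show ?thesis by simp
    qed
    finally show "\<bar>u y' - u y - u1 y * (dn + dd) - u2 y / 2 * dn\<^sup>2\<bar> \<le> \<eta> * dn\<^sup>2 + D * (\<delta>\<^sup>2 + dn ^ 4)"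
      by (simp add: x_def algebra_simps)
  qed
qed

section \<open>The discrete Ito formula\<close>

text \<open>A semimartingale stopped inside \<open>{a..b}\<close>, reduced to what the grid argument
  uses: martingale part \<open>n\<close>, drift \<open>d\<close> and bracket \<open>A\<close>, the
  last two Lipschitz in time uniformly in the path. The martingale properties are phrased as
  orthogonality to events of \<open>F s\<close>, as \<open>local_martingale_stopped\<close> delivers
  them.\<close>

locale ito_decomposition = filtered_prob_space +
  fixes T B C a b :: real and y n d A :: "real \<Rightarrow> 'a \<Rightarrow> real"
  assumes T0: "0 < T" and C0: "0 \<le> C"
    and y_meas: "0 \<le> t \<Longrightarrow> t \<le> T \<Longrightarrow> y t \<in> borel_measurable (G t)"
    and n_meas: "0 \<le> t \<Longrightarrow> t \<le> T \<Longrightarrow> n t \<in> borel_measurable (G t)"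
    and A_meas: "0 \<le> t \<Longrightarrow> t \<le> T \<Longrightarrow> A t \<in> borel_measurable (G t)"
    and d_meas: "0 \<le> t \<Longrightarrow> t \<le> T \<Longrightarrow> d t \<in> borel_measurable M"
    and y_range: "\<omega> \<in> space M \<Longrightarrow> 0 \<le> t \<Longrightarrow> t \<le> T \<Longrightarrow> y t \<omega> \<in> {a..b}"
    and n_bound: "\<omega> \<in> space M \<Longrightarrow> 0 \<le> t \<Longrightarrow> t \<le> T \<Longrightarrow> \<bar>n t \<omega>\<bar> \<le> B"
    and n_cont: "\<omega> \<in> space M \<Longrightarrow> continuous_on {0..T} (\<lambda>t. n t \<omega>)"
    and y_diff: "\<omega> \<in> space M \<Longrightarrow> 0 \<le> s \<Longrightarrow> s \<le> t \<Longrightarrow> t \<le> T \<Longrightarrow> 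
        y t \<omega> - y s \<omega> = (n t \<omega> - n s \<omega>) + (d t \<omega> - d s \<omega>)"
    and d_lip: "\<omega> \<in> space M \<Longrightarrow> 0 \<le> s \<Longrightarrow> s \<le> t \<Longrightarrow> t \<le> T \<Longrightarrow> \<bar>d t \<omega> - d s \<omega>\<bar> \<le> C * (t - s)"
    and A_lip: "\<omega> \<in> space M \<Longrightarrow> 0 \<le> s \<Longrightarrow> s \<le> t \<Longrightarrow> t \<le> T \<Longrightarrow> \<bar>A t \<omega> - A s \<omega>\<bar> \<le> C * (t - s)"
    and n_mart: "0 \<le> s \<Longrightarrow> s \<le> t \<Longrightarrow> t \<le> T \<Longrightarrow> E \<in> F s \<Longrightarrow> 
        (\<integral>\<omega>. indicator E \<omega> * (n t \<omega> - n s \<omega>) \<partial>M) = 0"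
    and n2_mart: "0 \<le> s \<Longrightarrow> s \<le> t \<Longrightarrow> t \<le> T \<Longrightarrow> E \<in> F s \<Longrightarrow> 
        (\<integral>\<omega>. indicator E \<omega> * (((n t \<omega>)\<^sup>2 - A t \<omega>) - ((n s \<omega>)\<^sup>2 - A s \<omega>)) \<partial>M) = 0"
begin

lemma integrable_bounded:
  fixes f :: "'a \<Rightarrow> real"
  assumes "f \<in> borel_measurable M" "\<And>\<omega>. \<omega> \<in> space M \<Longrightarrow> \<bar>f \<omega>\<bar> \<le> K"
  shows "integrable M f"
  using assms by (intro integrable_const_bound[of f K]) auto

lemma meas_M:
  assumes "0 \<le> t" "t \<le> T"
  shows "y t \<in> borel_measurable M" "n t \<in> borel_measurable M" "A t \<in> borel_measurable M"
  using y_meas n_meas A_meas measurable_G_M assms by blast+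

lemma B0: "0 \<le> B"
  using n_bound[of _ 0] T0 not_empty by force

lemma n_diff_bound: 
  assumes "\<omega> \<in> space M" "0 \<le> s" "s \<le> t" "t \<le> T"
  shows "\<bar>n t \<omega> - n s \<omega>\<bar> \<le> 2 * B"
  using n_bound[OF assms(1), of s] n_bound[OF assms(1), of t] assms by force

lemma n_diff_mult:
  assumes "0 \<le> s" "s \<le> t" "t \<le> T" "c \<in> borel_measurable (G s)" "\<And>\<omega>. \<omega> \<in> space M \<Longrightarrow> \<bar>c \<omega>\<bar> \<le> K"
  shows "(\<integral>\<omega>. c \<omega> * (n t \<omega> - n s \<omega>) \<partial>M) = 0"
proof (rule expectation_mult_eq_0[OF assms(1) _ _ assms(4,5)])
  show "integrable M (\<lambda>\<omega>. n t \<omega> - n s \<omega>)"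
    by (rule integrable_bounded[of _ "2 * B"]) (use meas_M assms n_diff_bound in auto)
qed (use n_mart assms in auto)

text \<open>The difference of the squares \<open>n t ^ 2\<close> and \<open>n s ^ 2\<close> is the
  squared increment plus \<open>2 * n s\<close> times the increment. The latter has mean zero under
  any weight known at time \<open>s\<close>, so the martingale property of \<open>n^2 - A\<close>
  passes to the squared increment.\<close>

lemma n_diff_sq_mult:
  assumes st: "0 \<le> s" "s \<le> t" "t \<le> T" and c: "c \<in> borel_measurable (G s)" "\<And>\<omega>. \<omega> \<in> space M \<Longrightarrow> \<bar>c \<omega>\<bar> \<le> K"
  shows "(\<integral>\<omega>. c \<omega> * (n t \<omega> - n s \<omega>)\<^sup>2 \<partial>M) = (\<integral>\<omega>. c \<omega> * (A t \<omega> - A s \<omega>) \<partial>M)"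
proof -
  have [measurable]: "n t \<in> borel_measurable M" "n s \<in> borel_measurable M" "A t \<in> borel_measurable M" "A s \<in> borel_measurable M" "c \<in> borel_measurable M"
    using meas_M measurable_G_M c st by auto
  have 1: "(\<integral>\<omega>. (c \<omega> * n s \<omega>) * (n t \<omega> - n s \<omega>) \<partial>M) = 0"
  proof (rule n_diff_mult[OF st])
    show "(\<lambda>\<omega>. c \<omega> * n s \<omega>) \<in> borel_measurable (G s)" using c n_meas[of s] st by auto
    show "\<bar>c \<omega> * n s \<omega>\<bar> \<le> K * B" if "\<omega> \<in> space M" for \<omega>
      unfolding abs_mult using c(2)[OF that] n_bound[OF that, of s] st by (intro mult_mono) auto
  qed
  define D where "D \<omega> = ((n t \<omega>)\<^sup>2 - A t \<omega>) - ((n s \<omega>)\<^sup>2 - A s \<omega>)" for \<omega>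
  have sqb: "(n q \<omega>)\<^sup>2 \<le> B\<^sup>2" if "\<omega> \<in> space M" "0 \<le> q" "q \<le> T" for \<omega> q
    using n_bound[OF that] power_mono[of "\<bar>n q \<omega>\<bar>" B 2] by simp
  have Di: "integrable M D"
  proof (rule integrable_bounded[of _ "B\<^sup>2 + C * (t - s)"])
    fix \<omega> assume w: "\<omega> \<in> space M"
    show "\<bar>D \<omega>\<bar> \<le> B\<^sup>2 + C * (t - s)"
      using sqb[OF w, of s] sqb[OF w, of t] A_lip[OF w st] st zero_le_power2[of "n t \<omega>"] zero_le_power2[of "n s \<omega>"]
      unfolding D_def abs_le_iff by (intro conjI) linarith+
  next
    show "D \<in> borel_measurable M" unfolding D_def by measurable
  qed
  have 2: "(\<integral>\<omega>. c \<omega> * D \<omega> \<partial>M) = 0"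
    by (rule expectation_mult_eq_0[OF st(1) Di _ c]) (use n2_mart st in \<open>auto simp: D_def\<close>)
  have K0: "0 \<le> K" using c(2) not_empty by force
  have i1: "integrable M (\<lambda>\<omega>. c \<omega> * (n t \<omega> - n s \<omega>)\<^sup>2)"
  proof (rule integrable_bounded[of _ "K * (2 * B)\<^sup>2"])
    show "\<bar>c \<omega> * (n t \<omega> - n s \<omega>)\<^sup>2\<bar> \<le> K * (2 * B)\<^sup>2" if "\<omega> \<in> space M" for \<omega>
      unfolding abs_mult using c(2)[OF that] power_mono[OF n_diff_bound[OF that st], of 2] K0
      by (intro mult_mono) auto
  qed auto
  have i2: "integrable M (\<lambda>\<omega>. c \<omega> * (A t \<omega> - A s \<omega>))"
  proof (rule integrable_bounded[of _ "K * (C * (t - s))"])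
    show "\<bar>c \<omega> * (A t \<omega> - A s \<omega>)\<bar> \<le> K * (C * (t - s))" if "\<omega> \<in> space M" for \<omega>
      unfolding abs_mult using c(2)[OF that] A_lip[OF that st] K0 by (intro mult_mono) auto
  qed auto
  have i3: "integrable M (\<lambda>\<omega>. (c \<omega> * n s \<omega>) * (n t \<omega> - n s \<omega>))"
  proof (rule integrable_bounded[of _ "(K * B) * (2 * B)"])
    show "\<bar>(c \<omega> * n s \<omega>) * (n t \<omega> - n s \<omega>)\<bar> \<le> (K * B) * (2 * B)" if "\<omega> \<in> space M" for \<omega>
      unfolding abs_mult using c(2)[OF that] n_bound[OF that, of s] n_diff_bound[OF that st] K0 B0 st 
      by (intro mult_mono) auto
  qed auto
  have "(\<integral>\<omega>. c \<omega> * D \<omega> \<partial>M) = (\<integral>\<omega>. c \<omega> * (n t \<omega> - n s \<omega>)\<^sup>2 - c \<omega> * (A t \<omega> - A s \<omega>) + 2 * ((c \<omega> * n s \<omega>) * (n t \<omega> - n s \<omega>)) \<partial>M)"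
    by (intro Bochner_Integration.integral_cong) (auto simp: D_def power2_eq_square algebra_simps)
  also have "\<dots> = (\<integral>\<omega>. c \<omega> * (n t \<omega> - n s \<omega>)\<^sup>2 \<partial>M) - (\<integral>\<omega>. c \<omega> * (A t \<omega> - A s \<omega>) \<partial>M)"
    using i1 i2 i3 1 by simp
  finally show ?thesis using 2 by simp
qed

section \<open>Moments of the increments along a grid\<close>

definition grid :: "nat \<Rightarrow> nat \<Rightarrow> real" where
  "grid k i = real i * (T / real (Suc k))"

lemma grid_0: "grid k 0 = 0" by (simp add: grid_def)

lemma grid_end: "grid k (Suc k) = T" by (simp add: grid_def del: of_nat_Suc)

lemma grid_bounds: 
  assumes "i \<le> Suc k" shows "0 \<le> grid k i" "grid k i \<le> T"
proof -
  show "0 \<le> grid k i" using T0 by (simp add: grid_def)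
  have "grid k i \<le> grid k (Suc k)" unfolding grid_def using assms T0 by (intro mult_right_mono) auto
  then show "grid k i \<le> T" by (simp add: grid_end)
qed

lemma grid_step: "grid k (Suc i) - grid k i = T / real (Suc k)"
  by (simp add: grid_def algebra_simps add_divide_distrib[symmetric] del: of_nat_Suc)
     (simp add: algebra_simps add_divide_distrib)

lemma grid_mono: "grid k i \<le> grid k (Suc i)"
proof -
  have "0 \<le> T / real (Suc k)" using T0 by simp
  then show ?thesis using grid_step[of k i] by linarith
qed

lemma grid_ineqs: 
  assumes "i < Suc k"
  shows "0 \<le> grid k i" "grid k i \<le> grid k (Suc i)" "grid k (Suc i) \<le> T" "grid k i \<le> T" "0 \<le> grid k (Suc i)"
  using grid_bounds[of i k] grid_bounds[of "Suc i" k] assms grid_mono by auto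

definition dn :: "nat \<Rightarrow> nat \<Rightarrow> 'a \<Rightarrow> real" where
  "dn k i \<omega> = n (grid k (Suc i)) \<omega> - n (grid k i) \<omega>"

lemma dn_meas: "i < Suc k \<Longrightarrow> dn k i \<in> borel_measurable M"
  unfolding dn_def using meas_M grid_ineqs by auto

lemma dn_bound: "i < Suc k \<Longrightarrow> \<omega> \<in> space M \<Longrightarrow> \<bar>dn k i \<omega>\<bar> \<le> 2 * B"
  unfolding dn_def using n_diff_bound grid_ineqs by auto

lemma dn_sq_bound: "i < Suc k \<Longrightarrow> \<omega> \<in> space M \<Longrightarrow> (dn k i \<omega>)\<^sup>2 \<le> 4 * B\<^sup>2"
  using power_mono[OF dn_bound, of i k \<omega> 2] by (simp add: power_mult_distrib)

text \<open>The conditional variance of an increment is the conditional growth of the bracket, hence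
  at most \<open>C\<close> times the mesh.\<close>

lemma dn_sq_mult_le:
  assumes i: "i < Suc k" and c: "c \<in> borel_measurable (G (grid k i))" "\<And>\<omega>. \<omega> \<in> space M \<Longrightarrow> 0 \<le> c \<omega>" "\<And>\<omega>. \<omega> \<in> space M \<Longrightarrow> c \<omega> \<le> K"
  shows "(\<integral>\<omega>. c \<omega> * (dn k i \<omega>)\<^sup>2 \<partial>M) \<le> C * (T / real (Suc k)) * (\<integral>\<omega>. c \<omega> \<partial>M)"
proof -
  note g = grid_ineqs[OF i]
  have [measurable]: "c \<in> borel_measurable M" using c measurable_G_M g by blast
  have [measurable]: "A (grid k (Suc i)) \<in> borel_measurable M" "A (grid k i) \<in> borel_measurable M"
    using meas_M g by auto
  have K0: "0 \<le> K" using c(2,3) not_empty by force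
  have ci: "integrable M c" by (rule integrable_bounded[of _ K]) (use c in auto)
  have lip: "\<bar>A (grid k (Suc i)) \<omega> - A (grid k i) \<omega>\<bar> \<le> C * (T / real (Suc k))" if "\<omega> \<in> space M" for \<omega>
    using A_lip[OF that g(1-3)] grid_step[of k i] by simp
  have "(\<integral>\<omega>. c \<omega> * (dn k i \<omega>)\<^sup>2 \<partial>M) = (\<integral>\<omega>. c \<omega> * (A (grid k (Suc i)) \<omega> - A (grid k i) \<omega>) \<partial>M)"
    unfolding dn_def by (rule n_diff_sq_mult[OF g(1-3) c(1), of K]) (use c in auto)
  also have "\<dots> \<le> (\<integral>\<omega>. C * (T / real (Suc k)) * c \<omega> \<partial>M)"
  proof (rule integral_mono)
    show "integrable M (\<lambda>\<omega>. c \<omega> * (A (grid k (Suc i)) \<omega> - A (grid k i) \<omega>))"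
    proof (rule integrable_bounded[of _ "K * (C * (T / real (Suc k)))"])
      show "\<bar>c \<omega> * (A (grid k (Suc i)) \<omega> - A (grid k i) \<omega>)\<bar> \<le> K * (C * (T / real (Suc k)))" if "\<omega> \<in> space M" for \<omega>
        unfolding abs_mult using c(2,3)[OF that] lip[OF that] K0 by (intro mult_mono) auto
    qed auto
    show "integrable M (\<lambda>\<omega>. C * (T / real (Suc k)) * c \<omega>)" using ci by (rule integrable_mult_right)
    show "c \<omega> * (A (grid k (Suc i)) \<omega> - A (grid k i) \<omega>) \<le> C * (T / real (Suc k)) * c \<omega>" if "\<omega> \<in> space M" for \<omega>
      using mult_left_mono[OF abs_le_D1[OF lip[OF that]] c(2)[OF that]] by (simp add: mult_ac)
  qed
  also have "\<dots> = C * (T / real (Suc k)) * (\<integral>\<omega>. c \<omega> \<partial>M)" by simp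
  finally show ?thesis .
qed

definition qv :: "nat \<Rightarrow> nat \<Rightarrow> 'a \<Rightarrow> real" where
  "qv k j \<omega> = (\<Sum>i<j. (dn k i \<omega>)\<^sup>2)"

lemma qv_nonneg: "0 \<le> qv k j \<omega>"
  by (simp add: qv_def sum_nonneg)

lemma qv_Suc: "qv k (Suc j) \<omega> = qv k j \<omega> + (dn k j \<omega>)\<^sup>2"
  by (simp add: qv_def)

lemma qv_0: "qv k 0 = (\<lambda>_. 0)"
  by (simp add: qv_def fun_eq_iff)

lemma qv_le:
  assumes "j \<le> Suc k" "\<omega> \<in> space M" shows "qv k j \<omega> \<le> real j * (4 * B\<^sup>2)"
proof -
  have "qv k j \<omega> \<le> (\<Sum>i<j. 4 * B\<^sup>2)" unfolding qv_def
    using assms dn_sq_bound by (intro sum_mono) auto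
  then show ?thesis by simp
qed

lemma grid_le: "i \<le> j \<Longrightarrow> grid k i \<le> grid k j"
  unfolding grid_def using T0 by (intro mult_right_mono) auto

lemma qv_meas: 
  assumes "j \<le> Suc k" shows "qv k j \<in> borel_measurable (G (grid k j))"
  unfolding qv_def dn_def
proof (intro borel_measurable_sum borel_measurable_power borel_measurable_diff)
  fix i assume i: "i \<in> {..<j}"
  show "n (grid k (Suc i)) \<in> borel_measurable (G (grid k j))" "n (grid k i) \<in> borel_measurable (G (grid k j))"
    using assms i grid_bounds[of j k] grid_bounds[of i k] grid_bounds[of "Suc i" k]
    by (auto intro!: measurable_G_mono[OF _ _ n_meas] grid_le)
qed

lemma qv_integrable:
  assumes "j \<le> Suc k" shows "integrable M (qv k j)" "integrable M (\<lambda>\<omega>. (qv k j \<omega>)\<^sup>2)"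
proof -
  have [measurable]: "qv k j \<in> borel_measurable M"
    using measurable_G_M[OF grid_bounds(1) qv_meas] assms by blast
  have b: "\<bar>qv k j \<omega>\<bar> \<le> real j * (4 * B\<^sup>2)" if "\<omega> \<in> space M" for \<omega>
    using qv_le[OF assms that] qv_nonneg[of k j \<omega>] by simp
  show "integrable M (qv k j)" by (rule integrable_bounded[OF _ b]) auto
  show "integrable M (\<lambda>\<omega>. (qv k j \<omega>)\<^sup>2)"
    by (rule integrable_bounded[of _ "(real j * (4 * B\<^sup>2))\<^sup>2"]) (use power_mono[OF b, of _ 2] in auto)
qed

lemma dn_sq_integrable: "i < Suc k \<Longrightarrow> integrable M (\<lambda>\<omega>. (dn k i \<omega>)\<^sup>2)"
  by (rule integrable_bounded[of _ "4 * B\<^sup>2"]) (use dn_meas dn_sq_bound in auto)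

lemma qv_expectation:
  assumes "j \<le> Suc k" shows "(\<integral>\<omega>. qv k j \<omega> \<partial>M) \<le> real j * (C * (T / real (Suc k)))"
  using assms
proof (induction j)
  case (Suc j)
  have "(\<integral>\<omega>. (dn k j \<omega>)\<^sup>2 \<partial>M) \<le> C * (T / real (Suc k))"
    using dn_sq_mult_le[of j k "\<lambda>_. 1" 1] Suc.prems by (simp add: prob_space)
  moreover have "(\<integral>\<omega>. qv k (Suc j) \<omega> \<partial>M) = (\<integral>\<omega>. qv k j \<omega> \<partial>M) + (\<integral>\<omega>. (dn k j \<omega>)\<^sup>2 \<partial>M)"
    unfolding qv_Suc using qv_integrable[of j k] dn_sq_integrable[of j k] Suc.prems by simp
  moreover have "real (Suc j) * (C * (T / real (Suc k))) = real j * (C * (T / real (Suc k))) + C * (T / real (Suc k))"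
    unfolding of_nat_Suc distrib_right by (simp only: mult_1_left add.commute)
  ultimately show ?case using Suc by linarith
qed (simp add: qv_0)

lemma qv_expectation_CT:
  assumes "j \<le> Suc k" shows "(\<integral>\<omega>. qv k j \<omega> \<partial>M) \<le> C * T"
proof -
  have "real j * (C * (T / real (Suc k))) \<le> real (Suc k) * (C * (T / real (Suc k)))"
    using assms C0 T0 by (intro mult_right_mono) auto
  also have "\<dots> = C * T" by (simp del: of_nat_Suc)
  finally show ?thesis using qv_expectation[OF assms] by linarith
qed

text \<open>A second moment of the discrete quadratic variation that is bounded uniformly in the mesh
  makes the sum of the fourth powers of the increments vanish in the limit.\<close>
lemma qv_sq_expectation:
  assumes "j \<le> Suc k" 
  shows "(\<integral>\<omega>. (qv k j \<omega>)\<^sup>2 \<partial>M) \<le> real j * ((2 * (C * T) + 4 * B\<^sup>2) * (C * (T / real (Suc k))))"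
  using assms
proof (induction j)
  case (Suc j)
  then have j: "j < Suc k" "j \<le> Suc k" by auto
  \<comment> \<open>Squaring \<open>qv + dn^2\<close> adds \<open>2 * qv * dn^2 + dn ^ 4\<close>,
    and \<open>dn ^ 4 \<le> 4 * B^2 * dn^2\<close>. The growth is thus at most \<open>dn^2\<close>
    times a weight known before the step, to which \<open>dn_sq_mult_le\<close> applies.\<close>
  define c where "c \<omega> = 2 * qv k j \<omega> + 4 * B\<^sup>2" for \<omega>
  have ci: "integrable M c" unfolding c_def using qv_integrable(1)[OF j(2)] by auto
  have cle: "(\<integral>\<omega>. c \<omega> * (dn k j \<omega>)\<^sup>2 \<partial>M) \<le> C * (T / real (Suc k)) * (\<integral>\<omega>. c \<omega> \<partial>M)"
  proof (rule dn_sq_mult_le[OF j(1), of _ "2 * (real j * (4 * B\<^sup>2)) + 4 * B\<^sup>2"])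
    show "c \<in> borel_measurable (G (grid k j))" using qv_meas[OF j(2)] unfolding c_def by auto
    show "0 \<le> c \<omega>" for \<omega> using qv_nonneg[of k j \<omega>] by (simp add: c_def)
    show "c \<omega> \<le> 2 * (real j * (4 * B\<^sup>2)) + 4 * B\<^sup>2" if "\<omega> \<in> space M" for \<omega>
      using qv_le[OF j(2) that] unfolding c_def by linarith
  qed
  have cint: "integrable M (\<lambda>\<omega>. c \<omega> * (dn k j \<omega>)\<^sup>2)"
  proof (rule integrable_bounded[of _ "(2 * (real j * (4 * B\<^sup>2)) + 4 * B\<^sup>2) * (4 * B\<^sup>2)"])
    show "(\<lambda>\<omega>. c \<omega> * (dn k j \<omega>)\<^sup>2) \<in> borel_measurable M"
      using borel_measurable_integrable[OF ci] dn_meas[OF j(1)] by measurable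
    fix \<omega> assume w: "\<omega> \<in> space M"
    have "0 \<le> c \<omega>" "c \<omega> \<le> 2 * (real j * (4 * B\<^sup>2)) + 4 * B\<^sup>2" 
      using qv_nonneg[of k j \<omega>] qv_le[OF j(2) w] by (auto simp: c_def)
    then show "\<bar>c \<omega> * (dn k j \<omega>)\<^sup>2\<bar> \<le> (2 * (real j * (4 * B\<^sup>2)) + 4 * B\<^sup>2) * (4 * B\<^sup>2)"
      unfolding abs_mult using dn_sq_bound[OF j(1) w] by (intro mult_mono) auto
  qed
  have "(\<integral>\<omega>. (qv k (Suc j) \<omega>)\<^sup>2 \<partial>M) \<le> (\<integral>\<omega>. (qv k j \<omega>)\<^sup>2 + c \<omega> * (dn k j \<omega>)\<^sup>2 \<partial>M)"
  proof (rule integral_mono)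
    show "integrable M (\<lambda>\<omega>. (qv k (Suc j) \<omega>)\<^sup>2)" using qv_integrable Suc.prems by blast
    show "integrable M (\<lambda>\<omega>. (qv k j \<omega>)\<^sup>2 + c \<omega> * (dn k j \<omega>)\<^sup>2)" using cint qv_integrable(2)[OF j(2)] by auto
    fix \<omega> assume w: "\<omega> \<in> space M"
    have "(dn k j \<omega>)\<^sup>2 * (dn k j \<omega>)\<^sup>2 \<le> 4 * B\<^sup>2 * (dn k j \<omega>)\<^sup>2"
      using dn_sq_bound[OF j(1) w] by (intro mult_right_mono) auto
    then show "(qv k (Suc j) \<omega>)\<^sup>2 \<le> (qv k j \<omega>)\<^sup>2 + c \<omega> * (dn k j \<omega>)\<^sup>2"
      by (simp add: qv_Suc c_def power2_sum algebra_simps power2_eq_square[of "(dn k j \<omega>)\<^sup>2"])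
  qed
  also have "\<dots> = (\<integral>\<omega>. (qv k j \<omega>)\<^sup>2 \<partial>M) + (\<integral>\<omega>. c \<omega> * (dn k j \<omega>)\<^sup>2 \<partial>M)"
    using cint qv_integrable(2)[OF j(2)] by simp
  also have "(\<integral>\<omega>. c \<omega> * (dn k j \<omega>)\<^sup>2 \<partial>M) \<le> C * (T / real (Suc k)) * (2 * (C * T) + 4 * B\<^sup>2)"
  proof -
    have "(\<integral>\<omega>. c \<omega> \<partial>M) \<le> 2 * (C * T) + 4 * B\<^sup>2"
      unfolding c_def using qv_integrable(1)[OF j(2)] qv_expectation_CT[OF j(2)] by (simp add: prob_space)
    then show ?thesis using cle C0 T0 
      by (meson order_trans mult_left_mono mult_nonneg_nonneg divide_nonneg_nonneg less_imp_le of_nat_0_le_iff)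
  qed
  also have "C * (T / real (Suc k)) * (2 * (C * T) + 4 * B\<^sup>2) = (2 * (C * T) + 4 * B\<^sup>2) * (C * (T / real (Suc k)))"
    by (simp only: mult_ac)
  finally show ?case using Suc.IH[OF j(2)] unfolding of_nat_Suc[of j] distrib_right[of _ _ "_ * (C * _)"] mult_1_left
    by linarith
qed (simp add: qv_0)

lemma qv_sq_expectation_bound:
  "(\<integral>\<omega>. (qv k (Suc k) \<omega>)\<^sup>2 \<partial>M) \<le> (2 * (C * T) + 4 * B\<^sup>2) * (C * T)"
  using qv_sq_expectation[of "Suc k" k] by (simp del: of_nat_Suc add: mult_ac)

definition maxdn :: "nat \<Rightarrow> 'a \<Rightarrow> real" where
  "maxdn k \<omega> = Max ((\<lambda>i. (dn k i \<omega>)\<^sup>2) ` {..k})"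

lemma maxdn_ge: "i \<le> k \<Longrightarrow> (dn k i \<omega>)\<^sup>2 \<le> maxdn k \<omega>"
  unfolding maxdn_def by (intro Max_ge) auto

lemma maxdn_attained: obtains i where "i \<le> k" "maxdn k \<omega> = (dn k i \<omega>)\<^sup>2"
proof -
  have "maxdn k \<omega> \<in> (\<lambda>i. (dn k i \<omega>)\<^sup>2) ` {..k}" unfolding maxdn_def by (intro Max_in) auto
  then show ?thesis using that by auto
qed

lemma maxdn_meas: "maxdn k \<in> borel_measurable M"
  unfolding maxdn_def 
proof (rule borel_measurable_Max)
  show "(\<lambda>x. (dn k i x)\<^sup>2) \<in> borel_measurable M" if "i \<in> {..k}" for i
    using that by (intro borel_measurable_power dn_meas) auto
qed auto

lemma maxdn_bounds: assumes "\<omega> \<in> space M" shows "0 \<le> maxdn k \<omega>" "maxdn k \<omega> \<le> 4 * B\<^sup>2"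
  using maxdn_attained[of k \<omega>] dn_sq_bound[OF _ assms] by (metis zero_le_power2, metis le_imp_less_Suc)

lemma maxdn_tendsto:
  assumes w: "\<omega> \<in> space M" shows "(\<lambda>k. maxdn k \<omega>) \<longlonglongrightarrow> 0"
proof (rule LIMSEQ_I)
  fix e :: real assume e: "0 < e"
  have "uniformly_continuous_on {0..T} (\<lambda>t. n t \<omega>)"
    using n_cont[OF w] by (intro compact_uniformly_continuous) auto
  then obtain \<delta> where \<delta>: "0 < \<delta>" 
    "\<And>s t. s \<in> {0..T} \<Longrightarrow> t \<in> {0..T} \<Longrightarrow> \<bar>t - s\<bar> < \<delta> \<Longrightarrow> \<bar>n t \<omega> - n s \<omega>\<bar> < sqrt e"
    unfolding uniformly_continuous_on_def dist_real_def using e by (metis real_sqrt_gt_0_iff)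
  have "(\<lambda>k. T / real (Suc k)) \<longlonglongrightarrow> 0" by (rule LIMSEQ_Suc[OF lim_const_over_n])
  then obtain k0 where k0: "\<And>k. k \<ge> k0 \<Longrightarrow> T / real (Suc k) < \<delta>"
    using order_tendstoD(2)[of _ 0 sequentially \<delta>] \<delta>(1) unfolding eventually_sequentially by blast
  show "\<exists>k0. \<forall>k\<ge>k0. norm (maxdn k \<omega> - 0) < e"
  proof (intro exI allI impI)
    fix k assume k: "k0 \<le> k"
    obtain i where i: "i \<le> k" "maxdn k \<omega> = (dn k i \<omega>)\<^sup>2" by (rule maxdn_attained)
    have "\<bar>dn k i \<omega>\<bar> < sqrt e" unfolding dn_def
      using grid_ineqs[of i k] i(1) grid_step[of k i] k0[OF k] T0 by (intro \<delta>(2)) auto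
    then have "\<bar>dn k i \<omega>\<bar> ^ 2 < (sqrt e)\<^sup>2" by (intro power_strict_mono) auto
    then show "norm (maxdn k \<omega> - 0) < e" using i e by simp
  qed
qed

definition quart :: "nat \<Rightarrow> 'a \<Rightarrow> real" where
  "quart k \<omega> = (\<Sum>i<Suc k. (dn k i \<omega>) ^ 4)"

lemma quart_integrable: "integrable M (quart k)"
proof (rule integrable_bounded[of _ "real (Suc k) * (4 * B\<^sup>2)\<^sup>2"])
  show "quart k \<in> borel_measurable M" unfolding quart_def 
    by (intro borel_measurable_sum borel_measurable_power dn_meas) auto
  fix \<omega> assume w: "\<omega> \<in> space M"
  have "quart k \<omega> \<le> (\<Sum>i<Suc k. (4 * B\<^sup>2)\<^sup>2)" unfolding quart_def
  proof (rule sum_mono)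
    fix i assume "i \<in> {..<Suc k}"
    then have "((dn k i \<omega>)\<^sup>2)\<^sup>2 \<le> (4 * B\<^sup>2)\<^sup>2" using dn_sq_bound[OF _ w, of i k] by (intro power_mono) auto
    then show "(dn k i \<omega>) ^ 4 \<le> (4 * B\<^sup>2)\<^sup>2" by simp
  qed
  moreover have "0 \<le> quart k \<omega>" unfolding quart_def by (intro sum_nonneg) simp
  ultimately show "\<bar>quart k \<omega>\<bar> \<le> real (Suc k) * (4 * B\<^sup>2)\<^sup>2" by simp
qed

text \<open>The sum is at most \<open>maxdn * qv\<close>. The first factor tends to 0 in mean
  square, by uniform continuity of the paths and bounded convergence; the second stays bounded in
  mean square. A weighted inequality between product and squares takes the place of
  Cauchy-Schwarz.\<close>

lemma quart_tendsto: "(\<lambda>k. \<integral>\<omega>. quart k \<omega> \<partial>M) \<longlonglongrightarrow> 0"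
proof (rule LIMSEQ_I)
  fix e :: real assume e: "0 < e"
  \<comment> \<open>The bound of \<open>qv_sq_expectation_bound\<close>, raised by 1 so that it may
    be divided by.\<close>
  define R where "R = (2 * (C * T) + 4 * B\<^sup>2) * (C * T) + 1"
  have R0: "0 < R" using C0 T0 unfolding R_def by (intro add_nonneg_pos mult_nonneg_nonneg add_nonneg_nonneg) auto
  have m2i: "integrable M (\<lambda>\<omega>. (maxdn k \<omega>)\<^sup>2)" for k
  proof (rule integrable_bounded[of _ "(4 * B\<^sup>2)\<^sup>2"])
    show "(\<lambda>\<omega>. (maxdn k \<omega>)\<^sup>2) \<in> borel_measurable M" using maxdn_meas by auto
    show "\<bar>(maxdn k \<omega>)\<^sup>2\<bar> \<le> (4 * B\<^sup>2)\<^sup>2" if "\<omega> \<in> space M" for \<omega>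
      using power_mono[OF maxdn_bounds(2)[OF that] maxdn_bounds(1)[OF that], of k 2] by simp
  qed
  have "(\<lambda>k. \<integral>\<omega>. (maxdn k \<omega>)\<^sup>2 \<partial>M) \<longlonglongrightarrow> (\<integral>\<omega>. 0\<^sup>2 \<partial>M)"
  proof (rule integral_dominated_convergence[where w = "\<lambda>_. (4 * B\<^sup>2)\<^sup>2"])
    show "AE \<omega> in M. (\<lambda>k. (maxdn k \<omega>)\<^sup>2) \<longlonglongrightarrow> 0\<^sup>2"
      by (intro AE_I2 tendsto_power maxdn_tendsto)
    show "AE \<omega> in M. norm ((maxdn k \<omega>)\<^sup>2) \<le> (4 * B\<^sup>2)\<^sup>2" for k
    proof (rule AE_I2)
      fix \<omega> assume w: "\<omega> \<in> space M"
      show "norm ((maxdn k \<omega>)\<^sup>2) \<le> (4 * B\<^sup>2)\<^sup>2"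
        using power_mono[OF maxdn_bounds(2)[OF w] maxdn_bounds(1)[OF w], of k 2] by simp
    qed
  qed (use maxdn_meas in auto)
  then have "(\<lambda>k. R / (2 * e) * (\<integral>\<omega>. (maxdn k \<omega>)\<^sup>2 \<partial>M)) \<longlonglongrightarrow> R / (2 * e) * 0"
    by (intro tendsto_mult tendsto_const) simp
  then have "\<forall>\<^sub>F k in sequentially. R / (2 * e) * (\<integral>\<omega>. (maxdn k \<omega>)\<^sup>2 \<partial>M) < e / 2"
    using e by (intro order_tendstoD(2)[where y = "R / (2*e) * 0"]) auto
  then obtain k0 where k0: "\<And>k. k \<ge> k0 \<Longrightarrow> R / (2 * e) * (\<integral>\<omega>. (maxdn k \<omega>)\<^sup>2 \<partial>M) < e / 2"
    unfolding eventually_sequentially by blast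
  show "\<exists>k0. \<forall>k\<ge>k0. norm ((\<integral>\<omega>. quart k \<omega> \<partial>M) - 0) < e"
  proof (intro exI allI impI)
    fix k assume k: "k0 \<le> k"
    have "(\<integral>\<omega>. quart k \<omega> \<partial>M) \<le> (\<integral>\<omega>. R / (2 * e) * (maxdn k \<omega>)\<^sup>2 + e / (2 * R) * (qv k (Suc k) \<omega>)\<^sup>2 \<partial>M)"
    proof (rule integral_mono[OF quart_integrable])
      show "integrable M (\<lambda>\<omega>. R / (2 * e) * (maxdn k \<omega>)\<^sup>2 + e / (2 * R) * (qv k (Suc k) \<omega>)\<^sup>2)"
        using m2i qv_integrable(2)[of "Suc k" k] by auto
      fix \<omega> assume w: "\<omega> \<in> space M"
      have "quart k \<omega> \<le> (\<Sum>i<Suc k. maxdn k \<omega> * (dn k i \<omega>)\<^sup>2)" unfolding quart_def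
      proof (rule sum_mono)
        fix i assume "i \<in> {..<Suc k}"
        then have "(dn k i \<omega>)\<^sup>2 * (dn k i \<omega>)\<^sup>2 \<le> maxdn k \<omega> * (dn k i \<omega>)\<^sup>2" 
          using maxdn_ge[of i k \<omega>] by (intro mult_right_mono) auto
        then show "(dn k i \<omega>) ^ 4 \<le> maxdn k \<omega> * (dn k i \<omega>)\<^sup>2" by (simp add: power4_eq_xxxx power2_eq_square mult_ac)
      qed
      also have "\<dots> = maxdn k \<omega> * qv k (Suc k) \<omega>" by (simp only: qv_def sum_distrib_left)
      also have "\<dots> \<le> R / (2 * e) * (maxdn k \<omega>)\<^sup>2 + e / (2 * R) * (qv k (Suc k) \<omega>)\<^sup>2"
      proof -
        \<comment> \<open>Expanding this square yields the weights \<open>R / (2 * e)\<close> and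
          \<open>e / (2 * R)\<close>; the second leaves \<open>e / 2\<close> once the mean of
          \<open>qv^2\<close> is bounded by \<open>R\<close>.\<close>
        have "0 \<le> (R * maxdn k \<omega> - e * qv k (Suc k) \<omega>)\<^sup>2 / (2 * e * R)" using e R0 by simp
        then show ?thesis using e R0 by (simp add: power2_eq_square field_simps)
      qed
      finally show "quart k \<omega> \<le> R / (2 * e) * (maxdn k \<omega>)\<^sup>2 + e / (2 * R) * (qv k (Suc k) \<omega>)\<^sup>2" .
    qed
    also have "\<dots> = R / (2 * e) * (\<integral>\<omega>. (maxdn k \<omega>)\<^sup>2 \<partial>M) + e / (2 * R) * (\<integral>\<omega>. (qv k (Suc k) \<omega>)\<^sup>2 \<partial>M)"
      using m2i qv_integrable(2)[of "Suc k" k] by simp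
    also have "\<dots> < e / 2 + e / (2 * R) * R"
    proof (rule add_less_le_mono[OF k0[OF k] mult_left_mono])
      show "(\<integral>\<omega>. (qv k (Suc k) \<omega>)\<^sup>2 \<partial>M) \<le> R" using qv_sq_expectation_bound[of k] by (simp add: R_def)
    qed (use e R0 in simp)
    also have "\<dots> = e" using R0 by simp
    finally have "(\<integral>\<omega>. quart k \<omega> \<partial>M) < e" .
    moreover have "0 \<le> (\<integral>\<omega>. quart k \<omega> \<partial>M)" unfolding quart_def
      by (intro Bochner_Integration.integral_nonneg sum_nonneg) simp
    ultimately show "norm ((\<integral>\<omega>. quart k \<omega> \<partial>M) - 0) < e" by simp
  qed
qed

section \<open>Ito's formula along the grid, in expectation\<close>

lemma continuous_compose_meas:
  assumes f: "continuous_on {a..b} f" and t: "0 \<le> t" "t \<le> T"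
  shows "(\<lambda>\<omega>. f (y t \<omega>) :: real) \<in> borel_measurable (G t)"
proof -
  have ab: "a \<le> b" using y_range[of _ 0] T0 not_empty by force
  \<comment> \<open>\<open>f\<close> is continuous on \<open>{a..b}\<close> only. Composition with
    the clamp onto \<open>{a..b}\<close> is continuous everywhere and agrees with \<open>f\<close>
    on the range of \<open>y\<close>.\<close>
  have "continuous_on UNIV (\<lambda>x. f (max a (min b x)))"
    by (rule continuous_on_compose2[OF f]) (use ab in \<open>auto intro!: continuous_intros\<close>)
  then have "(\<lambda>x. f (max a (min b x))) \<in> borel_measurable borel"
    by (rule borel_measurable_continuous_onI)
  then have "(\<lambda>\<omega>. f (max a (min b (y t \<omega>)))) \<in> borel_measurable (G t)"
    by (rule measurable_compose[OF y_meas[OF t]])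
  moreover have *: "f (max a (min b (y t \<omega>))) = f (y t \<omega>)" if "\<omega> \<in> space (G t)" for \<omega>
    using y_range[of \<omega> t] that t by (auto simp: max_def min_def)
  ultimately show ?thesis 
    using measurable_cong[of "G t" "\<lambda>\<omega>. f (max a (min b (y t \<omega>)))" "\<lambda>\<omega>. f (y t \<omega>)", OF *] by blast
qed

lemma continuous_bounded:
  assumes "continuous_on {a..b} f"
  obtains K :: real where "0 \<le> K" "\<And>\<omega> t. \<omega> \<in> space M \<Longrightarrow> 0 \<le> t \<Longrightarrow> t \<le> T \<Longrightarrow> \<bar>f (y t \<omega>)\<bar> \<le> K"
proof -
  obtain K where "0 \<le> K" "\<And>x. x \<in> {a..b} \<Longrightarrow> \<bar>f x\<bar> \<le> K" by (rule compact_interval_bound[OF assms]) blast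
  then show thesis using y_range by (intro that) auto
qed

text \<open>Each increment of \<open>u (y t)\<close> is expanded to second order with coefficients
  known at the left grid point. In expectation the term in \<open>u1 * dn\<close> vanishes and
  \<open>dn^2\<close> may be replaced by the increment of \<open>A\<close>; the remainders sum to
  something that vanishes with the mesh. The weight \<open>w\<close> will be the discount
  factor.\<close>

lemma discrete_ito:
  assumes u: "\<And>x. x \<in> {a..b} \<Longrightarrow> (u has_real_derivative u1 x) (at x)"
    and u1: "\<And>x. x \<in> {a..b} \<Longrightarrow> (u1 has_real_derivative u2 x) (at x)"
    and u2: "continuous_on {a..b} u2"
    and w_meas: "\<And>t. 0 \<le> t \<Longrightarrow> t \<le> T \<Longrightarrow> w t \<in> borel_measurable (G t)"
    and w_bd: "\<And>t \<omega>. \<omega> \<in> space M \<Longrightarrow> 0 \<le> t \<Longrightarrow> t \<le> T \<Longrightarrow> \<bar>w t \<omega>\<bar> \<le> 1"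
  shows "(\<lambda>k. \<integral>\<omega>. (\<Sum>i<Suc k. w (grid k i) \<omega> * 
     (u (y (grid k (Suc i)) \<omega>) - u (y (grid k i) \<omega>) 
      - u1 (y (grid k i) \<omega>) * (d (grid k (Suc i)) \<omega> - d (grid k i) \<omega>)
      - u2 (y (grid k i) \<omega>) / 2 * (A (grid k (Suc i)) \<omega> - A (grid k i) \<omega>))) \<partial>M) \<longlonglongrightarrow> 0"
    (is "(\<lambda>k. \<integral>\<omega>. (\<Sum>i<Suc k. ?h k i \<omega>) \<partial>M) \<longlonglongrightarrow> 0")
proof (rule LIMSEQ_I)
  fix e :: real assume e: "0 < e"
  have cu: "continuous_on {a..b} u" and cu1: "continuous_on {a..b} u1"
    by (rule DERIV_continuous_on[OF has_field_derivative_at_within[OF u]], assumption)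
       (rule DERIV_continuous_on[OF has_field_derivative_at_within[OF u1]], assumption)
  obtain K where K: "0 \<le> K" "\<And>\<omega> t. \<omega> \<in> space M \<Longrightarrow> 0 \<le> t \<Longrightarrow> t \<le> T \<Longrightarrow> \<bar>u (y t \<omega>)\<bar> \<le> K"
    by (rule continuous_bounded[OF cu]) blast
  obtain K1 where K1: "0 \<le> K1" "\<And>\<omega> t. \<omega> \<in> space M \<Longrightarrow> 0 \<le> t \<Longrightarrow> t \<le> T \<Longrightarrow> \<bar>u1 (y t \<omega>)\<bar> \<le> K1"
    by (rule continuous_bounded[OF cu1]) blast
  obtain K2 where K2: "0 \<le> K2" "\<And>\<omega> t. \<omega> \<in> space M \<Longrightarrow> 0 \<le> t \<Longrightarrow> t \<le> T \<Longrightarrow> \<bar>u2 (y t \<omega>)\<bar> \<le> K2"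
    by (rule continuous_bounded[OF u2]) blast
  \<comment> \<open>The \<open>\<eta>\<close>-part of the remainders sums to at most
    \<open>\<eta> * (C * T)\<close>, which stays below \<open>e / 4\<close> for every mesh; the
    added 1 guards against \<open>C = 0\<close>.\<close>
  define \<eta> where "\<eta> = e / (4 * (C * T + 1))"
  have CT: "0 \<le> C * T" using C0 T0 by simp
  have \<eta>: "0 < \<eta>" using e CT by (simp add: \<eta>_def)
  have \<eta>CT: "\<eta> * (C * T) \<le> e / 4" using e CT by (simp add: \<eta>_def field_simps)
  obtain D where D: "0 \<le> D" 
    "\<And>y y' dn dd \<delta>. y \<in> {a..b} \<Longrightarrow> y' \<in> {a..b} \<Longrightarrow> y' - y = dn + dd \<Longrightarrow> \<bar>dd\<bar> \<le> C * \<delta> \<Longrightarrow> 0 \<le> \<delta> \<Longrightarrow> \<delta> \<le> T \<Longrightarrow>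
      \<bar>u y' - u y - u1 y * (dn + dd) - u2 y / 2 * dn\<^sup>2\<bar> \<le> \<eta> * dn\<^sup>2 + D * (\<delta>\<^sup>2 + dn ^ 4)"
    by (rule second_order_remainder_bound[OF u u1 u2 \<eta> less_imp_le[OF T0], of C]) blast+
  define dd where "dd k i \<omega> = d (grid k (Suc i)) \<omega> - d (grid k i) \<omega>" for k i \<omega>
  define dA where "dA k i \<omega> = A (grid k (Suc i)) \<omega> - A (grid k i) \<omega>" for k i \<omega>
  define \<rho> where "\<rho> k i \<omega> = u (y (grid k (Suc i)) \<omega>) - u (y (grid k i) \<omega>) - u1 (y (grid k i) \<omega>) * (dn k i \<omega> + dd k i \<omega>)
       - u2 (y (grid k i) \<omega>) / 2 * (dn k i \<omega>)\<^sup>2" for k i \<omega>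
  define \<delta> where "\<delta> k = T / real (Suc k)" for k
  have \<delta>0: "0 \<le> \<delta> k" "\<delta> k \<le> T" for k using T0 by (auto simp: \<delta>_def field_simps)
  have \<rho>_bd: "\<bar>\<rho> k i \<omega>\<bar> \<le> \<eta> * (dn k i \<omega>)\<^sup>2 + D * ((\<delta> k)\<^sup>2 + (dn k i \<omega>) ^ 4)" if "i < Suc k" "\<omega> \<in> space M" for k i \<omega>
    unfolding \<rho>_def
  proof (rule D(2))
    note g = grid_ineqs[OF that(1)]
    show "y (grid k i) \<omega> \<in> {a..b}" "y (grid k (Suc i)) \<omega> \<in> {a..b}" using y_range that(2) g by auto
    show "y (grid k (Suc i)) \<omega> - y (grid k i) \<omega> = dn k i \<omega> + dd k i \<omega>" 
      unfolding dn_def dd_def using y_diff that(2) g by auto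
    show "\<bar>dd k i \<omega>\<bar> \<le> C * \<delta> k" unfolding dd_def \<delta>_def grid_step[of k i, symmetric] using d_lip that(2) g by auto
  qed (use \<delta>0 in auto)
  have step: "integrable M (?h k i) \<and> \<bar>integral\<^sup>L M (?h k i)\<bar> \<le> \<eta> * (\<integral>\<omega>. (dn k i \<omega>)\<^sup>2 \<partial>M) + D * ((\<delta> k)\<^sup>2 + (\<integral>\<omega>. (dn k i \<omega>) ^ 4 \<partial>M))"
    if i: "i < Suc k" for k i
  proof -
    note g = grid_ineqs[OF i]
    define w' where "w' = w (grid k i)"
    have w': "w' \<in> borel_measurable (G (grid k i))" "\<And>\<omega>. \<omega> \<in> space M \<Longrightarrow> \<bar>w' \<omega>\<bar> \<le> 1"
      unfolding w'_def using w_meas w_bd g by auto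
    have u1m: "(\<lambda>\<omega>. u1 (y (grid k i) \<omega>)) \<in> borel_measurable (G (grid k i))" 
      and u2m: "(\<lambda>\<omega>. u2 (y (grid k i) \<omega>)) \<in> borel_measurable (G (grid k i))"
      using continuous_compose_meas cu1 u2 g by auto
    have um: "(\<lambda>\<omega>. u (y (grid k i) \<omega>)) \<in> borel_measurable M" "(\<lambda>\<omega>. u (y (grid k (Suc i)) \<omega>)) \<in> borel_measurable M"
      using measurable_G_M continuous_compose_meas[OF cu] g by blast+
    have [measurable]: "w' \<in> borel_measurable M" "(\<lambda>\<omega>. u1 (y (grid k i) \<omega>)) \<in> borel_measurable M"
       "(\<lambda>\<omega>. u2 (y (grid k i) \<omega>)) \<in> borel_measurable M"
      using measurable_G_M[OF g(1)] w' u1m u2m by blast+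
    note [measurable] = um dn_meas[OF i] 
    have [measurable]: "dd k i \<in> borel_measurable M" unfolding dd_def using d_meas g by auto
    have [measurable]: "dA k i \<in> borel_measurable M" unfolding dA_def using meas_M g by auto
    have ib: "integrable M (\<lambda>\<omega>. (dn k i \<omega>) ^ 4)"
    proof (rule integrable_bounded[of _ "(4 * B\<^sup>2)\<^sup>2"])
      show "\<bar>(dn k i \<omega>) ^ 4\<bar> \<le> (4 * B\<^sup>2)\<^sup>2" if "\<omega> \<in> space M" for \<omega>
        using power_mono[OF dn_sq_bound[OF i that], of 2] by simp
    qed measurable
    have rbi: "integrable M (\<lambda>\<omega>. \<eta> * (dn k i \<omega>)\<^sup>2 + D * ((\<delta> k)\<^sup>2 + (dn k i \<omega>) ^ 4))"
      using dn_sq_integrable[OF i] ib by auto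
    have \<rho>m[measurable]: "\<rho> k i \<in> borel_measurable M" unfolding \<rho>_def by measurable
    have w\<rho>: "\<bar>w' \<omega> * \<rho> k i \<omega>\<bar> \<le> \<eta> * (dn k i \<omega>)\<^sup>2 + D * ((\<delta> k)\<^sup>2 + (dn k i \<omega>) ^ 4)" if "\<omega> \<in> space M" for \<omega>
    proof -
      have "\<bar>w' \<omega> * \<rho> k i \<omega>\<bar> \<le> 1 * \<bar>\<rho> k i \<omega>\<bar>" unfolding abs_mult using w'(2)[OF that] by (intro mult_right_mono) auto
      then show ?thesis using \<rho>_bd[OF i that] by simp
    qed
    have i\<rho>: "integrable M (\<lambda>\<omega>. w' \<omega> * \<rho> k i \<omega>)"
      by (rule Bochner_Integration.integrable_bound[OF rbi]) (use w\<rho> in \<open>auto intro!: AE_I2 intro: order_trans[OF _ abs_ge_self]\<close>)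
    have i1: "integrable M (\<lambda>\<omega>. (w' \<omega> * u1 (y (grid k i) \<omega>)) * dn k i \<omega>)"
    proof (rule integrable_bounded[of _ "(1 * K1) * (2 * B)"])
      show "\<bar>(w' \<omega> * u1 (y (grid k i) \<omega>)) * dn k i \<omega>\<bar> \<le> (1 * K1) * (2 * B)" if "\<omega> \<in> space M" for \<omega>
        unfolding abs_mult using w'(2)[OF that] K1 dn_bound[OF i that] that g by (intro mult_mono) auto
    qed measurable
    have i2: "integrable M (\<lambda>\<omega>. (w' \<omega> * (u2 (y (grid k i) \<omega>) / 2)) * (dn k i \<omega>)\<^sup>2)"
    proof (rule integrable_bounded[of _ "(1 * (K2 / 2)) * (4 * B\<^sup>2)"])
      show "\<bar>(w' \<omega> * (u2 (y (grid k i) \<omega>) / 2)) * (dn k i \<omega>)\<^sup>2\<bar> \<le> (1 * (K2 / 2)) * (4 * B\<^sup>2)" if "\<omega> \<in> space M" for \<omega>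
        unfolding abs_mult using w'(2)[OF that] K2 dn_sq_bound[OF i that] that g by (intro mult_mono) auto
    qed measurable
    have i3: "integrable M (\<lambda>\<omega>. (w' \<omega> * (u2 (y (grid k i) \<omega>) / 2)) * dA k i \<omega>)"
    proof (rule integrable_bounded[of _ "(1 * (K2 / 2)) * (C * \<delta> k)"])
      show "\<bar>(w' \<omega> * (u2 (y (grid k i) \<omega>) / 2)) * dA k i \<omega>\<bar> \<le> (1 * (K2 / 2)) * (C * \<delta> k)" if "\<omega> \<in> space M" for \<omega>
        unfolding abs_mult using w'(2)[OF that] K2 A_lip[OF that, of "grid k i" "grid k (Suc i)"] that g grid_step[of k i]
        by (intro mult_mono) (auto simp: dA_def \<delta>_def)
    qed measurable
    have z1: "(\<integral>\<omega>. (w' \<omega> * u1 (y (grid k i) \<omega>)) * dn k i \<omega> \<partial>M) = 0"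
      unfolding dn_def
    proof (rule n_diff_mult[OF g(1-3)])
      show "\<bar>w' \<omega> * u1 (y (grid k i) \<omega>)\<bar> \<le> 1 * K1" if "\<omega> \<in> space M" for \<omega>
        unfolding abs_mult using w'(2)[OF that] K1 that g by (intro mult_mono) auto
    qed (use w' u1m in auto)
    have z2: "(\<integral>\<omega>. (w' \<omega> * (u2 (y (grid k i) \<omega>) / 2)) * (dn k i \<omega>)\<^sup>2 \<partial>M) = (\<integral>\<omega>. (w' \<omega> * (u2 (y (grid k i) \<omega>) / 2)) * dA k i \<omega> \<partial>M)"
      unfolding dn_def dA_def
    proof (rule n_diff_sq_mult[OF g(1-3)])
      show "\<bar>w' \<omega> * (u2 (y (grid k i) \<omega>) / 2)\<bar> \<le> 1 * (K2 / 2)" if "\<omega> \<in> space M" for \<omega>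
        unfolding abs_mult using w'(2)[OF that] K2 that g by (intro mult_mono) auto
    qed (use w' u2m in auto)
    \<comment> \<open>Taylor remainder, martingale increment, and exchange of \<open>dn^2\<close>
      for \<open>dA\<close>: only the first can have a nonzero expectation.\<close>
    have h: "?h k i = (\<lambda>\<omega>. w' \<omega> * \<rho> k i \<omega> + (w' \<omega> * u1 (y (grid k i) \<omega>)) * dn k i \<omega> 
        + ((w' \<omega> * (u2 (y (grid k i) \<omega>) / 2)) * (dn k i \<omega>)\<^sup>2 - (w' \<omega> * (u2 (y (grid k i) \<omega>) / 2)) * dA k i \<omega>))"
      by (rule ext) (simp add: \<rho>_def w'_def dA_def dd_def field_simps)
    have "integral\<^sup>L M (?h k i) = (\<integral>\<omega>. w' \<omega> * \<rho> k i \<omega> \<partial>M)"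
      unfolding h using i\<rho> i1 i2 i3 z1 z2 by simp
    moreover have "\<bar>\<integral>\<omega>. w' \<omega> * \<rho> k i \<omega> \<partial>M\<bar> \<le> (\<integral>\<omega>. \<bar>w' \<omega> * \<rho> k i \<omega>\<bar> \<partial>M)"
      by (rule integral_abs_bound)
    moreover have "(\<integral>\<omega>. \<bar>w' \<omega> * \<rho> k i \<omega>\<bar> \<partial>M) \<le> (\<integral>\<omega>. \<eta> * (dn k i \<omega>)\<^sup>2 + D * ((\<delta> k)\<^sup>2 + (dn k i \<omega>) ^ 4) \<partial>M)"
      using w\<rho> by (intro integral_mono rbi integrable_abs i\<rho>)
    moreover have "\<dots> = \<eta> * (\<integral>\<omega>. (dn k i \<omega>)\<^sup>2 \<partial>M) + D * ((\<delta> k)\<^sup>2 + (\<integral>\<omega>. (dn k i \<omega>) ^ 4 \<partial>M))"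
      using dn_sq_integrable[OF i] ib by (simp add: prob_space)
    moreover have "integrable M (?h k i)" unfolding h using i\<rho> i1 i2 i3 by auto
    ultimately show ?thesis by linarith
  qed
  have tot: "\<bar>\<integral>\<omega>. (\<Sum>i<Suc k. ?h k i \<omega>) \<partial>M\<bar> \<le> e / 4 + (D * T * T / real (Suc k) + D * (\<integral>\<omega>. quart k \<omega> \<partial>M))" for k
  proof -
    have e1: "(\<integral>\<omega>. (\<Sum>i<Suc k. ?h k i \<omega>) \<partial>M) = (\<Sum>i<Suc k. integral\<^sup>L M (?h k i))"
      using step by (intro Bochner_Integration.integral_sum) auto
    have e2: "\<bar>\<Sum>i<Suc k. integral\<^sup>L M (?h k i)\<bar> \<le> (\<Sum>i<Suc k. \<bar>integral\<^sup>L M (?h k i)\<bar>)" by (rule sum_abs)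
    have e3: "(\<Sum>i<Suc k. \<bar>integral\<^sup>L M (?h k i)\<bar>) \<le> (\<Sum>i<Suc k. \<eta> * (\<integral>\<omega>. (dn k i \<omega>)\<^sup>2 \<partial>M) + D * ((\<delta> k)\<^sup>2 + (\<integral>\<omega>. (dn k i \<omega>) ^ 4 \<partial>M)))"
    proof (rule sum_mono)
      fix i assume "i \<in> {..<Suc k}"
      then have "i < Suc k" by simp
      from step[OF this] show "\<bar>integral\<^sup>L M (?h k i)\<bar> \<le> \<eta> * (\<integral>\<omega>. (dn k i \<omega>)\<^sup>2 \<partial>M) + D * ((\<delta> k)\<^sup>2 + (\<integral>\<omega>. (dn k i \<omega>) ^ 4 \<partial>M))"
        by (rule conjunct2)
    qed
    have e4: "(\<Sum>i<Suc k. \<eta> * (\<integral>\<omega>. (dn k i \<omega>)\<^sup>2 \<partial>M) + D * ((\<delta> k)\<^sup>2 + (\<integral>\<omega>. (dn k i \<omega>) ^ 4 \<partial>M)))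
      = \<eta> * (\<Sum>i<Suc k. (\<integral>\<omega>. (dn k i \<omega>)\<^sup>2 \<partial>M)) + D * (real (Suc k) * (\<delta> k)\<^sup>2 + (\<Sum>i<Suc k. (\<integral>\<omega>. (dn k i \<omega>) ^ 4 \<partial>M)))"
      by (simp only: sum.distrib sum_distrib_left[symmetric] sum_constant card_lessThan)
    have e5: "(\<Sum>i<Suc k. (\<integral>\<omega>. (dn k i \<omega>)\<^sup>2 \<partial>M)) = (\<integral>\<omega>. qv k (Suc k) \<omega> \<partial>M)"
      unfolding qv_def by (rule Bochner_Integration.integral_sum[symmetric]) (use dn_sq_integrable in auto)
    have e6: "(\<Sum>i<Suc k. (\<integral>\<omega>. (dn k i \<omega>) ^ 4 \<partial>M)) = (\<integral>\<omega>. quart k \<omega> \<partial>M)"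
      unfolding quart_def
    proof (rule Bochner_Integration.integral_sum[symmetric])
      fix i assume "i \<in> {..<Suc k}"
      then have i: "i < Suc k" by simp
      show "integrable M (\<lambda>\<omega>. (dn k i \<omega>) ^ 4)"
      proof (rule integrable_bounded[of _ "(4 * B\<^sup>2)\<^sup>2"])
        show "(\<lambda>\<omega>. (dn k i \<omega>) ^ 4) \<in> borel_measurable M" using dn_meas[OF i] by auto
        show "\<bar>(dn k i \<omega>) ^ 4\<bar> \<le> (4 * B\<^sup>2)\<^sup>2" if "\<omega> \<in> space M" for \<omega>
          using power_mono[OF dn_sq_bound[OF i that], of 2] by simp
      qed
    qed
    have e7: "\<eta> * (\<integral>\<omega>. qv k (Suc k) \<omega> \<partial>M) \<le> \<eta> * (C * T)"
      using qv_expectation_CT[of "Suc k" k] \<eta> by (intro mult_left_mono) auto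
    have e8: "real (Suc k) * (\<delta> k)\<^sup>2 = T * T / real (Suc k)"
      by (simp add: \<delta>_def power2_eq_square field_simps del: of_nat_Suc)
    have e9: "D * (T * T / real (Suc k) + (\<integral>\<omega>. quart k \<omega> \<partial>M)) = D * T * T / real (Suc k) + D * (\<integral>\<omega>. quart k \<omega> \<partial>M)"
      by (simp add: distrib_left mult.assoc)
    show ?thesis using e2 e3 e7 \<eta>CT unfolding e1 e4 e5 e6 e8 e9 by linarith
  qed
  have "(\<lambda>k. D * T * T / real (Suc k) + D * (\<integral>\<omega>. quart k \<omega> \<partial>M)) \<longlonglongrightarrow> 0 + D * 0"
    by (intro tendsto_add tendsto_mult tendsto_const quart_tendsto LIMSEQ_Suc[OF lim_const_over_n])
  then have "\<forall>\<^sub>F k in sequentially. D * T * T / real (Suc k) + D * (\<integral>\<omega>. quart k \<omega> \<partial>M) < e / 4"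
    using e by (intro order_tendstoD(2)) auto
  then obtain k0 where k0: "\<And>k. k \<ge> k0 \<Longrightarrow> D * T * T / real (Suc k) + D * (\<integral>\<omega>. quart k \<omega> \<partial>M) < e / 4"
    unfolding eventually_sequentially by blast
  show "\<exists>k0. \<forall>k\<ge>k0. norm ((\<integral>\<omega>. (\<Sum>i<Suc k. ?h k i \<omega>) \<partial>M) - 0) < e"
  proof (intro exI allI impI)
    fix k assume "k0 \<le> k"
    from k0[OF this] tot[of k] e show "norm ((\<integral>\<omega>. (\<Sum>i<Suc k. ?h k i \<omega>) \<partial>M) - 0) < e"
      unfolding real_norm_def diff_zero by linarith
  qed
qed

end

section \<open>Dynkin's formula\<close>

text \<open>Riemann-Stieltjes sums with an integrator frozen after \<open>S\<close>. Tags may lie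
  beyond \<open>S\<close>, hence \<open>p\<close> has to live on \<open>{0..T}\<close>, whereas the
  integrator is differentiated on \<open>{0..S}\<close> only. Each summand is compared with the
  increment of the integral \<open>P\<close> through the mean value inequality.\<close>

lemma stopped_riemann_sum_tendsto:
  fixes p q D :: "real \<Rightarrow> real" and c :: "nat \<Rightarrow> nat \<Rightarrow> real"
  assumes ST: "0 \<le> S" "S \<le> T" "0 < T"
    and p: "continuous_on {0..T} p" and q: "continuous_on {0..S} q"
    and D: "\<And>t. t \<in> {0..S} \<Longrightarrow> (D has_real_derivative q t) (at t within {0..S})"
    and g: "\<And>k i. g k i = real i * (T / real (Suc k))"
    and c: "\<And>k i. c k i \<in> {g k i..g k (Suc i)}"
  shows "(\<lambda>k. \<Sum>i<Suc k. p (c k i) * (D (min (g k (Suc i)) S) - D (min (g k i) S))) \<longlonglongrightarrow> integral {0..S} (\<lambda>s. p s * q s)"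
proof (rule LIMSEQ_I)
  fix e :: real assume e: "0 < e"
  obtain Q0 where Q0: "0 \<le> Q0" "\<And>t. t \<in> {0..S} \<Longrightarrow> \<bar>q t\<bar> \<le> Q0"
    by (rule compact_interval_bound[OF q]) blast
  define Q where "Q = Q0 + 1"
  have Q: "0 < Q" "\<And>t. t \<in> {0..S} \<Longrightarrow> \<bar>q t\<bar> \<le> Q" using Q0 unfolding Q_def by force+
  \<comment> \<open>A cell contributes at most \<open>\<epsilon> * Q\<close> times its length, so
    the total error is at most \<open>\<epsilon> * Q * T = e / 2\<close>.\<close>
  define \<epsilon> where "\<epsilon> = e / (2 * Q * T)"
  have \<epsilon>: "0 < \<epsilon>" using e Q ST by (simp add: \<epsilon>_def)
  have "uniformly_continuous_on {0..T} p" using p by (intro compact_uniformly_continuous) auto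
  then obtain \<delta> where \<delta>: "0 < \<delta>" 
    "\<And>s t. s \<in> {0..T} \<Longrightarrow> t \<in> {0..T} \<Longrightarrow> \<bar>t - s\<bar> < \<delta> \<Longrightarrow> \<bar>p t - p s\<bar> < \<epsilon>"
    unfolding uniformly_continuous_on_def dist_real_def using \<epsilon> by metis
  have "(\<lambda>k. T / real (Suc k)) \<longlonglongrightarrow> 0" by (rule LIMSEQ_Suc[OF lim_const_over_n])
  then obtain k0 where k0: "\<And>k. k \<ge> k0 \<Longrightarrow> T / real (Suc k) < \<delta>"
    using order_tendstoD(2)[of _ 0 sequentially \<delta>] \<delta>(1) unfolding eventually_sequentially by blast
  define P where "P t = integral {0..t} (\<lambda>s. p s * q s)" for t
  have pq: "continuous_on {0..S} (\<lambda>s. p s * q s)"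
    using q continuous_on_subset[OF p] ST by (intro continuous_on_mult) auto
  have P: "(P has_real_derivative p t * q t) (at t within {0..S})" if "t \<in> {0..S}" for t
    using integral_has_real_derivative[OF pq that] unfolding P_def .
  show "\<exists>k0. \<forall>k\<ge>k0. norm ((\<Sum>i<Suc k. p (c k i) * (D (min (g k (Suc i)) S) - D (min (g k i) S))) 
      - integral {0..S} (\<lambda>s. p s * q s)) < e"
  proof (intro exI allI impI)
    fix k assume k: "k0 \<le> k"
    define \<theta> where "\<theta> i = min (g k i) S" for i
    have gT: "g k i \<le> T" if "i \<le> Suc k" for i
    proof -
      have "real i * (T / real (Suc k)) \<le> real (Suc k) * (T / real (Suc k))" using that ST by (intro mult_right_mono) auto
      then show ?thesis using g by (simp del: of_nat_Suc)
    qed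
    have gstep: "g k (Suc i) = g k i + T / real (Suc k)" for i
      unfolding g of_nat_Suc[of i] by (simp only: distrib_right mult_1_left add.commute)
    have g0: "0 \<le> g k i" for i using ST by (simp add: g)
    have st0: "0 \<le> T / real (Suc k)" using ST by simp
    have \<theta>mono: "\<theta> i \<le> \<theta> (Suc i)" for i unfolding \<theta>_def using gstep[of i] st0 by linarith
    have \<theta>0: "0 \<le> \<theta> i" "\<theta> i \<le> S" for i unfolding \<theta>_def using g0[of i] ST by auto
    have \<theta>end: "\<theta> (Suc k) = S" "\<theta> 0 = 0" using ST by (auto simp: \<theta>_def g simp del: of_nat_Suc)
    have each: "\<bar>p (c k i) * (D (\<theta> (Suc i)) - D (\<theta> i)) - (P (\<theta> (Suc i)) - P (\<theta> i))\<bar> \<le> \<epsilon> * Q * (\<theta> (Suc i) - \<theta> i)"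
      if i: "i < Suc k" for i
    proof (cases "S < g k i")
      case True
      then have "\<theta> (Suc i) = \<theta> i" using gstep[of i] st0 by (auto simp: \<theta>_def)
      then show ?thesis by simp
    next
      case False
      let ?H = "\<lambda>t. p (c k i) * D t - P t"
      have "norm (?H (\<theta> (Suc i)) - ?H (\<theta> i)) \<le> \<epsilon> * Q * norm (\<theta> (Suc i) - \<theta> i)"
      proof (rule field_differentiable_bound[of "{\<theta> i..\<theta> (Suc i)}" ?H "\<lambda>t. (p (c k i) - p t) * q t"])
        fix t assume t: "t \<in> {\<theta> i..\<theta> (Suc i)}"
        then have tS: "t \<in> {0..S}" using \<theta>0[of i] \<theta>0[of "Suc i"] by auto
        have sub: "{\<theta> i..\<theta> (Suc i)} \<subseteq> {0..S}" using \<theta>0[of i] \<theta>0[of "Suc i"] by auto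
        have "(?H has_real_derivative p (c k i) * q t - p t * q t) (at t within {0..S})"
          by (intro DERIV_diff DERIV_cmult D P tS)
        then show "(?H has_field_derivative (p (c k i) - p t) * q t) (at t within {\<theta> i..\<theta> (Suc i)})"
          using DERIV_subset[OF _ sub] by (simp add: left_diff_distrib)
        show "norm ((p (c k i) - p t) * q t) \<le> \<epsilon> * Q"
        proof -
          have "\<bar>p (c k i) - p t\<bar> \<le> \<epsilon>"
          proof -
            have "g k i \<le> S" using False by simp
            then have "g k i \<le> t" "t \<le> g k (Suc i)" using t by (auto simp: \<theta>_def)
            then have "\<bar>p (c k i) - p t\<bar> < \<epsilon>"
              using c[of k i] gstep[of i] k0[OF k] gT[of "Suc i"] g0[of i] i by (intro \<delta>(2)) auto
            then show ?thesis by simp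
          qed
          then show ?thesis unfolding real_norm_def abs_mult using Q(2)[OF tS] \<epsilon> by (intro mult_mono) auto
        qed
      qed (use \<theta>mono in auto)
      then show ?thesis using \<theta>mono[of i] by (simp add: algebra_simps)
    qed
    have "(\<Sum>i<Suc k. P (\<theta> (Suc i)) - P (\<theta> i)) = P S - P 0"
      using sum_lessThan_telescope[of "\<lambda>i. P (\<theta> i)" "Suc k"] \<theta>end by simp
    then have "(\<Sum>i<Suc k. p (c k i) * (D (\<theta> (Suc i)) - D (\<theta> i))) - P S
      = (\<Sum>i<Suc k. p (c k i) * (D (\<theta> (Suc i)) - D (\<theta> i)) - (P (\<theta> (Suc i)) - P (\<theta> i)))"
      by (simp only: sum_subtractf) (simp add: P_def)
    also have "\<bar>\<dots>\<bar> \<le> (\<Sum>i<Suc k. \<bar>p (c k i) * (D (\<theta> (Suc i)) - D (\<theta> i)) - (P (\<theta> (Suc i)) - P (\<theta> i))\<bar>)"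
      by (rule sum_abs)
    also have "\<dots> \<le> (\<Sum>i<Suc k. \<epsilon> * Q * (\<theta> (Suc i) - \<theta> i))"
      using each by (intro sum_mono) auto
    also have "\<dots> = \<epsilon> * Q * S"
      unfolding sum_distrib_left[symmetric] using sum_lessThan_telescope[of \<theta> "Suc k"] \<theta>end by simp
    also have "\<dots> \<le> \<epsilon> * Q * T" using \<epsilon> Q ST by (intro mult_left_mono) auto
    also have "\<dots> = e / 2" using Q ST by (simp add: \<epsilon>_def)
    also have "\<dots> < e" using e by simp
    finally show "norm ((\<Sum>i<Suc k. p (c k i) * (D (min (g k (Suc i)) S) - D (min (g k i) S))) - integral {0..S} (\<lambda>s. p s * q s)) < e"
      by (simp add: \<theta>_def P_def)
  qed
qed

lemma set_integral_eq_integral_continuous: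
  fixes q :: "real \<Rightarrow> real"
  assumes "continuous_on {0..t} q"
  shows "(LINT s:{0..t}|lborel. q s) = integral {0..t} q"
  by (rule set_borel_integral_eq_integral(2)[OF borel_integrable_atLeastAtMost'[OF assms]])

lemma integral_Lipschitz:
  fixes q :: "real \<Rightarrow> real"
  assumes q: "continuous_on {0..S} q" and st: "0 \<le> s" "s \<le> t" "t \<le> S" 
    and K: "\<And>v. v \<in> {0..S} \<Longrightarrow> \<bar>q v\<bar> \<le> K"
  shows "\<bar>integral {0..t} q - integral {0..s} q\<bar> \<le> K * (t - s)"
proof -
  have i: "q integrable_on {0..t}" 
    by (rule integrable_continuous_real[OF continuous_on_subset[OF q]]) (use st in auto)
  have "integral {0..s} q + integral {s..t} q = integral {0..t} q"
    by (rule Henstock_Kurzweil_Integration.integral_combine) (use st i in auto)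
  moreover have "norm (integral {s..t} q) \<le> K * (t - s)"
    by (rule integral_bound) (use st K continuous_on_subset[OF q] in auto)
  ultimately show ?thesis by (simp add: abs_le_iff)
qed

context filtered_prob_space
begin

text \<open>\<open>discrete_ito\<close> is applied to the solution stopped at \<open>S\<close> with
  the discount factor as weight. Path by path the compensating sums converge to \<open>J\<close>,
  with a bound uniform in the mesh, so the vanishing expectations pass to the limit. Boundedness of
  the limit also yields the integrability claim.\<close>

lemma dynkin:
  fixes Y :: "real \<Rightarrow> 'a \<Rightarrow> real"
  assumes sol: "strong_solution M F W I \<mu> \<sigma> x Y"
    and S_st: "\<And>q. 0 \<le> q \<Longrightarrow> {\<omega>\<in>space M. S \<omega> \<le> q} \<in> F q"
    and S_nn: "\<And>\<omega>. \<omega> \<in> space M \<Longrightarrow> 0 \<le> S \<omega>" and S_le: "\<And>\<omega>. \<omega> \<in> space M \<Longrightarrow> S \<omega> \<le> T"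
    and T0: "0 < T"
    and range: "\<And>\<omega> t. \<omega> \<in> space M \<Longrightarrow> 0 \<le> t \<Longrightarrow> t \<le> S \<omega> \<Longrightarrow> Y t \<omega> \<in> {a..b}"
    and \<mu>: "continuous_on {a..b} \<mu>" and \<sigma>: "continuous_on {a..b} \<sigma>" and r: "0 \<le> r"
    and u: "\<And>x. x \<in> {a..b} \<Longrightarrow> (u has_real_derivative u1 x) (at x)"
    and u1: "\<And>x. x \<in> {a..b} \<Longrightarrow> (u1 has_real_derivative u2 x) (at x)"
    and u2: "continuous_on {a..b} u2"
  shows "integrable M (\<lambda>\<omega>. integral {0..S \<omega>} (\<lambda>s. exp (- r * s) * 
        ((\<sigma> (Y s \<omega>))\<^sup>2 / 2 * u2 (Y s \<omega>) + \<mu> (Y s \<omega>) * u1 (Y s \<omega>) - r * u (Y s \<omega>))))"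
    and "(\<integral>\<omega>. exp (- r * S \<omega>) * u (Y (S \<omega>) \<omega>) \<partial>M) = u x + 
    (\<integral>\<omega>. integral {0..S \<omega>} (\<lambda>s. exp (- r * s) * 
        ((\<sigma> (Y s \<omega>))\<^sup>2 / 2 * u2 (Y s \<omega>) + \<mu> (Y s \<omega>) * u1 (Y s \<omega>) - r * u (Y s \<omega>))) \<partial>M)"
proof -
  define d0 where "d0 t \<omega> = (LINT s:{0..t}|lborel. \<mu> (Y s \<omega>))" for t \<omega>
  define A0 where "A0 t \<omega> = (LINT s:{0..t}|lborel. (\<sigma> (Y s \<omega>))\<^sup>2)" for t \<omega>
  define N where "N t \<omega> = Y t \<omega> - x - d0 t \<omega>" for t \<omega>
  have cm: "cont_local_martingale M F N" and cm2: "cont_local_martingale M F (\<lambda>t \<omega>. (N t \<omega>)\<^sup>2 - A0 t \<omega>)"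
    and Y_ad: "adapted_proc M F Y" and Y0: "\<And>\<omega>. \<omega> \<in> space M \<Longrightarrow> Y 0 \<omega> = x"
    and Y_cont: "\<And>\<omega>. \<omega> \<in> space M \<Longrightarrow> continuous_on {0..} (\<lambda>t. Y t \<omega>)"
    using sol unfolding strong_solution_def Let_def N_def d0_def A0_def by auto
  have N_cont: "continuous_on {0..} (\<lambda>t. N t \<omega>)" and N2_cont: "continuous_on {0..} (\<lambda>t. (N t \<omega>)\<^sup>2 - A0 t \<omega>)"
    if "\<omega> \<in> space M" for \<omega>
    using cm cm2 that unfolding cont_local_martingale_def by auto
  have N_meas: "N t \<in> borel_measurable (G t)" and N2_meas: "(\<lambda>\<omega>. (N t \<omega>)\<^sup>2 - A0 t \<omega>) \<in> borel_measurable (G t)"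
    and Y_meas: "Y t \<in> borel_measurable (G t)" if "0 \<le> t" for t
    using cm cm2 adapted_procD[OF _ that] Y_ad unfolding cont_local_martingale_def by auto
  define \<theta> where "\<theta> t \<omega> = min t (S \<omega>)" for t :: real and \<omega>
  have \<theta>_meas: "\<theta> t \<in> borel_measurable (G t)" if "0 \<le> t" for t
    using measurable_min_stopping[OF that S_st S_nn] unfolding \<theta>_def .
  have \<theta>b: "0 \<le> \<theta> t \<omega>" "\<theta> t \<omega> \<le> t" "\<theta> t \<omega> \<le> S \<omega>" if "\<omega> \<in> space M" "0 \<le> t" for t \<omega>
    using S_nn[OF that(1)] that by (auto simp: \<theta>_def)
  have \<theta>mono: "\<theta> s \<omega> \<le> \<theta> t \<omega>" "\<theta> t \<omega> - \<theta> s \<omega> \<le> t - s" if "s \<le> t" for s t \<omega>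
    using that by (auto simp: \<theta>_def min_def)
  have \<theta>img: "(\<lambda>t. \<theta> t \<omega>) ` {0..T} \<subseteq> {0..S \<omega>}" if "\<omega> \<in> space M" for \<omega>
    using S_nn[OF that] by (auto simp: \<theta>_def)
  have stopped_meas: "(\<lambda>\<omega>. Z (\<theta> t \<omega>) \<omega>) \<in> borel_measurable (G t)" 
    if t: "0 \<le> t" and Z: "\<And>q. 0 \<le> q \<Longrightarrow> Z q \<in> borel_measurable (G q)" 
      and cont: "\<And>\<omega>. \<omega> \<in> space M \<Longrightarrow> continuous_on {0..} (\<lambda>q. Z q \<omega>)" for Z :: "real \<Rightarrow> 'a \<Rightarrow> real" and t
  proof (rule measurable_random_time[OF t, where Z = Z and R = "\<theta> t"])
    show "Z q \<in> borel_measurable (G t)" if "0 \<le> q" "q \<le> t" for q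
      by (rule measurable_G_mono[OF that Z[OF that(1)]])
  qed (use cont \<theta>_meas[OF t] \<theta>b t in auto)
  obtain K\<mu> where K\<mu>: "0 \<le> K\<mu>" "\<And>x. x \<in> {a..b} \<Longrightarrow> \<bar>\<mu> x\<bar> \<le> K\<mu>" by (rule compact_interval_bound[OF \<mu>]) blast
  obtain K\<sigma> where K\<sigma>: "0 \<le> K\<sigma>" "\<And>x. x \<in> {a..b} \<Longrightarrow> \<bar>(\<sigma> x)\<^sup>2\<bar> \<le> K\<sigma>" 
    by (rule compact_interval_bound[OF continuous_on_power[OF \<sigma>, of 2]]) blast
  define C where "C = K\<mu> + K\<sigma>"
  have C0: "0 \<le> C" using K\<mu> K\<sigma> by (simp add: C_def)
  have path: "continuous_on {0..S \<omega>} (\<lambda>s. f (Y s \<omega>))" if "\<omega> \<in> space M" "continuous_on {a..b} f" for \<omega> and f :: "real \<Rightarrow> real"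
    by (rule continuous_on_compose2[OF that(2) continuous_on_subset[OF Y_cont[OF that(1)]]]) (use range[OF that(1)] in auto)
  have d0_eq: "d0 t \<omega> = integral {0..t} (\<lambda>s. \<mu> (Y s \<omega>))" if "\<omega> \<in> space M" "t \<le> S \<omega>" for t \<omega>
    unfolding d0_def by (rule set_integral_eq_integral_continuous[OF continuous_on_subset[OF path[OF that(1) \<mu>]]]) (use that in auto)
  have A0_eq: "A0 t \<omega> = integral {0..t} (\<lambda>s. (\<sigma> (Y s \<omega>))\<^sup>2)" if "\<omega> \<in> space M" "t \<le> S \<omega>" for t \<omega>
    unfolding A0_def by (rule set_integral_eq_integral_continuous[OF continuous_on_subset[OF path[OF that(1) continuous_on_power[OF \<sigma>]]]]) (use that in auto)
  have d0_lip: "\<bar>d0 t \<omega> - d0 s \<omega>\<bar> \<le> C * (t - s)" if "\<omega> \<in> space M" "0 \<le> s" "s \<le> t" "t \<le> S \<omega>" for s t \<omega>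
  proof -
    have "\<bar>\<mu> (Y v \<omega>)\<bar> \<le> C" if "v \<in> {0..S \<omega>}" for v
      using K\<mu>(2)[OF range[OF \<open>\<omega> \<in> space M\<close>, of v]] that K\<sigma>(1) by (simp add: C_def)
    from integral_Lipschitz[OF path[OF that(1) \<mu>] that(2-4) this] show ?thesis using d0_eq that by simp
  qed
  have A0_lip: "\<bar>A0 t \<omega> - A0 s \<omega>\<bar> \<le> C * (t - s)" if "\<omega> \<in> space M" "0 \<le> s" "s \<le> t" "t \<le> S \<omega>" for s t \<omega>
  proof -
    have "\<bar>(\<sigma> (Y v \<omega>))\<^sup>2\<bar> \<le> C" if "v \<in> {0..S \<omega>}" for v
      using K\<sigma>(2)[OF range[OF \<open>\<omega> \<in> space M\<close>, of v]] that K\<mu>(1) by (simp add: C_def)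
    from integral_Lipschitz[OF path[OF that(1) continuous_on_power[OF \<sigma>]] that(2-4) this] show ?thesis using A0_eq that by simp
  qed
  have d00: "d0 0 \<omega> = 0" "A0 0 \<omega> = 0" if "\<omega> \<in> space M" for \<omega>
    using d0_eq[OF that, of 0] A0_eq[OF that, of 0] S_nn[OF that] by auto
  \<comment> \<open>Read off from \<open>N = Y - x - d0\<close>, with \<open>Y\<close> in
    \<open>{a..b}\<close> up to \<open>S\<close> and the drift integral at most
    \<open>C * T\<close>.\<close>
  define B where "B = \<bar>a\<bar> + \<bar>b\<bar> + \<bar>x\<bar> + C * T"
  have ctb: "C * \<theta> t \<omega> \<le> C * T" if "\<omega> \<in> space M" "0 \<le> t" for t \<omega>
    using \<theta>b[OF that] S_le[OF that(1)] C0 by (intro mult_left_mono) auto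
  have N_bd: "\<bar>N (\<theta> t \<omega>) \<omega>\<bar> \<le> B" if "\<omega> \<in> space M" "0 \<le> t" for t \<omega>
  proof -
    have "\<bar>d0 (\<theta> t \<omega>) \<omega>\<bar> \<le> C * T"
      using d0_lip[OF that(1), of 0 "\<theta> t \<omega>"] \<theta>b[OF that] d00[OF that(1)] ctb[OF that] by simp
    moreover have "Y (\<theta> t \<omega>) \<omega> \<in> {a..b}" using range[OF that(1)] \<theta>b[OF that] by blast
    ultimately show ?thesis unfolding N_def B_def by (auto simp: abs_le_iff)
  qed
  have N2_bd: "\<bar>(N (\<theta> t \<omega>) \<omega>)\<^sup>2 - A0 (\<theta> t \<omega>) \<omega>\<bar> \<le> B\<^sup>2 + C * T" if "\<omega> \<in> space M" "0 \<le> t" for t \<omega>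
  proof -
    have "\<bar>A0 (\<theta> t \<omega>) \<omega>\<bar> \<le> C * T"
      using A0_lip[OF that(1), of 0 "\<theta> t \<omega>"] \<theta>b[OF that] d00[OF that(1)] ctb[OF that] by simp
    moreover have "(N (\<theta> t \<omega>) \<omega>)\<^sup>2 \<le> B\<^sup>2" using power_mono[OF N_bd[OF that], of 2] by simp
    moreover have "0 \<le> (N (\<theta> t \<omega>) \<omega>)\<^sup>2" by simp
    ultimately show ?thesis by linarith
  qed
  define y where "y t \<omega> = Y (\<theta> t \<omega>) \<omega>" for t \<omega>
  define n where "n t \<omega> = N (\<theta> t \<omega>) \<omega>" for t \<omega>
  define d where "d t \<omega> = d0 (\<theta> t \<omega>) \<omega>" for t \<omega>
  define A where "A t \<omega> = A0 (\<theta> t \<omega>) \<omega>" for t \<omega>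
  define w where "w t \<omega> = exp (- r * \<theta> t \<omega>)" for t \<omega>
  interpret I: ito_decomposition M F T B C a b y n d A
  proof
    fix t s :: real and \<omega> E
    show "y t \<in> borel_measurable (G t)" if "0 \<le> t" unfolding y_def by (rule stopped_meas[OF that Y_meas Y_cont])
    show "n t \<in> borel_measurable (G t)" if "0 \<le> t" unfolding n_def by (rule stopped_meas[OF that N_meas N_cont])
    \<comment> \<open>Adaptedness is given for \<open>N\<close> and for \<open>N^2 - A0\<close>, so
      the bracket is recovered as a difference of the two.\<close>
    show Am: "A t \<in> borel_measurable (G t)" if "0 \<le> t"
    proof -
      have 1: "(\<lambda>\<omega>. (N (\<theta> t \<omega>) \<omega>)\<^sup>2 - A0 (\<theta> t \<omega>) \<omega>) \<in> borel_measurable (G t)" by (rule stopped_meas[OF that N2_meas N2_cont])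
      have 2: "(\<lambda>\<omega>. N (\<theta> t \<omega>) \<omega>) \<in> borel_measurable (G t)" by (rule stopped_meas[OF that N_meas N_cont])
      have eq: "A t = (\<lambda>\<omega>. (N (\<theta> t \<omega>) \<omega>)\<^sup>2 - ((N (\<theta> t \<omega>) \<omega>)\<^sup>2 - A0 (\<theta> t \<omega>) \<omega>))" by (simp add: A_def fun_eq_iff)
      show ?thesis unfolding eq by (rule borel_measurable_diff[OF borel_measurable_power[OF 2] 1])
    qed
    show "d t \<in> borel_measurable M" if "0 \<le> t"
    proof -
      have "(\<lambda>\<omega>. Y (\<theta> t \<omega>) \<omega> - x - N (\<theta> t \<omega>) \<omega>) \<in> borel_measurable (G t)"
        by (intro borel_measurable_diff stopped_meas[OF that Y_meas Y_cont] stopped_meas[OF that N_meas N_cont]) auto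
      then have "(\<lambda>\<omega>. Y (\<theta> t \<omega>) \<omega> - x - N (\<theta> t \<omega>) \<omega>) \<in> borel_measurable M" by (rule measurable_G_M[OF that])
      moreover have "d t = (\<lambda>\<omega>. Y (\<theta> t \<omega>) \<omega> - x - N (\<theta> t \<omega>) \<omega>)" by (simp add: d_def N_def fun_eq_iff)
      ultimately show ?thesis by simp
    qed
    show "y t \<omega> \<in> {a..b}" if "\<omega> \<in> space M" "0 \<le> t" unfolding y_def using range[OF that(1)] \<theta>b[OF that] by blast
    show "\<bar>n t \<omega>\<bar> \<le> B" if "\<omega> \<in> space M" "0 \<le> t" unfolding n_def by (rule N_bd[OF that])
    show "continuous_on {0..T} (\<lambda>t. n t \<omega>)" if "\<omega> \<in> space M" unfolding n_def
    proof (rule continuous_on_compose2[OF N_cont[OF that]])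
      show "continuous_on {0..T} (\<lambda>t. \<theta> t \<omega>)" unfolding \<theta>_def by (intro continuous_intros)
      show "(\<lambda>t. \<theta> t \<omega>) ` {0..T} \<subseteq> {0..}" using \<theta>img[OF that] by auto
    qed
    show "y t \<omega> - y s \<omega> = n t \<omega> - n s \<omega> + (d t \<omega> - d s \<omega>)"
      unfolding y_def n_def d_def N_def by linarith
    show "\<bar>d t \<omega> - d s \<omega>\<bar> \<le> C * (t - s)" if "\<omega> \<in> space M" "0 \<le> s" "s \<le> t"
    proof -
      have "\<bar>d t \<omega> - d s \<omega>\<bar> \<le> C * (\<theta> t \<omega> - \<theta> s \<omega>)" unfolding d_def
        using \<theta>b[OF that(1), of s] \<theta>b[OF that(1), of t] \<theta>mono[OF that(3)] that by (intro d0_lip) auto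
      also have "\<dots> \<le> C * (t - s)" using \<theta>mono(2)[OF that(3)] C0 by (rule mult_left_mono)
      finally show ?thesis .
    qed
    show "\<bar>A t \<omega> - A s \<omega>\<bar> \<le> C * (t - s)" if "\<omega> \<in> space M" "0 \<le> s" "s \<le> t"
    proof -
      have "\<bar>A t \<omega> - A s \<omega>\<bar> \<le> C * (\<theta> t \<omega> - \<theta> s \<omega>)" unfolding A_def
        using \<theta>b[OF that(1), of s] \<theta>b[OF that(1), of t] \<theta>mono[OF that(3)] that by (intro A0_lip) auto
      also have "\<dots> \<le> C * (t - s)" using \<theta>mono(2)[OF that(3)] C0 by (rule mult_left_mono)
      finally show ?thesis .
    qed
    show "(\<integral>\<omega>. indicator E \<omega> * (n t \<omega> - n s \<omega>) \<partial>M) = 0" if "0 \<le> s" "s \<le> t" "E \<in> F s"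
      unfolding n_def \<theta>_def
      by (rule local_martingale_stopped[OF cm S_st S_nn that(1,2) _ that(3)]) (use N_bd in \<open>auto simp: \<theta>_def\<close>)
    show "(\<integral>\<omega>. indicator E \<omega> * ((n t \<omega>)\<^sup>2 - A t \<omega> - ((n s \<omega>)\<^sup>2 - A s \<omega>)) \<partial>M) = 0" if "0 \<le> s" "s \<le> t" "E \<in> F s"
      unfolding n_def A_def \<theta>_def
      by (rule local_martingale_stopped[OF cm2 S_st S_nn that(1,2) _ that(3)]) (use N2_bd in \<open>auto simp: \<theta>_def\<close>)
  qed (use T0 C0 in auto)
  have w_meas: "w t \<in> borel_measurable (G t)" if "0 \<le> t" for t
    using \<theta>_meas[OF that] unfolding w_def[abs_def] by measurable
  have w_bd: "\<bar>w t \<omega>\<bar> \<le> 1" if "\<omega> \<in> space M" "0 \<le> t" for t \<omega>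
    using \<theta>b[OF that] r unfolding w_def by simp
  let ?g = I.grid
  have cu: "continuous_on {a..b} u" and cu1: "continuous_on {a..b} u1"
    by (rule DERIV_continuous_on[OF has_field_derivative_at_within[OF u]], assumption)
       (rule DERIV_continuous_on[OF has_field_derivative_at_within[OF u1]], assumption)
  define h where "h k \<omega> = (\<Sum>i<Suc k. w (?g k i) \<omega> * (u (y (?g k (Suc i)) \<omega>) - u (y (?g k i) \<omega>)
      - u1 (y (?g k i) \<omega>) * (d (?g k (Suc i)) \<omega> - d (?g k i) \<omega>)
      - u2 (y (?g k i) \<omega>) / 2 * (A (?g k (Suc i)) \<omega> - A (?g k i) \<omega>)))" for k \<omega>
  have lim0: "(\<lambda>k. \<integral>\<omega>. h k \<omega> \<partial>M) \<longlonglongrightarrow> 0"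
    unfolding h_def by (rule I.discrete_ito[OF u u1 u2 w_meas w_bd])
  \<comment> \<open>Discrete product rule: the increment of \<open>w * u\<close> is \<open>w\<close>
    at the left end times the increment of \<open>u\<close>, plus \<open>u\<close> at the right end
    times the increment of \<open>w\<close>. Hence the right endpoint here and the left one in
    \<open>R2\<close> and \<open>R3\<close>.\<close>
  define R1 where "R1 k \<omega> = (\<Sum>i<Suc k. u (y (?g k (Suc i)) \<omega>) * (w (?g k (Suc i)) \<omega> - w (?g k i) \<omega>))" for k \<omega>
  define R2 where "R2 k \<omega> = (\<Sum>i<Suc k. (w (?g k i) \<omega> * u1 (y (?g k i) \<omega>)) * (d (?g k (Suc i)) \<omega> - d (?g k i) \<omega>))" for k \<omega>
  define R3 where "R3 k \<omega> = (\<Sum>i<Suc k. (w (?g k i) \<omega> * (u2 (y (?g k i) \<omega>) / 2)) * (A (?g k (Suc i)) \<omega> - A (?g k i) \<omega>))" for k \<omega>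
  define Z where "Z \<omega> = exp (- r * S \<omega>) * u (Y (S \<omega>) \<omega>) - u x" for \<omega>
  have h_eq: "h k \<omega> = Z \<omega> - R1 k \<omega> - R2 k \<omega> - R3 k \<omega>" if w: "\<omega> \<in> space M" for k \<omega>
  proof -
    have "(\<Sum>i<Suc k. w (?g k (Suc i)) \<omega> * u (y (?g k (Suc i)) \<omega>) - w (?g k i) \<omega> * u (y (?g k i) \<omega>))
      = w (?g k (Suc k)) \<omega> * u (y (?g k (Suc k)) \<omega>) - w (?g k 0) \<omega> * u (y (?g k 0) \<omega>)"
      by (rule sum_lessThan_telescope)
    also have "\<dots> = Z \<omega>" 
      using S_nn[OF w] S_le[OF w] Y0[OF w] by (simp only: I.grid_end I.grid_0) (simp add: Z_def w_def y_def \<theta>_def min_absorb1 min_absorb2)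
    finally have Z: "Z \<omega> = (\<Sum>i<Suc k. w (?g k (Suc i)) \<omega> * u (y (?g k (Suc i)) \<omega>) - w (?g k i) \<omega> * u (y (?g k i) \<omega>))" ..
    show ?thesis unfolding h_def Z R1_def R2_def R3_def sum_subtractf[symmetric]
      by (rule sum.cong) (auto simp: field_simps)
  qed
  define J where "J \<omega> = integral {0..S \<omega>} (\<lambda>s. exp (- r * s) * 
        ((\<sigma> (Y s \<omega>))\<^sup>2 / 2 * u2 (Y s \<omega>) + \<mu> (Y s \<omega>) * u1 (Y s \<omega>) - r * u (Y s \<omega>)))" for \<omega>
  obtain K where K: "0 \<le> K" "\<And>x. x \<in> {a..b} \<Longrightarrow> \<bar>u x\<bar> \<le> K" by (rule compact_interval_bound[OF cu]) blast
  obtain K1 where K1: "0 \<le> K1" "\<And>x. x \<in> {a..b} \<Longrightarrow> \<bar>u1 x\<bar> \<le> K1" by (rule compact_interval_bound[OF cu1]) blast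
  obtain K2 where K2: "0 \<le> K2" "\<And>x. x \<in> {a..b} \<Longrightarrow> \<bar>u2 x\<bar> \<le> K2" by (rule compact_interval_bound[OF u2]) blast
  have yab: "y t \<omega> \<in> {a..b}" if "\<omega> \<in> space M" "0 \<le> t" "t \<le> T" for t \<omega> using I.y_range[OF that] .
  have limR: "(\<lambda>k. R1 k \<omega> + R2 k \<omega> + R3 k \<omega>) \<longlonglongrightarrow> J \<omega>" if w: "\<omega> \<in> space M" for \<omega>
  proof -
    note ST = S_nn[OF w] S_le[OF w] T0
    have \<theta>c: "continuous_on {0..T} (\<lambda>t. \<theta> t \<omega>)" unfolding \<theta>_def by (intro continuous_intros)
    have wc: "continuous_on {0..T} (\<lambda>t. w t \<omega>)" unfolding w_def by (intro continuous_intros \<theta>c)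
    have yc: "continuous_on {0..T} (\<lambda>t. f (y t \<omega>))" if "continuous_on {a..b} f" for f :: "real \<Rightarrow> real"
      unfolding y_def by (rule continuous_on_compose2[OF path[OF w that] \<theta>c]) (rule \<theta>img[OF w])
    have gc: "?g k i \<in> {?g k i..?g k (Suc i)}" "?g k (Suc i) \<in> {?g k i..?g k (Suc i)}" for k i
      using I.grid_mono[of k i] by auto
    note RS = stopped_riemann_sum_tendsto[OF ST _ _ _ I.grid_def]
    have sub: "w t \<omega> = exp (- r * t)" "y t \<omega> = Y t \<omega>" if "t \<in> {0..S \<omega>}" for t
      using that by (auto simp: w_def y_def \<theta>_def min_absorb1)
    have "(\<lambda>k. \<Sum>i<Suc k. u (y (?g k (Suc i)) \<omega>) * (exp (- r * (min (?g k (Suc i)) (S \<omega>))) - exp (- r * (min (?g k i) (S \<omega>))))) \<longlonglongrightarrow> 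
        integral {0..S \<omega>} (\<lambda>s. u (y s \<omega>) * (- r * exp (- r * s)))"
    proof (rule RS[OF yc[OF cu] _ _ gc(2)])
      show "((\<lambda>s. exp (- r * s)) has_real_derivative - r * exp (- r * t)) (at t within {0..S \<omega>})" for t
        by (auto intro!: derivative_eq_intros)
    qed (intro continuous_intros)
    then have L1: "(\<lambda>k. R1 k \<omega>) \<longlonglongrightarrow> integral {0..S \<omega>} (\<lambda>s. u (y s \<omega>) * (- r * exp (- r * s)))"
      by (simp only: R1_def w_def \<theta>_def)
    have "(\<lambda>k. \<Sum>i<Suc k. (w (?g k i) \<omega> * u1 (y (?g k i) \<omega>)) * (d0 (min (?g k (Suc i)) (S \<omega>)) \<omega> - d0 (min (?g k i) (S \<omega>)) \<omega>)) \<longlonglongrightarrow> 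
        integral {0..S \<omega>} (\<lambda>s. (w s \<omega> * u1 (y s \<omega>)) * \<mu> (Y s \<omega>))"
    proof (rule RS[OF continuous_on_mult[OF wc yc[OF cu1]] path[OF w \<mu>] _ gc(1)])
      fix t assume t: "t \<in> {0..S \<omega>}"
      show "((\<lambda>t. d0 t \<omega>) has_real_derivative \<mu> (Y t \<omega>)) (at t within {0..S \<omega>})"
        unfolding has_field_derivative_def
        by (rule has_derivative_transform[OF t _ integral_has_real_derivative[OF path[OF w \<mu>] t, unfolded has_field_derivative_def]]) (use d0_eq[OF w] in auto)
    qed
    then have L2: "(\<lambda>k. R2 k \<omega>) \<longlonglongrightarrow> integral {0..S \<omega>} (\<lambda>s. (w s \<omega> * u1 (y s \<omega>)) * \<mu> (Y s \<omega>))"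
      by (simp only: R2_def d_def \<theta>_def)
    have "(\<lambda>k. \<Sum>i<Suc k. (w (?g k i) \<omega> * (u2 (y (?g k i) \<omega>) / 2)) * (A0 (min (?g k (Suc i)) (S \<omega>)) \<omega> - A0 (min (?g k i) (S \<omega>)) \<omega>)) \<longlonglongrightarrow> 
        integral {0..S \<omega>} (\<lambda>s. (w s \<omega> * (u2 (y s \<omega>) / 2)) * (\<sigma> (Y s \<omega>))\<^sup>2)"
    proof (rule RS[OF continuous_on_mult[OF wc] path[OF w continuous_on_power[OF \<sigma>]] _ gc(1)])
      show "continuous_on {0..T} (\<lambda>t. u2 (y t \<omega>) / 2)" by (rule yc) (use u2 in \<open>intro continuous_intros, auto\<close>)
      fix t assume t: "t \<in> {0..S \<omega>}"
      show "((\<lambda>t. A0 t \<omega>) has_real_derivative (\<sigma> (Y t \<omega>))\<^sup>2) (at t within {0..S \<omega>})"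
        unfolding has_field_derivative_def
        by (rule has_derivative_transform[OF t _ integral_has_real_derivative[OF path[OF w continuous_on_power[OF \<sigma>]] t, unfolded has_field_derivative_def]]) (use A0_eq[OF w] in auto)
    qed
    then have L3: "(\<lambda>k. R3 k \<omega>) \<longlonglongrightarrow> integral {0..S \<omega>} (\<lambda>s. (w s \<omega> * (u2 (y s \<omega>) / 2)) * (\<sigma> (Y s \<omega>))\<^sup>2)"
      by (simp only: R3_def A_def \<theta>_def)
    let ?f1 = "\<lambda>s. u (y s \<omega>) * (- r * exp (- r * s))"
    let ?f2 = "\<lambda>s. (w s \<omega> * u1 (y s \<omega>)) * \<mu> (Y s \<omega>)"
    let ?f3 = "\<lambda>s. (w s \<omega> * (u2 (y s \<omega>) / 2)) * (\<sigma> (Y s \<omega>))\<^sup>2"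
    have S0T: "{0..S \<omega>} \<subseteq> {0..T}" using ST by auto
    note yc' = continuous_on_subset[OF yc S0T] and wc' = continuous_on_subset[OF wc S0T]
    have fi: "?f1 integrable_on {0..S \<omega>}" "?f2 integrable_on {0..S \<omega>}" "?f3 integrable_on {0..S \<omega>}"
      by (intro integrable_continuous_real continuous_intros yc' wc' path[OF w] cu cu1 u2 \<mu> \<sigma>; simp)+
    have "integral {0..S \<omega>} ?f1 + integral {0..S \<omega>} ?f2 + integral {0..S \<omega>} ?f3 = integral {0..S \<omega>} (\<lambda>s. ?f1 s + ?f2 s + ?f3 s)"
      unfolding Henstock_Kurzweil_Integration.integral_add[OF fi(1,2), symmetric]
      by (rule Henstock_Kurzweil_Integration.integral_add[OF integrable_add[OF fi(1,2)] fi(3), symmetric])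
    also have "\<dots> = J \<omega>" unfolding J_def
      by (rule Henstock_Kurzweil_Integration.integral_cong) (simp add: sub algebra_simps)
    finally have "integral {0..S \<omega>} ?f1 + integral {0..S \<omega>} ?f2 + integral {0..S \<omega>} ?f3 = J \<omega>" .
    then show ?thesis using tendsto_add[OF tendsto_add[OF L1 L2] L3] by simp
  qed
  have Zm: "Z \<in> borel_measurable M"
  proof -
    have "(\<lambda>\<omega>. w T \<omega> * u (y T \<omega>) - u x) \<in> borel_measurable M"
    proof (intro borel_measurable_diff borel_measurable_times borel_measurable_const)
      show "w T \<in> borel_measurable M" "(\<lambda>\<omega>. u (y T \<omega>)) \<in> borel_measurable M"
        using measurable_G_M[OF less_imp_le[OF T0]] w_meas[of T] I.continuous_compose_meas[OF cu, of T] T0 by auto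
    qed
    moreover have "w T \<omega> * u (y T \<omega>) - u x = Z \<omega>" if "\<omega> \<in> space M" for \<omega>
      using S_le[OF that] by (simp add: Z_def w_def y_def \<theta>_def min_absorb2)
    ultimately show ?thesis using measurable_cong[of M "\<lambda>\<omega>. w T \<omega> * u (y T \<omega>) - u x" Z] by blast
  qed
  have gm: "(\<lambda>\<omega>. f (y (?g k i) \<omega>)) \<in> borel_measurable M" "w (?g k i) \<in> borel_measurable M" "d (?g k i) \<in> borel_measurable M" 
     "A (?g k i) \<in> borel_measurable M" if "i \<le> Suc k" "continuous_on {a..b} f" for k i and f :: "real \<Rightarrow> real"
    using I.grid_bounds[OF that(1)] I.continuous_compose_meas[OF that(2)] measurable_G_M w_meas I.d_meas I.meas_M(3) by blast+
  have hm: "h k \<in> borel_measurable M" for k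
    unfolding h_def using gm(1)[OF _ cu] gm(1)[OF _ cu1] gm(1)[OF _ u2] gm(2-4)[OF _ cu]
    by (intro borel_measurable_sum borel_measurable_times borel_measurable_diff borel_measurable_divide borel_measurable_const) auto
  \<comment> \<open>The increments of \<open>w\<close>, \<open>d\<close> and \<open>A\<close> are
    Lipschitz in time, so each of the three sums is bounded by a telescoping sum that equals a
    multiple of \<open>T\<close>, whatever the mesh.\<close>
  have S_bd: "\<bar>h k \<omega>\<bar> \<le> 2 * K + (K * r * T + K1 * C * T + K2 / 2 * C * T)" if w: "\<omega> \<in> space M" for k \<omega>
  proof -
    have sums: "\<bar>\<Sum>i<Suc k. f i * e i\<bar> \<le> a * b * T" 
      if "\<And>i. i < Suc k \<Longrightarrow> \<bar>f i\<bar> \<le> a" "\<And>i. i < Suc k \<Longrightarrow> \<bar>e i\<bar> \<le> b * (?g k (Suc i) - ?g k i)" "0 \<le> a" for f e :: "nat \<Rightarrow> real" and a b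
    proof -
      have "\<bar>\<Sum>i<Suc k. f i * e i\<bar> \<le> (\<Sum>i<Suc k. \<bar>f i * e i\<bar>)" by (rule sum_abs)
      also have "\<dots> \<le> (\<Sum>i<Suc k. a * (b * (?g k (Suc i) - ?g k i)))"
        unfolding abs_mult using that by (intro sum_mono mult_mono) auto
      also have "\<dots> = a * b * T"
        unfolding sum_distrib_left[symmetric] sum_lessThan_telescope I.grid_end I.grid_0 by simp
      finally show ?thesis .
    qed
    have gi: "0 \<le> ?g k i" "?g k i \<le> T" "0 \<le> ?g k (Suc i)" "?g k (Suc i) \<le> T" "?g k i \<le> ?g k (Suc i)" if "i < Suc k" for i
      using I.grid_ineqs[OF that] by auto
    have b1: "\<bar>R1 k \<omega>\<bar> \<le> K * r * T" unfolding R1_def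
    proof (rule sums)
      fix i assume i: "i < Suc k"
      show "\<bar>u (y (?g k (Suc i)) \<omega>)\<bar> \<le> K" using K(2)[OF yab[OF w gi(3,4)[OF i]]] .
      show "\<bar>w (?g k (Suc i)) \<omega> - w (?g k i) \<omega>\<bar> \<le> r * (?g k (Suc i) - ?g k i)"
      proof -
        define p q where "p = \<theta> (?g k i) \<omega>" and "q = \<theta> (?g k (Suc i)) \<omega>"
        have pq: "0 \<le> p" "p \<le> q" "q - p \<le> ?g k (Suc i) - ?g k i"
          using \<theta>b[OF w gi(1)[OF i]] \<theta>mono[OF gi(5)[OF i], of \<omega>] by (auto simp: p_def q_def)
        have "exp (- r * q) \<le> exp (- r * p)" using pq r by (simp add: mult_left_mono)
        moreover have "exp (- r * p) - exp (- r * q) \<le> r * (?g k (Suc i) - ?g k i)"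
        proof -
          have "exp (- r * p) - exp (- r * q) = exp (- r * p) * (1 - exp (- (r * (q - p))))"
            by (simp add: algebra_simps exp_add[symmetric])
          also have "\<dots> \<le> 1 * (1 - exp (- (r * (q - p))))" using pq r by (intro mult_right_mono) auto
          also have "\<dots> \<le> r * (q - p)" using exp_ge_add_one_self[of "- (r * (q - p))"] by simp
          also have "\<dots> \<le> r * (?g k (Suc i) - ?g k i)" using pq r by (intro mult_left_mono) auto
          finally show ?thesis .
        qed
        ultimately show ?thesis unfolding w_def p_def[symmetric] q_def[symmetric] by (simp only: abs_minus_commute abs_of_nonpos abs_of_nonneg diff_le_0_iff_le minus_diff_eq)
      qed
    qed (rule K)
    have b2: "\<bar>R2 k \<omega>\<bar> \<le> K1 * C * T" unfolding R2_def
    proof (rule sums)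
      fix i assume i: "i < Suc k"
      show "\<bar>w (?g k i) \<omega> * u1 (y (?g k i) \<omega>)\<bar> \<le> K1" unfolding abs_mult
        using mult_mono[OF w_bd[OF w gi(1)[OF i]] K1(2)[OF yab[OF w gi(1,2)[OF i]]]] by simp
    qed (use I.d_lip[OF w] gi K1 in auto)
    have b3: "\<bar>R3 k \<omega>\<bar> \<le> K2 / 2 * C * T" unfolding R3_def
    proof (rule sums)
      fix i assume i: "i < Suc k"
      show "\<bar>w (?g k i) \<omega> * (u2 (y (?g k i) \<omega>) / 2)\<bar> \<le> K2 / 2" unfolding abs_mult
        using mult_mono[OF w_bd[OF w gi(1)[OF i]], of "\<bar>u2 (y (?g k i) \<omega>) / 2\<bar>" "K2 / 2"] K2(2)[OF yab[OF w gi(1,2)[OF i]]] by simp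
    qed (use I.A_lip[OF w] gi K2 in auto)
    have "\<bar>exp (- r * S \<omega>) * u (Y (S \<omega>) \<omega>)\<bar> \<le> 1 * K"
      unfolding abs_mult using r S_nn[OF w] K range[OF w S_nn[OF w]] by (intro mult_mono) auto
    moreover have "\<bar>u x\<bar> \<le> K" using K(2)[OF range[OF w, of 0]] Y0[OF w] S_nn[OF w] by simp
    ultimately show ?thesis unfolding h_eq[OF w] Z_def using b1 b2 b3 by linarith
  qed
  have lim1: "(\<lambda>k. h k \<omega>) \<longlonglongrightarrow> Z \<omega> - J \<omega>" if "\<omega> \<in> space M" for \<omega>
  proof -
    have "(\<lambda>k. Z \<omega> - (R1 k \<omega> + R2 k \<omega> + R3 k \<omega>)) \<longlonglongrightarrow> Z \<omega> - J \<omega>" by (intro tendsto_diff tendsto_const limR that)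
    then show ?thesis unfolding h_eq[OF that] by (simp add: diff_diff_eq add.assoc)
  qed
  \<comment> \<open>Measurability of \<open>J\<close> is obtained through the pathwise limit, which
    is why \<open>Z - J\<close> is treated before \<open>J\<close>.\<close>
  have ZJm: "(\<lambda>\<omega>. Z \<omega> - J \<omega>) \<in> borel_measurable M"
    by (rule borel_measurable_LIMSEQ_real[OF lim1 hm])
  have "(\<lambda>k. \<integral>\<omega>. h k \<omega> \<partial>M) \<longlonglongrightarrow> (\<integral>\<omega>. Z \<omega> - J \<omega> \<partial>M)"
    by (rule integral_dominated_convergence[where w = "\<lambda>_. 2 * K + (K * r * T + K1 * C * T + K2 / 2 * C * T)"])
       (use ZJm hm lim1 S_bd in \<open>auto intro!: AE_I2\<close>)
  then have ZJ0: "(\<integral>\<omega>. Z \<omega> - J \<omega> \<partial>M) = 0" using LIMSEQ_unique lim0 by blast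
  have Zi: "integrable M Z"
  proof (rule I.integrable_bounded[OF Zm])
    fix \<omega> assume w: "\<omega> \<in> space M"
    have "\<bar>exp (- r * S \<omega>) * u (Y (S \<omega>) \<omega>)\<bar> \<le> 1 * K"
      unfolding abs_mult using r S_nn[OF w] K range[OF w S_nn[OF w]] by (intro mult_mono) auto
    then show "\<bar>Z \<omega>\<bar> \<le> K + \<bar>u x\<bar>" unfolding Z_def by linarith
  qed
  have ZJi: "integrable M (\<lambda>\<omega>. Z \<omega> - J \<omega>)"
  proof (rule I.integrable_bounded[OF ZJm])
    fix \<omega> assume w: "\<omega> \<in> space M"
    show "\<bar>Z \<omega> - J \<omega>\<bar> \<le> 2 * K + (K * r * T + K1 * C * T + K2 / 2 * C * T)"
      by (rule tendsto_upperbound[OF tendsto_rabs[OF lim1[OF w]]]) (use S_bd[OF w] in auto)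
  qed
  have "(\<integral>\<omega>. J \<omega> \<partial>M) = (\<integral>\<omega>. Z \<omega> - (Z \<omega> - J \<omega>) \<partial>M)" by simp
  also have "\<dots> = (\<integral>\<omega>. Z \<omega> \<partial>M)" using ZJ0 Zi ZJi by (subst Bochner_Integration.integral_diff) auto
  also have "\<dots> = (\<integral>\<omega>. exp (- r * S \<omega>) * u (Y (S \<omega>) \<omega>) \<partial>M) - u x"
  proof -
    have "integrable M (\<lambda>\<omega>. Z \<omega> + u x)" using Zi by simp
    then have "integrable M (\<lambda>\<omega>. exp (- r * S \<omega>) * u (Y (S \<omega>) \<omega>))" by (simp add: Z_def)
    then show ?thesis unfolding Z_def by (simp add: prob_space)
  qed
  finally show "(\<integral>\<omega>. exp (- r * S \<omega>) * u (Y (S \<omega>) \<omega>) \<partial>M) = u x + 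
    (\<integral>\<omega>. integral {0..S \<omega>} (\<lambda>s. exp (- r * s) * 
        ((\<sigma> (Y s \<omega>))\<^sup>2 / 2 * u2 (Y s \<omega>) + \<mu> (Y s \<omega>) * u1 (Y s \<omega>) - r * u (Y s \<omega>))) \<partial>M)"
    unfolding J_def by simp
  have "integrable M (\<lambda>\<omega>. Z \<omega> - (Z \<omega> - J \<omega>))" using Zi ZJi by (rule Bochner_Integration.integrable_diff)
  then show "integrable M (\<lambda>\<omega>. integral {0..S \<omega>} (\<lambda>s. exp (- r * s) * 
        ((\<sigma> (Y s \<omega>))\<^sup>2 / 2 * u2 (Y s \<omega>) + \<mu> (Y s \<omega>) * u1 (Y s \<omega>) - r * u (Y s \<omega>))))"
    unfolding J_def by simp
qed

end

section \<open>Exit times from compact subintervals\<close>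

text \<open>A continuous path attains its extremes on \<open>{0..T}\<close>, and these lie strictly
  between the endpoints. This is how unattainability of \<open>lo\<close> and \<open>hi\<close>
  enters the later limits.\<close>

lemma eventually_path_in_compact:
  fixes y :: "real \<Rightarrow> real" and l u :: "nat \<Rightarrow> real" and lo hi :: ereal
  assumes y: "continuous_on {0..} y" "\<And>t. 0 \<le> t \<Longrightarrow> lo < ereal (y t) \<and> ereal (y t) < hi"
    and l: "(\<lambda>n. ereal (l n)) \<longlonglongrightarrow> lo" and u: "(\<lambda>n. ereal (u n)) \<longlonglongrightarrow> hi" and T: "0 \<le> T"
  shows "\<forall>\<^sub>F n in sequentially. \<forall>s\<in>{0..T}. l n < y s \<and> y s < u n"
proof -
  have c: "continuous_on {0..T} y" using y(1) by (rule continuous_on_subset) auto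
  obtain s1 where s1: "s1 \<in> {0..T}" "\<And>s. s \<in> {0..T} \<Longrightarrow> y s1 \<le> y s"
    using continuous_attains_inf[OF compact_Icc _ c] T by auto
  obtain s2 where s2: "s2 \<in> {0..T}" "\<And>s. s \<in> {0..T} \<Longrightarrow> y s \<le> y s2"
    using continuous_attains_sup[OF compact_Icc _ c] T by auto
  have "\<forall>\<^sub>F n in sequentially. ereal (l n) < ereal (y s1)"
    using y(2)[of s1] s1(1) by (intro order_tendstoD(2)[OF l]) auto
  moreover have "\<forall>\<^sub>F n in sequentially. ereal (y s2) < ereal (u n)"
    using y(2)[of s2] s2(1) by (intro order_tendstoD(1)[OF u]) auto
  ultimately show ?thesis
  proof eventually_elim
    case (elim n)
    then show ?case using s1(2) s2(2) by force
  qed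
qed

text \<open>The minimum of \<open>\<tau>\<close>, \<open>T\<close> and the exit time from the open
  interval, packed into one infimum. The point \<open>T\<close> keeps the set nonempty and the value
  real; the clause on \<open>\<tau>\<close> lets the same construction localise an arbitrary
  stopping time.\<close>

definition exit_time :: "(real \<Rightarrow> 'a \<Rightarrow> real) \<Rightarrow> ('a \<Rightarrow> ereal) \<Rightarrow> real \<Rightarrow> real \<Rightarrow> real \<Rightarrow> 'a \<Rightarrow> real" where
  "exit_time Y \<tau> a b T \<omega> = Inf ({t \<in> {0..T}. Y t \<omega> \<notin> {a<..<b} \<or> \<tau> \<omega> \<le> ereal t} \<union> {T})"

lemma exit_time_props:
  fixes Y :: "real \<Rightarrow> 'a \<Rightarrow> real"
  assumes cont: "continuous_on {0..} (\<lambda>t. Y t \<omega>)" and Y0: "Y 0 \<omega> \<in> {a<..<b}" and T: "0 < T" and \<tau>: "0 \<le> \<tau> \<omega>"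
  defines "S \<equiv> exit_time Y \<tau> a b T \<omega>"
  shows "0 \<le> S" "S \<le> T" "ereal S \<le> \<tau> \<omega>"
    "\<And>t. 0 \<le> t \<Longrightarrow> t < S \<Longrightarrow> Y t \<omega> \<in> {a<..<b} \<and> ereal t < \<tau> \<omega>"
    "\<And>t. 0 \<le> t \<Longrightarrow> t \<le> S \<Longrightarrow> Y t \<omega> \<in> {a..b}"
    "S = T \<or> Y S \<omega> \<notin> {a<..<b} \<or> \<tau> \<omega> \<le> ereal S"
proof -
  define E where "E = {t \<in> {0..T}. Y t \<omega> \<notin> {a<..<b} \<or> \<tau> \<omega> \<le> ereal t} \<union> {T}"
  have S: "S = Inf E" by (simp add: S_def exit_time_def E_def)
  have cT: "continuous_on {0..T} (\<lambda>t. Y t \<omega>)" using cont by (rule continuous_on_subset) auto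
  have cl1: "closed {t \<in> {0..T}. Y t \<omega> \<notin> {a<..<b}}"
  proof -
    have "closed ({0..T} \<inter> (\<lambda>t. Y t \<omega>) -` (- {a<..<b}))"
      by (rule continuous_closed_preimage[OF cT]) (auto simp: closed_Compl)
    moreover have "{0..T} \<inter> (\<lambda>t. Y t \<omega>) -` (- {a<..<b}) = {t \<in> {0..T}. Y t \<omega> \<notin> {a<..<b}}" by auto
    ultimately show ?thesis by simp
  qed
  have cl2: "closed {t \<in> {0..T}. \<tau> \<omega> \<le> ereal t}"
  proof (cases "\<tau> \<omega>")
    case (real q)
    then have "{t \<in> {0..T}. \<tau> \<omega> \<le> ereal t} = {0..T} \<inter> {q..}" by auto
    moreover have "closed ({0..T} \<inter> {q..})" by (intro closed_Int closed_atLeast closed_atLeastAtMost)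
    ultimately show ?thesis by simp
  qed (use \<tau> in auto)
  have E_eq: "E = {t \<in> {0..T}. Y t \<omega> \<notin> {a<..<b}} \<union> {t \<in> {0..T}. \<tau> \<omega> \<le> ereal t} \<union> {T}" unfolding E_def by auto
  have clE: "closed E" unfolding E_eq by (intro closed_Un closed_singleton cl1 cl2)
  have bdd: "bdd_below E" unfolding E_def using T by (intro bdd_belowI[of _ 0]) auto
  have ne: "E \<noteq> {}" by (simp add: E_def)
  \<comment> \<open>The set is closed, so the infimum is attained; the final alternative of the
    lemma is just this membership.\<close>
  have SE: "S \<in> E" unfolding S using closed_contains_Inf[OF ne bdd clE] .
  show S0: "0 \<le> S" using SE T by (auto simp: E_def)
  show ST: "S \<le> T" unfolding S by (rule cInf_lower[OF _ bdd]) (simp add: E_def)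
  have lt: "t \<notin> E" if "t < S" for t using that cInf_lower[OF _ bdd, of t] unfolding S by force
  show "ereal S \<le> \<tau> \<omega>"
  proof (cases "\<tau> \<omega> \<le> ereal T")
    case True
    then obtain q where q: "\<tau> \<omega> = ereal q" using \<tau> by (cases "\<tau> \<omega>") auto
    then have "q \<in> E" using True \<tau> unfolding E_def by auto
    then show ?thesis using lt[of q] q by force
  next
    case False
    then have "ereal T \<le> \<tau> \<omega>" by simp
    then show ?thesis using ST by (metis ereal_less_eq(3) order_trans)
  qed
  show ins: "Y t \<omega> \<in> {a<..<b} \<and> ereal t < \<tau> \<omega>" if "0 \<le> t" "t < S" for t
    using lt[OF that(2)] that ST unfolding E_def by auto
  show "S = T \<or> Y S \<omega> \<notin> {a<..<b} \<or> \<tau> \<omega> \<le> ereal S" using SE by (auto simp: E_def)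
  show "Y t \<omega> \<in> {a..b}" if t: "0 \<le> t" "t \<le> S" for t
  proof (cases "t < S")
    case True then show ?thesis using ins[OF t(1) True] by auto
  next
    case False
    then have tS: "t = S" using t by simp
    show ?thesis
    proof (cases "S = 0")
      case True then show ?thesis using tS Y0 by auto
    next
      case False
      then have Sp: "0 < S" using S0 by simp
      \<comment> \<open>At \<open>S\<close> the path may sit on the boundary of the interval.
        Approaching \<open>S\<close> through earlier times, at which it is inside, shows that it is
        not beyond.\<close>
      define s where "s n = S - S / real (Suc n)" for n
      have "(\<lambda>n. S - S / real (Suc n)) \<longlonglongrightarrow> S - 0"
        by (intro tendsto_intros LIMSEQ_Suc[OF lim_const_over_n])
      then have s: "s \<longlonglongrightarrow> S" by (simp add: s_def[abs_def])
      have sb: "0 \<le> s n" "s n < S" for n using Sp by (auto simp: s_def field_simps)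
      have lim: "(\<lambda>n. Y (s n) \<omega>) \<longlonglongrightarrow> Y S \<omega>"
        by (rule continuous_on_tendsto_compose[OF cont s]) (use S0 sb in auto)
      have "Y (s n) \<omega> \<in> {a..b}" for n using ins[OF sb] by (simp add: less_imp_le)
      then show ?thesis unfolding tS using closed_sequentially[OF closed_atLeastAtMost _ lim] by blast
    qed
  qed
qed

context filtered_prob_space
begin

text \<open>Continuity and closedness reduce the uncountable condition to rational times, which
  approximate from below and so remain in \<open>[0, q]\<close>.\<close>

lemma path_in_closed_set_measurable:
  fixes Y :: "real \<Rightarrow> 'a \<Rightarrow> real"
  assumes ad: "adapted_proc M F Y" and cont: "\<And>\<omega>. \<omega> \<in> space M \<Longrightarrow> continuous_on {0..} (\<lambda>t. Y t \<omega>)"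
    and q: "0 \<le> q" and C: "closed C"
  shows "{\<omega>\<in>space M. \<forall>s\<in>{0..q}. Y s \<omega> \<in> C} \<in> sets (G q)"
proof -
  define D where "D = {0..q} \<inter> \<rat>"
  have D: "countable D" unfolding D_def using countable_rat by (rule countable_Int2)
  have "(\<forall>s\<in>{0..q}. Y s \<omega> \<in> C) \<longleftrightarrow> (\<forall>s\<in>D. Y s \<omega> \<in> C)" if w: "\<omega> \<in> space M" for \<omega>
  proof
    assume R: "\<forall>s\<in>D. Y s \<omega> \<in> C"
    show "\<forall>s\<in>{0..q}. Y s \<omega> \<in> C"
    proof
      fix s assume s: "s \<in> {0..q}"
      define f where "f n = of_int \<lfloor>real (Suc n) * s\<rfloor> / real (Suc n)" for n
      have f: "s - 1 / real (Suc n) \<le> f n" "f n \<le> s" "0 \<le> f n" for n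
      proof -
        have "real (Suc n) * s - 1 \<le> of_int \<lfloor>real (Suc n) * s\<rfloor>" by linarith
        then show "s - 1 / real (Suc n) \<le> f n" by (simp add: f_def divide_simps mult.commute)
        have "of_int \<lfloor>real (Suc n) * s\<rfloor> \<le> real (Suc n) * s" by simp
        then show "f n \<le> s" by (simp add: f_def divide_simps mult.commute)
        show "0 \<le> f n" unfolding f_def using s by simp
      qed
      have "(\<lambda>n. s - 1 / real (Suc n)) \<longlonglongrightarrow> s - 0"
        by (intro tendsto_intros LIMSEQ_Suc[OF lim_1_over_n])
      then have lf: "f \<longlonglongrightarrow> s" 
        using tendsto_sandwich[OF always_eventually always_eventually _ tendsto_const, of "\<lambda>n. s - 1 / real (Suc n)" f s] f by simp
      have fD: "f n \<in> D" for n unfolding D_def using f[of n] s by (auto simp: f_def)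
      have "(\<lambda>n. Y (f n) \<omega>) \<longlonglongrightarrow> Y s \<omega>"
        by (rule continuous_on_tendsto_compose[OF cont[OF w] lf]) (use s f in auto)
      then show "Y s \<omega> \<in> C" using closed_sequentially[OF C, of "\<lambda>n. Y (f n) \<omega>"] R fD by blast
    qed
  qed (auto simp: D_def)
  then have "{\<omega>\<in>space M. \<forall>s\<in>{0..q}. Y s \<omega> \<in> C} = {\<omega>\<in>space (G q). \<forall>s\<in>D. Y s \<omega> \<in> C}" by auto
  also have "\<dots> \<in> sets (G q)"
  proof (rule sets.sets_Collect_countable_All'[OF _ D])
    fix s assume s: "s \<in> D"
    have "Y s \<in> borel_measurable (G q)"
      using s adapted_procD[OF ad] measurable_G_mono[of s q] by (auto simp: D_def)
    then show "{\<omega>\<in>space (G q). Y s \<omega> \<in> C} \<in> sets (G q)"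
      using measurable_sets[of "Y s" "G q" borel C] C by (simp add: borel_closed vimage_def Int_def conj_commute)
  qed
  finally show ?thesis .
qed

text \<open>Leaving an open interval is entering a closed set, which is decided at time
  \<open>q\<close> without looking past it. Staying inside up to \<open>q\<close> is a countable
  union of events for closed subintervals, since a path on the compact \<open>[0, q]\<close> keeps a
  positive distance from both levels.\<close>

lemma exit_time_stopping:
  fixes Y :: "real \<Rightarrow> 'a \<Rightarrow> real"
  assumes ad: "adapted_proc M F Y" and cont: "\<And>\<omega>. \<omega> \<in> space M \<Longrightarrow> continuous_on {0..} (\<lambda>t. Y t \<omega>)"
    and Y0: "\<And>\<omega>. \<omega> \<in> space M \<Longrightarrow> Y 0 \<omega> \<in> {a<..<b}"
    and T: "0 < T" and \<tau>: "stopping_time_e M F \<tau>" and q: "0 \<le> q"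
  shows "{\<omega>\<in>space M. exit_time Y \<tau> a b T \<omega> \<le> q} \<in> F q"
proof (cases "q < T")
  case False
  have "exit_time Y \<tau> a b T \<omega> \<le> q" if "\<omega> \<in> space M" for \<omega>
    using exit_time_props(2)[where Y = Y and \<tau> = \<tau> and \<omega> = \<omega>, OF cont[OF that] Y0[OF that] T] \<tau> that False unfolding stopping_time_e_def by fastforce
  then have "{\<omega>\<in>space M. exit_time Y \<tau> a b T \<omega> \<le> q} = space (G q)" by auto
  then show ?thesis using sets_G[OF q] sets.top[of "G q"] by simp
next
  case True
  define In where "In = {\<omega>\<in>space M. \<forall>s\<in>{0..q}. Y s \<omega> \<in> {a<..<b}}"
  have In: "In \<in> sets (G q)"
  proof -
    have "In = (\<Union>n::nat. {\<omega>\<in>space M. \<forall>s\<in>{0..q}. Y s \<omega> \<in> {a + 1 / real (Suc n)..b - 1 / real (Suc n)}})"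
    proof (intro equalityI subsetI)
      fix \<omega> assume "\<omega> \<in> In"
      then have w: "\<omega> \<in> space M" and R: "\<And>s. s \<in> {0..q} \<Longrightarrow> a < Y s \<omega> \<and> Y s \<omega> < b" by (auto simp: In_def)
      have c: "continuous_on {0..q} (\<lambda>t. Y t \<omega>)" using cont[OF w] by (rule continuous_on_subset) auto
      obtain s1 where s1: "s1 \<in> {0..q}" "\<And>s. s \<in> {0..q} \<Longrightarrow> Y s1 \<omega> \<le> Y s \<omega>"
        using continuous_attains_inf[OF compact_Icc _ c] q by auto
      obtain s2 where s2: "s2 \<in> {0..q}" "\<And>s. s \<in> {0..q} \<Longrightarrow> Y s \<omega> \<le> Y s2 \<omega>"
        using continuous_attains_sup[OF compact_Icc _ c] q by auto
      have "0 < min (Y s1 \<omega> - a) (b - Y s2 \<omega>)" using R[OF s1(1)] R[OF s2(1)] by simp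
      then obtain n where n: "1 / real (Suc n) < min (Y s1 \<omega> - a) (b - Y s2 \<omega>)"
        using nat_approx_posE by blast
      have "Y s \<omega> \<in> {a + 1 / real (Suc n)..b - 1 / real (Suc n)}" if "s \<in> {0..q}" for s
        using s1(2)[OF that] s2(2)[OF that] n by auto
      then show "\<omega> \<in> (\<Union>n::nat. {\<omega>\<in>space M. \<forall>s\<in>{0..q}. Y s \<omega> \<in> {a + 1 / real (Suc n)..b - 1 / real (Suc n)}})"
        using w by blast
    next
      fix \<omega> assume "\<omega> \<in> (\<Union>n::nat. {\<omega>\<in>space M. \<forall>s\<in>{0..q}. Y s \<omega> \<in> {a + 1 / real (Suc n)..b - 1 / real (Suc n)}})"
      then obtain n :: nat where w: "\<omega> \<in> space M" and R: "\<And>s. s \<in> {0..q} \<Longrightarrow> Y s \<omega> \<in> {a + 1 / real (Suc n)..b - 1 / real (Suc n)}"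
        by blast
      have "0 < 1 / real (Suc n)" by simp
      then have "Y s \<omega> \<in> {a<..<b}" if "s \<in> {0..q}" for s
        using R[OF that] unfolding atLeastAtMost_iff greaterThanLessThan_iff by linarith
      then show "\<omega> \<in> In" using w by (simp add: In_def)
    qed
    also have "\<dots> \<in> sets (G q)"
      by (intro sets.countable_nat_UN image_subsetI path_in_closed_set_measurable[OF ad cont q] closed_atLeastAtMost)
    finally show ?thesis .
  qed
  have \<tau>q: "{\<omega>\<in>space M. \<tau> \<omega> \<le> ereal q} \<in> sets (G q)"
    using \<tau> q sets_G unfolding stopping_time_e_def by auto
  have "exit_time Y \<tau> a b T \<omega> \<le> q \<longleftrightarrow> \<tau> \<omega> \<le> ereal q \<or> \<omega> \<notin> In" if w: "\<omega> \<in> space M" for \<omega>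
  proof -
    have \<tau>0: "0 \<le> \<tau> \<omega>" using \<tau> w unfolding stopping_time_e_def by blast
    note P = exit_time_props[where Y = Y and \<tau> = \<tau> and \<omega> = \<omega>, OF cont[OF w] Y0[OF w] T \<tau>0]
    show ?thesis
    proof
      assume le: "exit_time Y \<tau> a b T \<omega> \<le> q"
      show "\<tau> \<omega> \<le> ereal q \<or> \<omega> \<notin> In"
      proof (rule ccontr)
        assume "\<not> (\<tau> \<omega> \<le> ereal q \<or> \<omega> \<notin> In)"
        then have 1: "ereal q < \<tau> \<omega>" and 2: "\<And>s. s \<in> {0..q} \<Longrightarrow> Y s \<omega> \<in> {a<..<b}" by (auto simp: In_def)
        have "Y (exit_time Y \<tau> a b T \<omega>) \<omega> \<in> {a<..<b}" using 2 P(1) le by simp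
        then have "\<tau> \<omega> \<le> ereal (exit_time Y \<tau> a b T \<omega>)" using P(6) True le by auto
        then show False using 1 le by (meson ereal_less_eq(3) leD order_trans)
      qed
    next
      assume R: "\<tau> \<omega> \<le> ereal q \<or> \<omega> \<notin> In"
      show "exit_time Y \<tau> a b T \<omega> \<le> q"
      proof (rule ccontr)
        assume "\<not> exit_time Y \<tau> a b T \<omega> \<le> q"
        then have "Y s \<omega> \<in> {a<..<b} \<and> ereal s < \<tau> \<omega>" if "s \<in> {0..q}" for s using P(4)[of s] that by auto
        then show False using R w q unfolding In_def by force
      qed
    qed
  qed
  then have "{\<omega>\<in>space M. exit_time Y \<tau> a b T \<omega> \<le> q} = {\<omega>\<in>space M. \<tau> \<omega> \<le> ereal q} \<union> (space (G q) - In)" by auto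
  also have "\<dots> \<in> sets (G q)" using In \<tau>q by (intro sets.Un sets.Diff sets.top) auto
  finally show ?thesis using sets_G[OF q] by simp
qed

end

section \<open>Scale, speed and the inhomogeneous equation\<close>

locale diffusion =
  fixes lo hi :: ereal and \<mu> \<sigma> \<psi> \<psi>1 \<psi>2 :: "real \<Rightarrow> real" and r x0 :: real
  assumes \<mu>_cont: "continuous_on (einterval lo hi) \<mu>"
    and \<sigma>_cont: "continuous_on (einterval lo hi) \<sigma>"
    and \<sigma>_pos: "x \<in> einterval lo hi \<Longrightarrow> 0 < \<sigma> x"
    and r_pos: "0 < r"
    and \<psi>_pos: "x \<in> einterval lo hi \<Longrightarrow> 0 < \<psi> x"
    and \<psi>_mono: "strict_mono_on (einterval lo hi) \<psi>"
    and \<psi>_deriv: "x \<in> einterval lo hi \<Longrightarrow> (\<psi> has_real_derivative \<psi>1 x) (at x)"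
    and \<psi>1_deriv: "x \<in> einterval lo hi \<Longrightarrow> (\<psi>1 has_real_derivative \<psi>2 x) (at x)"
    and \<psi>_ode: "x \<in> einterval lo hi \<Longrightarrow> (\<sigma> x)\<^sup>2 / 2 * \<psi>2 x + \<mu> x * \<psi>1 x = r * \<psi> x"
    and x0: "x0 \<in> einterval lo hi"
begin

abbreviation I where "I \<equiv> einterval lo hi"
abbreviation sc where "sc \<equiv> scale_dens \<mu> \<sigma> x0"
abbreviation sp where "sp \<equiv> speed_dens \<mu> \<sigma> x0"

lemma open_I: "open I" by simp

lemma I_convex: assumes "x \<in> I" "y \<in> I" "x \<le> z" "z \<le> y" shows "z \<in> I"
proof -
  have "lo < ereal x" "ereal y < hi" using assms by (auto simp: einterval_def)
  moreover have "ereal x \<le> ereal z" "ereal z \<le> ereal y" using assms by auto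
  ultimately show ?thesis unfolding einterval_def mem_Collect_eq
    using order.strict_trans2 order.strict_trans1 by blast
qed

lemma I_Icc: "x \<in> I \<Longrightarrow> y \<in> I \<Longrightarrow> {x..y} \<subseteq> I"
proof
  fix z assume "x \<in> I" "y \<in> I" "z \<in> {x..y}"
  then show "z \<in> I" using I_convex[of x y z] by simp
qed

lemma \<sigma>_nz: "x \<in> I \<Longrightarrow> \<sigma> x \<noteq> 0"
  using \<sigma>_pos[of x] by simp

lemma I_less: assumes "x \<in> I" obtains z where "z \<in> I" "z < x"
proof -
  obtain e where "0 < e" "ball x e \<subseteq> I" using assms open_I open_contains_ball by metis
  then show thesis by (intro that[of "x - e / 2"]) (auto simp: subset_iff dist_real_def)
qed

lemma I_greater: assumes "x \<in> I" obtains z where "z \<in> I" "x < z"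
proof -
  obtain e where "0 < e" "ball x e \<subseteq> I" using assms open_I open_contains_ball by metis
  then show thesis by (intro that[of "x + e / 2"]) (auto simp: subset_iff dist_real_def)
qed

lemma I_min_max: "x \<in> I \<Longrightarrow> y \<in> I \<Longrightarrow> min x y \<in> I \<and> max x y \<in> I"
  by (auto simp: min_def max_def)

lemma interval_integral_deriv:
  assumes f: "continuous_on I f" and c: "c \<in> I" and x: "x \<in> I"
  shows "((\<lambda>u. LBINT y=ereal c..ereal u. f y) has_real_derivative f x) (at x)"
proof -
  have "min c x \<in> I" "max c x \<in> I" using I_min_max[OF c x] by auto
  then obtain a b where a: "a \<in> I" "a < min c x" and b: "b \<in> I" "max c x < b"
    using I_less I_greater by metis
  have "((\<lambda>u. LBINT y=ereal c..ereal u. f y) has_vector_derivative f x) (at x within {a..b})"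
    by (rule interval_integral_FTC2) (use a b continuous_on_subset[OF f I_Icc[OF a(1) b(1)]] in auto)
  then have *: "((\<lambda>u. LBINT y=ereal c..ereal u. f y) has_real_derivative f x) (at x within {a..b})"
    unfolding has_real_derivative_iff_has_vector_derivative .
  have "x \<in> interior {a..b}" using a b by auto
  from *[unfolded at_within_interior[OF this]] show ?thesis .
qed

lemma sc_pos: "0 < sc x"
  by (simp add: scale_dens_def)

lemma sc_deriv: 
  assumes "x \<in> I" shows "(sc has_real_derivative - (2 * \<mu> x / (\<sigma> x)\<^sup>2) * sc x) (at x)"
proof -
  have "continuous_on I (\<lambda>u. 2 * \<mu> u / (\<sigma> u)\<^sup>2)"
    by (intro continuous_intros \<mu>_cont \<sigma>_cont) (simp add: \<sigma>_nz)
  from interval_integral_deriv[OF this x0 assms] show ?thesis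
    unfolding scale_dens_def[abs_def] by (auto intro!: derivative_eq_intros)
qed

lemma sp_eq: "sp x = 2 / ((\<sigma> x)\<^sup>2 * sc x)"
  by (simp add: speed_dens_def)

lemma sp_pos: "x \<in> I \<Longrightarrow> 0 < sp x"
  using \<sigma>_pos[of x] sc_pos[of x] by (simp add: sp_eq)

lemma sc_cont: "continuous_on I sc"
  by (rule DERIV_continuous_on[OF has_field_derivative_at_within[OF sc_deriv]])

lemma sp_cont: "continuous_on I sp"
proof -
  have "(\<sigma> x)\<^sup>2 * sc x \<noteq> 0" if "x \<in> I" for x using \<sigma>_pos[OF that] sc_pos[of x] by simp
  then show ?thesis unfolding sp_eq[abs_def]
    by (intro continuous_on_divide continuous_on_mult continuous_on_power continuous_on_const \<sigma>_cont sc_cont ballI)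
qed

lemma \<psi>_cont: "continuous_on I \<psi>"
  by (rule DERIV_continuous_on[OF has_field_derivative_at_within[OF \<psi>_deriv]])

lemma \<psi>1_cont: "continuous_on I \<psi>1"
  by (rule DERIV_continuous_on[OF has_field_derivative_at_within[OF \<psi>1_deriv]])

lemma \<psi>2_eq: "x \<in> I \<Longrightarrow> \<psi>2 x = 2 * (r * \<psi> x - \<mu> x * \<psi>1 x) / (\<sigma> x)\<^sup>2"
proof -
  assume x: "x \<in> I"
  have "(\<sigma> x)\<^sup>2 * \<psi>2 x = 2 * (r * \<psi> x - \<mu> x * \<psi>1 x)" using \<psi>_ode[OF x] by simp
  then show ?thesis using \<sigma>_pos[OF x] by (simp add: eq_divide_eq mult.commute)
qed

text \<open>Differentiability gives only the existence of \<open>\<psi>2\<close>; its continuity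
  comes from solving the differential equation for it.\<close>

lemma \<psi>2_cont: "continuous_on I \<psi>2"
proof -
  have "continuous_on I (\<lambda>x. 2 * (r * \<psi> x - \<mu> x * \<psi>1 x) / (\<sigma> x)\<^sup>2)"
    by (intro continuous_intros \<psi>_cont \<psi>1_cont \<mu>_cont \<sigma>_cont) (simp add: \<sigma>_nz)
  then show ?thesis using \<psi>2_eq by (simp cong: continuous_on_cong)
qed

lemma \<psi>_le: "x \<in> I \<Longrightarrow> y \<in> I \<Longrightarrow> x \<le> y \<Longrightarrow> \<psi> x \<le> \<psi> y"
  using strict_mono_onD[OF \<psi>_mono, of x y] by (cases "x = y") auto

lemma \<psi>1_nonneg: assumes "x \<in> I" shows "0 \<le> \<psi>1 x"
proof -
  have "mono_on I \<psi>" using \<psi>_le by (auto intro!: mono_onI)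
  then show ?thesis using mono_on_imp_deriv_nonneg[OF _ \<psi>_deriv[OF assms]] assms by (simp add: interior_open)
qed

text \<open>\<open>p\<close> is the derivative of \<open>\<psi>\<close> with respect to the scale; \<open>H g z\<close> below is the integral of \<open>g \<psi>\<close>
  against the speed measure over \<open>(lo, z)\<close>.\<close>
definition p where "p x = \<psi>1 x / sc x"

text \<open>Feller's form of the equation: \<open>sc\<close> is the integrating factor of the
  first-order term, so differentiating \<open>\<psi>\<close> first by scale and then by speed gives
  \<open>r * \<psi>\<close>.\<close>

lemma p_deriv: assumes "x \<in> I" shows "(p has_real_derivative r * \<psi> x * sp x) (at x)"
proof -
  have s: "\<sigma> x \<noteq> 0" "sc x \<noteq> 0" using \<sigma>_pos[OF assms] sc_pos[of x] by auto
  have "(p has_real_derivative (\<psi>2 x * sc x - \<psi>1 x * (- (2 * \<mu> x / (\<sigma> x)\<^sup>2) * sc x)) / (sc x * sc x)) (at x)"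
    unfolding p_def[abs_def] by (rule DERIV_divide[OF \<psi>1_deriv[OF assms] sc_deriv[OF assms] s(2)])
  moreover have "(\<psi>2 x * sc x - \<psi>1 x * (- (2 * \<mu> x / (\<sigma> x)\<^sup>2) * sc x)) / (sc x * sc x) = r * \<psi> x * sp x"
    unfolding sp_eq \<psi>2_eq[OF assms] using s by (simp add: field_simps)
  ultimately show ?thesis by simp
qed

lemma p_strict_mono: assumes "x \<in> I" "y \<in> I" "x < y" shows "p x < p y"
proof (rule DERIV_pos_imp_increasing[OF assms(3)])
  fix z assume "x \<le> z" "z \<le> y"
  then have z: "z \<in> I" using I_convex assms by blast
  show "\<exists>y. (p has_real_derivative y) (at z) \<and> 0 < y"
    using p_deriv[OF z] mult_pos_pos[OF mult_pos_pos[OF r_pos \<psi>_pos[OF z]] sp_pos[OF z]] by blast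
qed

lemma p_mono: "x \<in> I \<Longrightarrow> y \<in> I \<Longrightarrow> x \<le> y \<Longrightarrow> p x \<le> p y"
  using p_strict_mono[of x y] by (cases "x = y") auto

text \<open>\<open>\<psi>1\<close> is only known to be nonnegative; strictness is borrowed from the
  strict growth of \<open>p\<close> from a smaller point.\<close>

lemma p_pos: assumes "x \<in> I" shows "0 < p x"
proof -
  obtain z where "z \<in> I" "z < x" by (rule I_less[OF assms])
  moreover have "0 \<le> p z" unfolding p_def by (intro divide_nonneg_pos \<psi>1_nonneg sc_pos \<open>z \<in> I\<close>)
  ultimately show ?thesis using p_strict_mono[of z x] assms by linarith
qed

lemma p_cont: "continuous_on I p"
  by (rule DERIV_continuous_on[OF has_field_derivative_at_within[OF p_deriv]])

text \<open>The limit of the increasing function \<open>p\<close> at \<open>lo\<close>. As an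
  infimum it needs no distinction between finite and infinite ends.\<close>

definition p_inf where "p_inf = Inf (p ` I)"

lemma p_inf_le: "x \<in> I \<Longrightarrow> p_inf \<le> p x"
  unfolding p_inf_def
proof (rule cInf_lower)
  show "bdd_below (p ` I)"
  proof (rule bdd_belowI[of _ 0])
    fix v assume "v \<in> p ` I"
    then obtain x where "x \<in> I" "v = p x" by blast
    then show "0 \<le> v" using p_pos[of x] by simp
  qed
qed (rule imageI)

lemma p_inf_nonneg: "0 \<le> p_inf"
  unfolding p_inf_def
proof (rule cInf_greatest)
  show "p ` I \<noteq> {}" using x0 by blast
  fix v assume "v \<in> p ` I"
  then obtain x where "x \<in> I" "v = p x" by blast
  then show "0 \<le> v" using p_pos[of x] by simp
qed

lemma p_inf_approx: assumes "p_inf < c" obtains x where "x \<in> I" "p x < c"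
proof -
  have "\<exists>v\<in>p ` I. v < c" using assms unfolding p_inf_def by (rule cInf_lessD[rotated]) (use x0 in blast)
  then show ?thesis using that by auto
qed

text \<open>Variation of constants: \<open>\<psi> K\<close> with \<open>K' = - s' \<Gamma> / \<psi>\<^sup>2\<close> solves the inhomogeneous
  equation \<open>(\<G> - r) u = - g\<close> as soon as \<open>\<Gamma>' = g \<psi> m'\<close>.\<close>
lemma inhomogeneous_solution:
  assumes \<Gamma>: "\<And>x. x \<in> I \<Longrightarrow> (\<Gamma> has_real_derivative g x * \<psi> x * sp x) (at x)"
    and g: "continuous_on I g" and z: "z \<in> I"
  obtains K u1 u2 where
    "\<And>x. x \<in> I \<Longrightarrow> (K has_real_derivative - (sc x * \<Gamma> x / (\<psi> x)\<^sup>2)) (at x)" "K z = 0"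
    "\<And>x. x \<in> I \<Longrightarrow> ((\<lambda>x. \<psi> x * K x) has_real_derivative u1 x) (at x)"
    "\<And>x. x \<in> I \<Longrightarrow> (u1 has_real_derivative u2 x) (at x)"
    "continuous_on I u2"
    "\<And>x. x \<in> I \<Longrightarrow> (\<sigma> x)\<^sup>2 / 2 * u2 x + \<mu> x * u1 x - r * (\<psi> x * K x) = - g x"
proof -
  have \<Gamma>_cont: "continuous_on I \<Gamma>"
    by (rule DERIV_continuous_on[OF has_field_derivative_at_within[OF \<Gamma>]])
  have "\<psi> x \<noteq> 0" if "x \<in> I" for x using \<psi>_pos[OF that] by simp
  then have fc: "continuous_on I (\<lambda>x. sc x * \<Gamma> x / (\<psi> x)\<^sup>2)"
    by (intro continuous_intros sc_cont \<Gamma>_cont \<psi>_cont) auto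
  define K where "K x = - (LBINT y=ereal z..ereal x. sc y * \<Gamma> y / (\<psi> y)\<^sup>2)" for x
  have K: "(K has_real_derivative - (sc x * \<Gamma> x / (\<psi> x)\<^sup>2)) (at x)" if "x \<in> I" for x
    unfolding K_def[abs_def] using interval_integral_deriv[OF fc z that] by (rule DERIV_minus)
  have K_cont: "continuous_on I K"
    by (rule DERIV_continuous_on[OF has_field_derivative_at_within[OF K]])
  \<comment> \<open>In the derivative of \<open>u1\<close> the two terms with
    \<open>\<psi>1 * \<Gamma>\<close> cancel, and \<open>sc * sp = 2 / \<sigma>^2\<close> turns the
    derivative of \<open>\<Gamma>\<close> into the last term of \<open>u2\<close>.\<close>
  define u1 where "u1 x = \<psi>1 x * K x - sc x * \<Gamma> x / \<psi> x" for x
  define u2 where "u2 x = \<psi>2 x * K x + 2 * \<mu> x / (\<sigma> x)\<^sup>2 * sc x * \<Gamma> x / \<psi> x - 2 * g x / (\<sigma> x)\<^sup>2" for x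
  have d1: "((\<lambda>x. \<psi> x * K x) has_real_derivative u1 x) (at x)" if x: "x \<in> I" for x
  proof -
    have "((\<lambda>x. \<psi> x * K x) has_real_derivative \<psi>1 x * K x + (- (sc x * \<Gamma> x / (\<psi> x)\<^sup>2)) * \<psi> x) (at x)"
      by (rule DERIV_mult[OF \<psi>_deriv[OF x] K[OF x]])
    moreover have "\<psi>1 x * K x + (- (sc x * \<Gamma> x / (\<psi> x)\<^sup>2)) * \<psi> x = u1 x"
      using \<psi>_pos[OF x] by (simp add: u1_def power2_eq_square field_simps)
    ultimately show ?thesis by simp
  qed
  have d2: "(u1 has_real_derivative u2 x) (at x)" if x: "x \<in> I" for x
  proof -
    have nz: "\<psi> x \<noteq> 0" "\<sigma> x \<noteq> 0" "sc x \<noteq> 0" using \<psi>_pos[OF x] \<sigma>_pos[OF x] sc_pos[of x] by auto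
    have "((\<lambda>x. \<psi>1 x * K x - sc x * \<Gamma> x / \<psi> x) has_real_derivative 
      (\<psi>2 x * K x + (- (sc x * \<Gamma> x / (\<psi> x)\<^sup>2)) * \<psi>1 x) - 
      ((- (2 * \<mu> x / (\<sigma> x)\<^sup>2) * sc x * \<Gamma> x + g x * \<psi> x * sp x * sc x) * \<psi> x - sc x * \<Gamma> x * \<psi>1 x) / (\<psi> x * \<psi> x)) (at x)"
      by (intro DERIV_diff DERIV_mult \<psi>1_deriv K DERIV_divide sc_deriv \<Gamma> \<psi>_deriv x nz)
    moreover have "(\<psi>2 x * K x + (- (sc x * \<Gamma> x / (\<psi> x)\<^sup>2)) * \<psi>1 x) - 
      ((- (2 * \<mu> x / (\<sigma> x)\<^sup>2) * sc x * \<Gamma> x + g x * \<psi> x * sp x * sc x) * \<psi> x - sc x * \<Gamma> x * \<psi>1 x) / (\<psi> x * \<psi> x) = u2 x"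
      unfolding u2_def sp_eq using nz by (simp add: power2_eq_square field_simps)
    ultimately show ?thesis unfolding u1_def[abs_def] by simp
  qed
  show thesis
  proof (rule that[OF K _ d1 d2])
    show "K z = 0" by (simp add: K_def)
    have "\<psi> x \<noteq> 0" "(\<sigma> x)\<^sup>2 \<noteq> 0" if "x \<in> I" for x using \<psi>_pos[OF that] \<sigma>_pos[OF that] by auto
    then show "continuous_on I u2" unfolding u2_def[abs_def]
      by (intro continuous_intros \<psi>2_cont K_cont \<mu>_cont \<sigma>_cont sc_cont \<Gamma>_cont \<psi>_cont g) auto
    fix x assume x: "x \<in> I"
    have nz: "\<psi> x \<noteq> 0" "\<sigma> x \<noteq> 0" using \<psi>_pos[OF x] \<sigma>_pos[OF x] by auto
    have "(\<sigma> x)\<^sup>2 / 2 * u2 x + \<mu> x * u1 x - r * (\<psi> x * K x) = 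
       ((\<sigma> x)\<^sup>2 / 2 * \<psi>2 x + \<mu> x * \<psi>1 x - r * \<psi> x) * K x - g x"
      unfolding u2_def u1_def using nz by (simp add: power2_eq_square field_simps)
    then show "(\<sigma> x)\<^sup>2 / 2 * u2 x + \<mu> x * u1 x - r * (\<psi> x * K x) = - g x"
      using \<psi>_ode[OF x] by simp
  qed
qed

text \<open>As \<open>sc * p = \<psi>1\<close>, the bound on \<open>\<Gamma>\<close> makes the slope
  of \<open>K\<close> at most that of \<open>c / \<psi>\<close> in absolute value. So
  \<open>c / \<psi> - K\<close> and \<open>c / \<psi> + K\<close> both decrease, and
  \<open>K z = 0\<close> gives \<open>\<bar>K q\<bar> \<le> c / \<psi> q\<close>. Uniformity down to
  \<open>lo\<close> is what allows the lower exit level to be sent there.\<close>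

lemma solution_bounded:
  assumes K: "\<And>x. x \<in> I \<Longrightarrow> (K has_real_derivative - (sc x * \<Gamma> x / (\<psi> x)\<^sup>2)) (at x)" and z: "K z = 0" "z \<in> I"
    and c: "0 \<le> c" "\<And>x. x \<in> I \<Longrightarrow> x \<le> z \<Longrightarrow> \<bar>\<Gamma> x\<bar> \<le> c * p x" and q: "q \<in> I" "q \<le> z"
  shows "\<bar>\<psi> q * K q\<bar> \<le> c"
proof -
  have inv: "((\<lambda>x. c / \<psi> x) has_real_derivative - (c * \<psi>1 x / (\<psi> x)\<^sup>2)) (at x)" if "x \<in> I" for x
    using DERIV_divide[OF DERIV_const[of c] \<psi>_deriv[OF that]] \<psi>_pos[OF that] by (simp add: power2_eq_square)
  have bd: "\<bar>sc x * \<Gamma> x / (\<psi> x)\<^sup>2\<bar> \<le> c * \<psi>1 x / (\<psi> x)\<^sup>2" if "x \<in> I" "x \<le> z" for x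
  proof -
    have "sc x * \<bar>\<Gamma> x\<bar> \<le> sc x * (c * p x)" using c(2)[OF that] sc_pos[of x] by (intro mult_left_mono) auto
    also have "\<dots> = c * \<psi>1 x" using sc_pos[of x] by (simp add: p_def)
    finally have "sc x * \<bar>\<Gamma> x\<bar> / (\<psi> x)\<^sup>2 \<le> c * \<psi>1 x / (\<psi> x)\<^sup>2" by (intro divide_right_mono) auto
    then show ?thesis using sc_pos[of x] by (simp add: abs_mult)
  qed
  have in_I: "x \<in> I" if "q \<le> x" "x \<le> z" for x using I_convex that q z by blast
  have "c / \<psi> z - K z \<le> c / \<psi> q - K q"
  proof (rule DERIV_nonpos_imp_nonincreasing[OF q(2)])
    fix x assume x: "q \<le> x" "x \<le> z"
    show "\<exists>y. ((\<lambda>x. c / \<psi> x - K x) has_real_derivative y) (at x) \<and> y \<le> 0"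
      by (intro exI conjI, rule DERIV_diff[OF inv[OF in_I[OF x]] K[OF in_I[OF x]]])
         (use abs_le_D1[OF bd[OF in_I[OF x] x(2)]] abs_le_D2[OF bd[OF in_I[OF x] x(2)]] in linarith)
  qed
  moreover have "c / \<psi> z + K z \<le> c / \<psi> q + K q"
  proof (rule DERIV_nonpos_imp_nonincreasing[OF q(2)])
    fix x assume x: "q \<le> x" "x \<le> z"
    show "\<exists>y. ((\<lambda>x. c / \<psi> x + K x) has_real_derivative y) (at x) \<and> y \<le> 0"
      by (intro exI conjI, rule DERIV_add[OF inv[OF in_I[OF x]] K[OF in_I[OF x]]])
         (use abs_le_D1[OF bd[OF in_I[OF x] x(2)]] abs_le_D2[OF bd[OF in_I[OF x] x(2)]] in linarith)
  qed
  moreover have "0 \<le> c / \<psi> z" using c \<psi>_pos[OF z(2)] by simp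
  ultimately have "\<bar>K q\<bar> \<le> c / \<psi> q" using z by (simp add: abs_le_iff)
  then have "\<psi> q * \<bar>K q\<bar> \<le> \<psi> q * (c / \<psi> q)" using \<psi>_pos[OF q(1)] by (intro mult_left_mono) auto
  then show ?thesis using \<psi>_pos[OF q(1)] by (simp add: abs_mult)
qed

section \<open>Integrals against the weight \<open>\<psi> dm\<close> from the lower end\<close>

definition H :: "(real \<Rightarrow> real) \<Rightarrow> real \<Rightarrow> real" where
  "H g z = (LINT x:einterval lo (ereal z)|lborel. g x * (\<psi> x * sp x))"

lemma sub_I: assumes "z \<in> I" shows "einterval lo (ereal z) \<subseteq> I"
proof
  fix x assume x: "x \<in> einterval lo (ereal z)"
  have "ereal z < hi" using assms by (simp add: einterval_def)
  moreover have "ereal x < ereal z" "lo < ereal x" using x by (auto simp: einterval_def)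
  ultimately show "x \<in> I" unfolding einterval_def mem_Collect_eq by (metis order.strict_trans)
qed

lemma p_tendsto_lo: "((p \<circ> real_of_ereal) \<longlongrightarrow> p_inf) (at_right lo)"
proof (rule order_tendstoI)
  have ev: "\<forall>\<^sub>F t in at_right lo. real_of_ereal t \<in> I \<and> real_of_ereal t < w" if "w \<in> I" for w
  proof -
    have lw: "lo < ereal w" using that by (simp add: einterval_def)
    have "real_of_ereal t \<in> I \<and> real_of_ereal t < w" if t: "lo < t" "t < ereal w" for t
    proof -
      obtain t' where t': "t = ereal t'" using t by (cases t) auto
      then have "t' \<in> einterval lo (ereal w)" using t by (simp add: einterval_def)
      then show ?thesis using sub_I[OF \<open>w \<in> I\<close>] t t' by auto
    qed
    then show ?thesis unfolding eventually_at_right[OF lw] using lw by blast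
  qed
  fix c
  {
    assume "c < p_inf"
    show "\<forall>\<^sub>F t in at_right lo. c < (p \<circ> real_of_ereal) t"
      using ev[OF x0] by eventually_elim (use p_inf_le \<open>c < p_inf\<close> in \<open>auto intro: less_le_trans\<close>)
  next
    assume "p_inf < c"
    then obtain w where w: "w \<in> I" "p w < c" by (rule p_inf_approx)
    show "\<forall>\<^sub>F t in at_right lo. (p \<circ> real_of_ereal) t < c"
      using ev[OF w(1)]
    proof eventually_elim
      case (elim t)
      then show ?case using p_mono[of "real_of_ereal t" w] w by auto
    qed
  }
qed

text \<open>\<open>r\<close> times the weight is the nonnegative derivative of \<open>p\<close>, so
  the fundamental theorem on the interval open at \<open>lo\<close> gives integrability and the
  value at once.\<close>

lemma weight_integrable:
  assumes z: "z \<in> I"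
  shows "set_integrable lborel (einterval lo (ereal z)) (\<lambda>x. \<psi> x * sp x)" 
    and "H (\<lambda>_. r) z = p z - p_inf"
proof -
  have lz: "lo < ereal z" using z by (simp add: einterval_def)
  have inI: "x \<in> I" if "lo < ereal x" "ereal x < ereal z" for x using sub_I[OF z] that by (auto simp: einterval_def)
  have cont: "isCont (\<lambda>x. r * \<psi> x * sp x) x" if "x \<in> I" for x
  proof -
    have "continuous_on I (\<lambda>x. r * \<psi> x * sp x)" by (intro continuous_intros \<psi>_cont sp_cont)
    then show ?thesis using that open_I continuous_on_eq_continuous_at by blast
  qed
  have nn: "AE x in lborel. lo < ereal x \<longrightarrow> ereal x < ereal z \<longrightarrow> 0 \<le> r * \<psi> x * sp x"
    using inI \<psi>_pos sp_pos r_pos by (auto intro!: AE_I2 mult_nonneg_nonneg less_imp_le)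
  have "isCont p z" using p_cont z open_I continuous_on_eq_continuous_at by blast
  then have lim: "((p \<circ> real_of_ereal) \<longlongrightarrow> p z) (at_left (ereal z))"
    unfolding ereal_tendsto_simps by (simp add: isCont_def filterlim_at_split)
  have F: "set_integrable lborel (einterval lo (ereal z)) (\<lambda>x. r * \<psi> x * sp x)"
    "(LBINT x=lo..ereal z. r * \<psi> x * sp x) = p z - p_inf"
    by (rule interval_integral_FTC_nonneg[OF lz p_deriv[OF inI] cont[OF inI] nn p_tendsto_lo lim]; assumption)+
  then have "set_integrable lborel (einterval lo (ereal z)) (\<lambda>x. (1 / r) * (r * \<psi> x * sp x))" 
    by (intro set_integrable_mult_right)
  then show "set_integrable lborel (einterval lo (ereal z)) (\<lambda>x. \<psi> x * sp x)" using r_pos by simp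
  show "H (\<lambda>_. r) z = p z - p_inf" 
    using F(2) lz unfolding H_def by (simp only: interval_lebesgue_integral_le_eq less_imp_le mult.assoc)
qed

text \<open>Boundedness to the left of each point makes \<open>g\<close> integrable against the
  weight near \<open>lo\<close>. Constants and differences qualify, and so do nonnegative
  nondecreasing functions such as \<open>pic\<close> at a fixed control.\<close>

definition adm :: "(real \<Rightarrow> real) \<Rightarrow> bool" where
  "adm g \<longleftrightarrow> continuous_on I g \<and> (\<forall>z\<in>I. \<exists>c. \<forall>x\<in>I. x \<le> z \<longrightarrow> \<bar>g x\<bar> \<le> c)"

lemma adm_cont: "adm g \<Longrightarrow> continuous_on I g"
  by (simp add: adm_def)

lemma adm_const: "adm (\<lambda>_. c)"
  by (auto simp: adm_def)

lemma adm_diff: assumes "adm f" "adm g" shows "adm (\<lambda>x. f x - g x)"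
  unfolding adm_def
proof (intro conjI ballI)
  show "continuous_on I (\<lambda>x. f x - g x)" using assms by (intro continuous_on_diff adm_cont)
  fix z assume "z \<in> I"
  then obtain c d where "\<And>x. x \<in> I \<Longrightarrow> x \<le> z \<Longrightarrow> \<bar>f x\<bar> \<le> c" "\<And>x. x \<in> I \<Longrightarrow> x \<le> z \<Longrightarrow> \<bar>g x\<bar> \<le> d"
    using assms unfolding adm_def by metis
  then have "\<bar>f x - g x\<bar> \<le> c + d" if "x \<in> I" "x \<le> z" for x
    using that abs_triangle_ineq4[of "f x" "g x"] by (meson add_mono order_trans)
  then show "\<exists>c. \<forall>x\<in>I. x \<le> z \<longrightarrow> \<bar>f x - g x\<bar> \<le> c" by blast
qed

lemma adm_nonneg_mono: 
  assumes "continuous_on I g" "mono_on I g" "\<And>x. x \<in> I \<Longrightarrow> 0 \<le> g x" shows "adm g"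
  unfolding adm_def using assms by (auto simp: mono_on_def intro!: exI[of _ "g _"])

lemma set_measurable_I: 
  assumes f: "continuous_on I f" and z: "z \<in> I"
  shows "set_borel_measurable lborel (einterval lo (ereal z)) (f :: real \<Rightarrow> real)"
  using borel_measurable_continuous_on_indicator[OF _ continuous_on_subset[OF f sub_I[OF z]]]
  by (simp add: set_borel_measurable_def)

lemma H_integrable_bound:
  assumes g: "set_borel_measurable lborel (einterval lo (ereal z)) (\<lambda>x. g x * (\<psi> x * sp x))"
    and c: "\<And>x. x \<in> I \<Longrightarrow> x \<le> z \<Longrightarrow> \<bar>g x\<bar> \<le> c" and z: "z \<in> I"
  shows "set_integrable lborel (einterval lo (ereal z)) (\<lambda>x. g x * (\<psi> x * sp x))"
proof (rule set_integrable_bound[OF set_integrable_mult_right[OF weight_integrable(1)[OF z], of c] g])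
  show "AE x in lborel. x \<in> einterval lo (ereal z) \<longrightarrow> norm (g x * (\<psi> x * sp x)) \<le> norm (c * (\<psi> x * sp x))"
  proof (intro AE_I2 impI)
    fix x assume x: "x \<in> einterval lo (ereal z)"
    then have "x \<in> I" "x \<le> z" using sub_I[OF z] by (auto simp: einterval_def)
    then have "\<bar>g x\<bar> \<le> \<bar>c\<bar>" using c[of x] by linarith
    then show "norm (g x * (\<psi> x * sp x)) \<le> norm (c * (\<psi> x * sp x))" by (simp add: abs_mult mult_right_mono)
  qed
qed

lemma H_measurable:
  assumes "continuous_on I g" "z \<in> I"
  shows "set_borel_measurable lborel (einterval lo (ereal z)) (\<lambda>x. g x * (\<psi> x * sp x))"
  by (rule set_measurable_I[OF _ assms(2)]) (intro continuous_intros assms \<psi>_cont sp_cont)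

lemma H_integrable:
  assumes g: "adm g" and z: "z \<in> I"
  shows "set_integrable lborel (einterval lo (ereal z)) (\<lambda>x. g x * (\<psi> x * sp x))"
proof -
  obtain c where "\<And>x. x \<in> I \<Longrightarrow> x \<le> z \<Longrightarrow> \<bar>g x\<bar> \<le> c" using g z unfolding adm_def by metis
  from H_integrable_bound[OF H_measurable[OF adm_cont[OF g] z] this z] show ?thesis .
qed

lemma H_diff: assumes "adm f" "adm g" "z \<in> I" shows "H (\<lambda>x. f x - g x) z = H f z - H g z"
  unfolding H_def left_diff_distrib
  using H_integrable[OF assms(1,3)] H_integrable[OF assms(2,3)] by (rule set_integral_diff(2))

lemma H_const: assumes "z \<in> I" shows "H (\<lambda>_. c) z = c / r * (p z - p_inf)"
proof -
  have "H (\<lambda>_. c) z = (LINT x:einterval lo (ereal z)|lborel. c / r * (r * (\<psi> x * sp x)))"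
    unfolding H_def using r_pos by (simp add: mult.assoc[symmetric])
  also have "\<dots> = c / r * H (\<lambda>_. r) z" unfolding H_def by (rule set_integral_mult_right)
  finally show ?thesis using weight_integrable(2)[OF assms] by simp
qed

lemma H_le: 
  assumes "adm f" "adm g" "z \<in> I" "\<And>x. x \<in> I \<Longrightarrow> x \<le> z \<Longrightarrow> f x \<le> g x" 
  shows "H f z \<le> H g z"
  unfolding H_def
proof (rule set_integral_mono[OF H_integrable[OF assms(1,3)] H_integrable[OF assms(2,3)]])
  fix x assume x: "x \<in> einterval lo (ereal z)"
  then have "x \<in> I" "x \<le> z" using sub_I[OF assms(3)] by (auto simp: einterval_def)
  then show "f x * (\<psi> x * sp x) \<le> g x * (\<psi> x * sp x)" 
    using assms(4) \<psi>_pos[of x] sp_pos[of x] by (intro mult_right_mono) auto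
qed

text \<open>The integral is improper at \<open>lo\<close>; it is split at an interior point
  \<open>a\<close>, and only the proper part is differentiated.\<close>

lemma H_deriv:
  assumes g: "adm g" and z: "z \<in> I"
  shows "(H g has_real_derivative g z * \<psi> z * sp z) (at z)"
proof -
  obtain a where a: "a \<in> I" "a < z" by (rule I_less[OF z])
  let ?f = "\<lambda>x. g x * (\<psi> x * sp x)"
  have lo: "lo < ereal y" if "y \<in> I" for y using that by (simp add: einterval_def)
  have H: "H g y = (LBINT x=lo..ereal y. ?f x)" if "y \<in> I" for y
    using lo[OF that] by (simp add: H_def interval_lebesgue_integral_le_eq less_imp_le)
  have eq: "H g a + (LBINT x=ereal a..ereal y. ?f x) = H g y" if y: "y \<in> I \<inter> {a<..}" for y
  proof -
    have "(LBINT x=lo..ereal a. ?f x) + (LBINT x=ereal a..ereal y. ?f x) = (LBINT x=lo..ereal y. ?f x)"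
    proof (rule interval_integral_sum)
      have "min lo (min (ereal a) (ereal y)) = lo" "max lo (max (ereal a) (ereal y)) = ereal y"
        using lo[OF a(1)] lo[of y] y by (auto simp: min_def max_def)
      then show "interval_lebesgue_integrable lborel (min lo (min (ereal a) (ereal y))) (max lo (max (ereal a) (ereal y))) ?f"
        using H_integrable[OF g, of y] y lo[of y] by (simp add: interval_lebesgue_integrable_def less_imp_le)
    qed
    then show ?thesis using H[OF a(1)] H[of y] y by simp
  qed
  have "((\<lambda>y. H g a + (LBINT x=ereal a..ereal y. ?f x)) has_real_derivative 0 + ?f z) (at z)"
    by (intro DERIV_add DERIV_const interval_integral_deriv[OF _ a(1) z] continuous_intros adm_cont[OF g] \<psi>_cont sp_cont)
  then have "((\<lambda>y. H g a + (LBINT x=ereal a..ereal y. ?f x)) has_real_derivative g z * \<psi> z * sp z) (at z)"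
    by (simp add: mult.assoc)
  then show ?thesis
    by (rule has_field_derivative_transform_within_open[where S = "I \<inter> {a<..}"]) (use a z eq in auto)
qed

text \<open>Strictness comes from the positive derivative on \<open>{a..z}\<close>; the part below
  \<open>a\<close> is only compared with zero.\<close>

lemma H_pos:
  assumes g: "adm g" and z: "z \<in> I" and pos: "\<And>x. x \<in> I \<Longrightarrow> x \<le> z \<Longrightarrow> 0 < g x"
  shows "0 < H g z"
proof -
  obtain a where a: "a \<in> I" "a < z" by (rule I_less[OF z])
  have "H (\<lambda>_. 0) a \<le> H g a" by (rule H_le[OF adm_const g a(1)]) (use pos a in \<open>auto intro: less_imp_le\<close>)
  moreover have "H (\<lambda>_. 0) a = 0" by (simp add: H_def set_lebesgue_integral_def)
  moreover have "H g a < H g z"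
  proof (rule DERIV_pos_imp_increasing[OF a(2)])
    fix x assume x: "a \<le> x" "x \<le> z"
    then have xI: "x \<in> I" using I_convex a z by blast
    show "\<exists>y. (H g has_real_derivative y) (at x) \<and> 0 < y"
      using H_deriv[OF g xI] mult_pos_pos[OF mult_pos_pos[OF pos[OF xI x(2)] \<psi>_pos[OF xI]] sp_pos[OF xI]] by blast
  qed
  ultimately show ?thesis by linarith
qed

lemma H_less:
  assumes "adm f" "adm g" "z \<in> I" "\<And>x. x \<in> I \<Longrightarrow> x \<le> z \<Longrightarrow> f x < g x"
  shows "H f z < H g z"
  using H_pos[OF adm_diff[OF assms(2,1)] assms(3)] H_diff[OF assms(2,1,3)] assms(4) by simp

lemma H_tendsto:
  fixes g :: "nat \<Rightarrow> real \<Rightarrow> real"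
  assumes g: "\<And>n. continuous_on I (g n)" and f: "continuous_on I f" and z: "z \<in> I"
    and lim: "\<And>x. x \<in> I \<Longrightarrow> x \<le> z \<Longrightarrow> (\<lambda>n. g n x) \<longlonglongrightarrow> f x"
    and c: "\<And>n x. x \<in> I \<Longrightarrow> x \<le> z \<Longrightarrow> \<bar>g n x\<bar> \<le> c"
  shows "(\<lambda>n. H (g n) z) \<longlonglongrightarrow> H f z"
  unfolding H_def set_lebesgue_integral_def
proof (rule integral_dominated_convergence[where w = "\<lambda>x. indicator (einterval lo (ereal z)) x *\<^sub>R (c * (\<psi> x * sp x))"])
  show "integrable lborel (\<lambda>x. indicator (einterval lo (ereal z)) x *\<^sub>R (c * (\<psi> x * sp x)))"
    using set_integrable_mult_right[OF weight_integrable(1)[OF z], of c] unfolding set_integrable_def .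
  have xI: "x \<in> I \<and> x \<le> z" if "x \<in> einterval lo (ereal z)" for x
    using sub_I[OF z] that by (auto simp: einterval_def)
  show "AE x in lborel. (\<lambda>n. indicator (einterval lo (ereal z)) x *\<^sub>R (g n x * (\<psi> x * sp x))) \<longlonglongrightarrow> indicator (einterval lo (ereal z)) x *\<^sub>R (f x * (\<psi> x * sp x))"
  proof (rule AE_I2)
    fix x
    show "(\<lambda>n. indicator (einterval lo (ereal z)) x *\<^sub>R (g n x * (\<psi> x * sp x))) \<longlonglongrightarrow> indicator (einterval lo (ereal z)) x *\<^sub>R (f x * (\<psi> x * sp x))"
      using lim[of x] xI[of x] by (cases "x \<in> einterval lo (ereal z)") (auto intro!: tendsto_mult)
  qed
  show "AE x in lborel. norm (indicator (einterval lo (ereal z)) x *\<^sub>R (g n x * (\<psi> x * sp x))) \<le> indicator (einterval lo (ereal z)) x *\<^sub>R (c * (\<psi> x * sp x))" for n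
  proof (rule AE_I2)
    fix x
    show "norm (indicator (einterval lo (ereal z)) x *\<^sub>R (g n x * (\<psi> x * sp x))) \<le> indicator (einterval lo (ereal z)) x *\<^sub>R (c * (\<psi> x * sp x))"
    proof (cases "x \<in> einterval lo (ereal z)")
      case True
      then have "x \<in> I" "x \<le> z" using xI by auto
      then show ?thesis using True c[of x n] \<psi>_pos[of x] sp_pos[of x] by (simp add: abs_mult mult_right_mono)
    qed simp
  qed
qed (use H_measurable[OF f z] H_measurable[OF g z] in \<open>auto simp: set_borel_measurable_def\<close>)

lemma nn_integral_H:
  assumes g: "adm g" and z: "z \<in> I" and nn: "\<And>x. x \<in> I \<Longrightarrow> 0 \<le> g x"
  shows "(\<integral>\<^sup>+ x\<in>einterval lo (ereal z). ennreal (g x * \<psi> x * sp x) \<partial>lborel) = ennreal (H g z)"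
proof -
  let ?f = "\<lambda>x. indicator (einterval lo (ereal z)) x * (g x * (\<psi> x * sp x))"
  have i: "integrable lborel ?f" using H_integrable[OF g z] by (simp add: set_integrable_def)
  have "0 \<le> ?f x" for x
    using nn[of x] \<psi>_pos[of x] sp_pos[of x] sub_I[OF z] by (auto simp: indicator_def subset_iff)
  then have "(\<integral>\<^sup>+ x. ennreal (?f x) \<partial>lborel) = ennreal (integral\<^sup>L lborel ?f)"
    using i by (intro nn_integral_eq_integral) auto
  moreover have "(\<integral>\<^sup>+ x\<in>einterval lo (ereal z). ennreal (g x * \<psi> x * sp x) \<partial>lborel) = (\<integral>\<^sup>+ x. ennreal (?f x) \<partial>lborel)"
    by (rule nn_integral_cong) (auto simp: indicator_def mult.assoc)
  ultimately show ?thesis by (simp add: H_def set_lebesgue_integral_def)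
qed

end

section \<open>The stopped diffusion\<close>

lemma disc_ereal: "disc r (ereal t) = exp (- r * t)"
  by (simp add: disc_def)

lemma integral_discount:
  fixes r t c :: real
  assumes "0 < r" "0 \<le> t"
  shows "integral {0..t} (\<lambda>s. exp (- r * s) * c) = c / r * (1 - exp (- r * t))"
proof -
  have h: "((\<lambda>s. exp (- r * s) * c) has_integral (- (c / r) * exp (- r * t) - (- (c / r) * exp (- r * 0)))) {0..t}"
  proof (rule fundamental_theorem_of_calculus[OF assms(2)])
    fix s
    show "((\<lambda>s. - (c / r) * exp (- r * s)) has_vector_derivative exp (- r * s) * c) (at s within {0..t})"
      using assms(1) by (auto intro!: derivative_eq_intros simp: has_real_derivative_iff_has_vector_derivative[symmetric])
  qed
  have eq: "- (c / r) * exp (- r * t) - (- (c / r) * exp (- r * 0)) = c / r * (1 - exp (- r * t))"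
    by (simp add: right_diff_distrib)
  show ?thesis by (rule trans[OF integral_unique[OF h] eq])
qed

locale diffusion_process = filtered_prob_space M F + diffusion lo hi \<mu> \<sigma> \<psi> \<psi>1 \<psi>2 r x0
  for M :: "'a measure" and F lo hi \<mu> \<sigma> \<psi> \<psi>1 \<psi>2 r x0 +
  fixes W :: "real \<Rightarrow> 'a \<Rightarrow> real" and X :: "real \<Rightarrow> real \<Rightarrow> 'a \<Rightarrow> real"
  assumes X_sol: "x \<in> einterval lo hi \<Longrightarrow> strong_solution M F W (einterval lo hi) \<mu> \<sigma> x (X x)"
    and \<psi>_hit: "x \<in> einterval lo hi \<Longrightarrow> y \<in> einterval lo hi \<Longrightarrow> x \<le> y \<Longrightarrow>
        (\<integral>\<omega>. disc r (hitting_time (X x) y \<omega>) \<partial>M) = \<psi> x / \<psi> y"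
begin

lemma X_adapted: "x \<in> I \<Longrightarrow> adapted_proc M F (X x)"
  and X_cont: "x \<in> I \<Longrightarrow> \<omega> \<in> space M \<Longrightarrow> continuous_on {0..} (\<lambda>t. X x t \<omega>)"
  and X_0: "x \<in> I \<Longrightarrow> \<omega> \<in> space M \<Longrightarrow> X x 0 \<omega> = x"
  and X_I: "x \<in> I \<Longrightarrow> \<omega> \<in> space M \<Longrightarrow> 0 \<le> t \<Longrightarrow> X x t \<omega> \<in> I"
  using X_sol[of x] unfolding strong_solution_def by auto

lemma seq_lo: 
  assumes "x \<in> I" obtains a where "\<And>n::nat. a n \<in> I" "\<And>n. a n < x" "(\<lambda>n. ereal (a n)) \<longlonglongrightarrow> lo"
proof -
  have "lo < ereal x" using assms by (simp add: einterval_def)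
  then obtain u l where l: "\<And>i. l i < u i" "\<And>i. lo < ereal (l i)" "\<And>i. ereal (u i) < ereal x" "(\<lambda>i. ereal (l i)) \<longlonglongrightarrow> lo"
    by (rule einterval_Icc_approximation) blast
  have lx: "l i < x" for i using l(1,3)[of i] by auto
  moreover have "l i \<in> I" for i
    using sub_I[OF assms] l(2)[of i] lx[of i] by (auto simp: einterval_def)
  ultimately show thesis using that l(4) by blast
qed

lemma seq_hi: 
  assumes "x \<in> I" obtains b where "\<And>n::nat. b n \<in> I" "\<And>n. x < b n" "(\<lambda>n. ereal (b n)) \<longlonglongrightarrow> hi"
proof -
  have "ereal x < hi" using assms by (simp add: einterval_def)
  then obtain u l where l: "\<And>i. l i < u i" "\<And>i. ereal x < ereal (l i)" "\<And>i. ereal (u i) < hi" "(\<lambda>i. ereal (u i)) \<longlonglongrightarrow> hi"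
    by (rule einterval_Icc_approximation) blast
  have lx: "x < u i" for i using l(1,2)[of i] by auto
  moreover have "u i \<in> I" for i
  proof -
    have "lo < ereal x" using assms by (simp add: einterval_def)
    also have "ereal x < ereal (u i)" using lx by simp
    finally show ?thesis using l(3)[of i] by (simp add: einterval_def)
  qed
  ultimately show thesis using that l(4) by blast
qed

lemma path_eventually:
  assumes x: "x \<in> I" and w: "\<omega> \<in> space M" and a: "(\<lambda>n. ereal (a n)) \<longlonglongrightarrow> lo" and b: "(\<lambda>n. ereal (b n)) \<longlonglongrightarrow> hi" 
    and T: "0 \<le> T"
  shows "\<forall>\<^sub>F n in sequentially. \<forall>s\<in>{0..T}. a n < X x s \<omega> \<and> X x s \<omega> < b n"
proof (rule eventually_path_in_compact[OF X_cont[OF x w] _ a b T])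
  show "lo < ereal (X x t \<omega>) \<and> ereal (X x t \<omega>) < hi" if "0 \<le> t" for t
    using X_I[OF x w that] by (simp add: einterval_def)
qed

text \<open>The levels \<open>b n\<close> move to \<open>hi\<close>, which no path reaches, so their
  hitting times tend to infinity. The expected discounts, equal to
  \<open>\<psi> x0 / \<psi> (b n)\<close> by \<open>\<psi>_hit\<close>, therefore tend to 0, which a
  bounded \<open>\<psi>\<close> would prevent.\<close>

lemma \<psi>_unbounded: "\<exists>y\<in>I. x0 \<le> y \<and> B < \<psi> y"
proof (rule ccontr)
  assume *: "\<not> (\<exists>y\<in>I. x0 \<le> y \<and> B < \<psi> y)"
  have bd: "\<psi> y \<le> B" if "y \<in> I" "x0 \<le> y" for y using * that by force
  obtain a where a: "\<And>n::nat. a n \<in> I" "(\<lambda>n. ereal (a n)) \<longlonglongrightarrow> lo" by (rule seq_lo[OF x0]) blast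
  obtain b where b: "\<And>n::nat. b n \<in> I" "\<And>n. x0 < b n" "(\<lambda>n. ereal (b n)) \<longlonglongrightarrow> hi" by (rule seq_hi[OF x0]) blast
  define f where "f n \<omega> = disc r (hitting_time (X x0) (b n) \<omega>)" for n \<omega>
  have E: "(\<integral>\<omega>. f n \<omega> \<partial>M) = \<psi> x0 / \<psi> (b n)" for n
    unfolding f_def using \<psi>_hit[OF x0 b(1)] b(2)[of n] by simp
  \<comment> \<open>A default value at work: the integral of a non-integrable function is 0, whereas
    the right side of \<open>E\<close> is positive. Measurability of the discounted hitting time
    comes along.\<close>
  have fi: "integrable M (f n)" for n
  proof (rule ccontr)
    assume "\<not> integrable M (f n)"
    then have "(\<integral>\<omega>. f n \<omega> \<partial>M) = 0" by (rule not_integrable_integral_eq)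
    then show False using E[of n] \<psi>_pos[OF x0] \<psi>_pos[OF b(1)[of n]] by simp
  qed
  have h0: "0 \<le> hitting_time (X x0) y \<omega>" for y \<omega>
    unfolding hitting_time_def by (rule Inf_greatest) auto
  have disc_le: "0 \<le> disc r t \<and> disc r t \<le> exp (- r * T)" if "ereal T \<le> t" for t T
    using that r_pos by (cases t) (auto simp: disc_def mult_left_mono)
  have "(\<lambda>n. \<integral>\<omega>. f n \<omega> \<partial>M) \<longlonglongrightarrow> (\<integral>\<omega>. 0 \<partial>M)"
  proof (rule integral_dominated_convergence[where w = "\<lambda>_. 1"])
    show "AE \<omega> in M. norm (f n \<omega>) \<le> 1" for n
      using disc_le[of 0] h0 by (intro AE_I2) (simp add: f_def zero_ereal_def[symmetric])
    show "AE \<omega> in M. (\<lambda>n. f n \<omega>) \<longlonglongrightarrow> 0"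
    proof (rule AE_I2)
      fix \<omega> assume w: "\<omega> \<in> space M"
      show "(\<lambda>n. f n \<omega>) \<longlonglongrightarrow> 0"
      proof (rule LIMSEQ_I)
        fix e :: real assume e: "0 < e"
        have "((\<lambda>T. exp (- r * T)) \<longlongrightarrow> 0) at_top" using r_pos by real_asymp
        then have "\<forall>\<^sub>F T in at_top. exp (- r * T) < e \<and> 0 \<le> T" 
          using e by (intro eventually_conj order_tendstoD(2) eventually_ge_at_top)
        then obtain T where T: "exp (- r * T) < e" "0 \<le> T" using eventually_happens[of _ at_top] by force
        have "\<forall>\<^sub>F n in sequentially. f n \<omega> < e \<and> 0 \<le> f n \<omega>"
          using path_eventually[OF x0 w a(2) b(3) T(2)]
        proof eventually_elim
          case (elim n)
          have "ereal T \<le> hitting_time (X x0) (b n) \<omega>" unfolding hitting_time_def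
          proof (rule Inf_greatest)
            fix v assume "v \<in> ereal ` {t. 0 \<le> t \<and> X x0 t \<omega> = b n}"
            then obtain t where t: "v = ereal t" "0 \<le> t" "X x0 t \<omega> = b n" by auto
            have "\<not> t \<le> T"
            proof
              assume "t \<le> T"
              then have "X x0 t \<omega> < b n" using elim t(2) by simp
              then show False using t(3) by simp
            qed
            then show "ereal T \<le> v" using t by simp
          qed
          then show ?case using disc_le[of T "hitting_time (X x0) (b n) \<omega>"] T by (auto simp: f_def)
        qed
        then show "\<exists>n0. \<forall>n\<ge>n0. norm (f n \<omega> - 0) < e" 
          unfolding eventually_sequentially real_norm_def diff_zero by (metis abs_of_nonneg)
      qed
    qed
  qed (use fi in auto)
  then have lim: "(\<lambda>n. \<psi> x0 / \<psi> (b n)) \<longlonglongrightarrow> 0" unfolding E Bochner_Integration.integral_zero .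
  have B0: "0 < B" using bd[OF x0] \<psi>_pos[OF x0] by simp
  have "\<psi> x0 / B \<le> \<psi> x0 / \<psi> (b n)" for n
    using bd[OF b(1)[of n]] b(2)[of n] \<psi>_pos[OF x0] \<psi>_pos[OF b(1)[of n]] B0 by (intro divide_left_mono) auto
  then have "\<psi> x0 / B \<le> 0" by (intro LIMSEQ_le_const[OF lim]) auto
  then show False using B0 \<psi>_pos[OF x0] by (simp add: divide_le_0_iff)
qed

section \<open>Dynkin's formula for the inhomogeneous equation\<close>

lemma exit_time_facts:
  assumes x: "x \<in> I" and ab: "a < x" "x < b" and T: "0 < T" and \<tau>: "stopping_time_e M F \<tau>" and w: "\<omega> \<in> space M"
  defines "S \<equiv> exit_time (X x) \<tau> a b T \<omega>"
  shows "0 \<le> S" "S \<le> T" "ereal S \<le> \<tau> \<omega>" 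
    "\<And>t. 0 \<le> t \<Longrightarrow> t \<le> S \<Longrightarrow> X x t \<omega> \<in> {a..b}"
    "S = T \<or> X x S \<omega> \<notin> {a<..<b} \<or> \<tau> \<omega> \<le> ereal S"
proof -
  have X0: "X x 0 \<omega> \<in> {a<..<b}" using X_0[OF x w] ab by simp
  have \<tau>0: "0 \<le> \<tau> \<omega>" using \<tau> w unfolding stopping_time_e_def by blast
  note P = exit_time_props[where Y = "X x" and \<tau> = \<tau> and \<omega> = \<omega>, OF X_cont[OF x w] X0 T \<tau>0]
  show "0 \<le> S" "S \<le> T" "ereal S \<le> \<tau> \<omega>" "\<And>t. 0 \<le> t \<Longrightarrow> t \<le> S \<Longrightarrow> X x t \<omega> \<in> {a..b}"
    "S = T \<or> X x S \<omega> \<notin> {a<..<b} \<or> \<tau> \<omega> \<le> ereal S"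
    unfolding S_def by (fact P(1) P(2) P(3) P(5) P(6))+
qed

lemma exit_time_stopping_time:
  assumes x: "x \<in> I" and ab: "a < x" "x < b" and T: "0 < T" and \<tau>: "stopping_time_e M F \<tau>" and q: "0 \<le> q"
  shows "{\<omega>\<in>space M. exit_time (X x) \<tau> a b T \<omega> \<le> q} \<in> F q"
  by (rule exit_time_stopping[OF X_adapted[OF x] X_cont[OF x] _ T \<tau> q]) (use X_0[OF x] ab in auto)

text \<open>One function \<open>K\<close> serves all starting points, exit levels, deadlines and
  stopping times; only the normalising zero \<open>z\<close> is chosen by the application.\<close>

lemma inhomogeneous_dynkin:
  assumes \<Gamma>: "\<And>x. x \<in> I \<Longrightarrow> (\<Gamma> has_real_derivative g x * \<psi> x * sp x) (at x)"
    and g: "continuous_on I g" and z: "z \<in> I"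
  obtains K where
    "\<And>x. x \<in> I \<Longrightarrow> (K has_real_derivative - (sc x * \<Gamma> x / (\<psi> x)\<^sup>2)) (at x)" "K z = 0"
    "\<And>x a b T \<tau>. a \<in> I \<Longrightarrow> b \<in> I \<Longrightarrow> a < x \<Longrightarrow> x < b \<Longrightarrow> 0 < T \<Longrightarrow> stopping_time_e M F \<tau> \<Longrightarrow>
      integrable M (\<lambda>\<omega>. integral {0..exit_time (X x) \<tau> a b T \<omega>} (\<lambda>s. exp (- r * s) * g (X x s \<omega>))) \<and>
      (\<integral>\<omega>. integral {0..exit_time (X x) \<tau> a b T \<omega>} (\<lambda>s. exp (- r * s) * g (X x s \<omega>)) \<partial>M) =
      \<psi> x * K x - (\<integral>\<omega>. exp (- r * exit_time (X x) \<tau> a b T \<omega>) * 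
         (\<psi> (X x (exit_time (X x) \<tau> a b T \<omega>) \<omega>) * K (X x (exit_time (X x) \<tau> a b T \<omega>) \<omega>)) \<partial>M)"
proof (rule inhomogeneous_solution[OF \<Gamma> g z])
  fix K u1 u2
  assume K: "\<And>x. x \<in> I \<Longrightarrow> (K has_real_derivative - (sc x * \<Gamma> x / (\<psi> x)\<^sup>2)) (at x)" "K z = 0"
    "\<And>x. x \<in> I \<Longrightarrow> ((\<lambda>x. \<psi> x * K x) has_real_derivative u1 x) (at x)"
    "\<And>x. x \<in> I \<Longrightarrow> (u1 has_real_derivative u2 x) (at x)"
    "continuous_on I u2"
    "\<And>x. x \<in> I \<Longrightarrow> (\<sigma> x)\<^sup>2 / 2 * u2 x + \<mu> x * u1 x - r * (\<psi> x * K x) = - g x"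
  show thesis
  proof (rule that[OF K(1,2)])
    fix x a b T :: real and \<tau>
    assume A: "a \<in> I" "b \<in> I" "a < x" "x < b" "0 < T" "stopping_time_e M F \<tau>"
    have x: "x \<in> I" using I_convex[OF A(1,2)] A by simp
    define S where "S = exit_time (X x) \<tau> a b T"
    have sub: "{a..b} \<subseteq> I" using I_Icc A by blast
    note P = exit_time_facts[OF x A(3-6), folded S_def] and st = exit_time_stopping_time[OF x A(3-6), folded S_def]
    note D = dynkin[OF X_sol[OF x] st P(1) P(2) A(5) P(4) continuous_on_subset[OF \<mu>_cont sub] continuous_on_subset[OF \<sigma>_cont sub] less_imp_le[OF r_pos]
       K(3)[OF subsetD[OF sub]] K(4)[OF subsetD[OF sub]] continuous_on_subset[OF K(5) sub]]
    have eq: "integral {0..S \<omega>} (\<lambda>s. exp (- r * s) * ((\<sigma> (X x s \<omega>))\<^sup>2 / 2 * u2 (X x s \<omega>) + \<mu> (X x s \<omega>) * u1 (X x s \<omega>) - r * (\<psi> (X x s \<omega>) * K (X x s \<omega>))))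
      = - integral {0..S \<omega>} (\<lambda>s. exp (- r * s) * g (X x s \<omega>))" if "\<omega> \<in> space M" for \<omega>
    proof -
      have "integral {0..S \<omega>} (\<lambda>s. exp (- r * s) * ((\<sigma> (X x s \<omega>))\<^sup>2 / 2 * u2 (X x s \<omega>) + \<mu> (X x s \<omega>) * u1 (X x s \<omega>) - r * (\<psi> (X x s \<omega>) * K (X x s \<omega>))))
        = integral {0..S \<omega>} (\<lambda>s. - (exp (- r * s) * g (X x s \<omega>)))"
        by (rule Henstock_Kurzweil_Integration.integral_cong) (use K(6) X_I[OF x that] in simp)
      then show ?thesis by simp
    qed
    have i: "integrable M (\<lambda>\<omega>. - integral {0..S \<omega>} (\<lambda>s. exp (- r * s) * g (X x s \<omega>)))"
      using D(1) eq by (simp cong: Bochner_Integration.integrable_cong)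
    have e: "(\<integral>\<omega>. exp (- r * S \<omega>) * (\<psi> (X x (S \<omega>) \<omega>) * K (X x (S \<omega>) \<omega>)) \<partial>M) = \<psi> x * K x + (\<integral>\<omega>. - integral {0..S \<omega>} (\<lambda>s. exp (- r * s) * g (X x s \<omega>)) \<partial>M)"
      using D(2) eq by (simp cong: Bochner_Integration.integral_cong)
    show "integrable M (\<lambda>\<omega>. integral {0..exit_time (X x) \<tau> a b T \<omega>} (\<lambda>s. exp (- r * s) * g (X x s \<omega>))) \<and>
      (\<integral>\<omega>. integral {0..exit_time (X x) \<tau> a b T \<omega>} (\<lambda>s. exp (- r * s) * g (X x s \<omega>)) \<partial>M) =
      \<psi> x * K x - (\<integral>\<omega>. exp (- r * exit_time (X x) \<tau> a b T \<omega>) * 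
         (\<psi> (X x (exit_time (X x) \<tau> a b T \<omega>) \<omega>) * K (X x (exit_time (X x) \<tau> a b T \<omega>) \<omega>)) \<partial>M)"
      using i e unfolding S_def[symmetric] by simp
  qed
qed

lemma never_stopping: "stopping_time_e M F (\<lambda>_. \<infinity>)"
  unfolding stopping_time_e_def
proof (intro conjI allI impI ballI)
  fix t :: real assume "0 \<le> t"
  then interpret sigma_algebra "space M" "F t" by (rule F_algebra)
  show "{\<omega> \<in> space M. \<infinity> \<le> ereal t} \<in> F t" by simp
qed simp

lemma exit_time_measurable:
  assumes x: "x \<in> I" and ab: "a < x" "x < b" and T: "0 < T" and \<tau>: "stopping_time_e M F \<tau>"
  shows "exit_time (X x) \<tau> a b T \<in> borel_measurable M"
    and "(\<lambda>\<omega>. X x (exit_time (X x) \<tau> a b T \<omega>) \<omega>) \<in> borel_measurable M"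
proof -
  define S where "S = exit_time (X x) \<tau> a b T"
  note P = exit_time_facts[OF x ab T \<tau>, folded S_def] and st = exit_time_stopping_time[OF x ab T \<tau>, folded S_def]
  have "(\<lambda>\<omega>. min T (S \<omega>)) \<in> borel_measurable M"
    using measurable_G_M[OF less_imp_le[OF T] measurable_min_stopping[OF less_imp_le[OF T] st P(1)]] .
  moreover have *: "min T (S \<omega>) = S \<omega>" if "\<omega> \<in> space M" for \<omega> using P(2)[OF that] by simp
  ultimately have Sm: "S \<in> borel_measurable M"
    using measurable_cong[of M "\<lambda>\<omega>. min T (S \<omega>)" S, OF *] by blast
  then show "exit_time (X x) \<tau> a b T \<in> borel_measurable M" by (simp add: S_def)
  have Xm: "X x q \<in> borel_measurable M" if "0 \<le> q" for q
    by (rule measurable_G_M[OF that adapted_procD[OF X_adapted[OF x] that]])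
  have "(\<lambda>\<omega>. X x (S \<omega>) \<omega>) \<in> borel_measurable M"
    by (rule measurable_random_time[where t = T and Z = "X x" and R = S])
       (use T Sm P(1,2) X_cont[OF x] Xm in auto)
  then show "(\<lambda>\<omega>. X x (exit_time (X x) \<tau> a b T \<omega>) \<omega>) \<in> borel_measurable M" by (simp add: S_def)
qed

text \<open>At \<open>S n\<close> the path is at \<open>z\<close>, where \<open>u\<close> vanishes,
  or it has met the lower level or the deadline. Along a fixed path the last two can only happen
  late when \<open>n\<close> is large, and then the discount makes the bounded \<open>u\<close>
  negligible.\<close>

lemma hitting_limit:
  assumes x: "x \<in> I" and z: "z \<in> I" "x < z" and a: "\<And>n. a n \<in> I" "\<And>n. a n < x" "(\<lambda>n. ereal (a n)) \<longlonglongrightarrow> lo"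
    and u: "continuous_on I u" "u z = 0" and c: "\<And>q. q \<in> I \<Longrightarrow> q \<le> z \<Longrightarrow> \<bar>u q\<bar> \<le> c"
  defines "S \<equiv> \<lambda>n. exit_time (X x) (\<lambda>_. \<infinity>) (a n) z (real (Suc n))"
  shows "(\<lambda>n. \<integral>\<omega>. exp (- r * S n \<omega>) * u (X x (S n \<omega>) \<omega>) \<partial>M) \<longlonglongrightarrow> 0"
proof -
  have Tn: "0 < real (Suc n)" for n by simp
  note E = exit_time_facts[OF x a(2) z(2) Tn never_stopping]
  have P: "0 \<le> S n \<omega>" "S n \<omega> \<le> real (Suc n)" "X x (S n \<omega>) \<omega> \<in> {a n..z}" 
     "S n \<omega> = real (Suc n) \<or> X x (S n \<omega>) \<omega> \<notin> {a n<..<z}" if "\<omega> \<in> space M" for n \<omega>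
    unfolding S_def using E(1)[OF that, of n n] E(2)[OF that, of n n] E(4)[OF that E(1)[OF that] order_refl, of n n] E(5)[OF that, of n n] 
    by (auto simp del: of_nat_Suc)
  have XI: "X x (S n \<omega>) \<omega> \<in> I" if "\<omega> \<in> space M" for n \<omega> using X_I[OF x that P(1)[OF that]] .
  have meas: "(\<lambda>\<omega>. exp (- r * S n \<omega>) * u (X x (S n \<omega>) \<omega>)) \<in> borel_measurable M" for n
  proof -
    have [measurable]: "S n \<in> borel_measurable M" "(\<lambda>\<omega>. X x (S n \<omega>) \<omega>) \<in> borel_measurable M"
      unfolding S_def by (rule exit_time_measurable[OF x a(2) z(2) Tn never_stopping])+
    have [measurable]: "(\<lambda>q. indicator I q *\<^sub>R u q) \<in> borel_measurable borel"
      by (rule borel_measurable_continuous_on_indicator[OF _ u(1)]) simp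
    have "(\<lambda>\<omega>. exp (- r * S n \<omega>) * (indicator I (X x (S n \<omega>) \<omega>) *\<^sub>R u (X x (S n \<omega>) \<omega>))) \<in> borel_measurable M"
      by (intro borel_measurable_times measurable_compose[OF _ \<open>(\<lambda>q. indicator I q *\<^sub>R u q) \<in> borel_measurable borel\<close>]) measurable
    moreover have *: "exp (- r * S n \<omega>) * (indicator I (X x (S n \<omega>) \<omega>) *\<^sub>R u (X x (S n \<omega>) \<omega>)) = exp (- r * S n \<omega>) * u (X x (S n \<omega>) \<omega>)"
      if "\<omega> \<in> space M" for \<omega> using XI[OF that] by simp
    ultimately show ?thesis 
      using measurable_cong[of M "\<lambda>\<omega>. exp (- r * S n \<omega>) * (indicator I (X x (S n \<omega>) \<omega>) *\<^sub>R u (X x (S n \<omega>) \<omega>))"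
         "\<lambda>\<omega>. exp (- r * S n \<omega>) * u (X x (S n \<omega>) \<omega>)", OF *] by blast
  qed
  have uc: "\<bar>u (X x (S n \<omega>) \<omega>)\<bar> \<le> c" if "\<omega> \<in> space M" for n \<omega>
  proof -
    have "X x (S n \<omega>) \<omega> \<le> z" using P(3)[OF that, of n] by simp
    then show ?thesis by (rule c[OF XI[OF that]])
  qed
  have b1: "\<bar>exp (- r * S n \<omega>) * u (X x (S n \<omega>) \<omega>)\<bar> \<le> c" if "\<omega> \<in> space M" for n \<omega>
  proof -
    have "\<bar>exp (- r * S n \<omega>) * u (X x (S n \<omega>) \<omega>)\<bar> \<le> 1 * c" unfolding abs_mult
      using uc[OF that, of n] P(1)[OF that, of n] r_pos by (intro mult_mono) auto
    then show ?thesis by simp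
  qed
  have "(\<lambda>n. \<integral>\<omega>. exp (- r * S n \<omega>) * u (X x (S n \<omega>) \<omega>) \<partial>M) \<longlonglongrightarrow> (\<integral>\<omega>. 0 \<partial>M)"
  proof (rule integral_dominated_convergence[where w = "\<lambda>_. c"])
    show "AE \<omega> in M. (\<lambda>n. exp (- r * S n \<omega>) * u (X x (S n \<omega>) \<omega>)) \<longlonglongrightarrow> 0"
    proof (rule AE_I2)
      fix \<omega> assume w: "\<omega> \<in> space M"
      show "(\<lambda>n. exp (- r * S n \<omega>) * u (X x (S n \<omega>) \<omega>)) \<longlonglongrightarrow> 0"
      proof (rule LIMSEQ_I)
        fix e :: real assume e: "0 < e"
        have "((\<lambda>T. exp (- r * T) * c) \<longlongrightarrow> 0 * c) at_top" using r_pos by (intro tendsto_mult tendsto_const) real_asymp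
        then have "\<forall>\<^sub>F T in at_top. exp (- r * T) * c < e \<and> 0 \<le> T" 
          using e by (intro eventually_conj order_tendstoD(2) eventually_ge_at_top) auto
        then obtain T where T: "exp (- r * T) * c < e" "0 \<le> T" using eventually_happens[of _ at_top] by force
        obtain b where b: "(\<lambda>n. ereal (b n)) \<longlonglongrightarrow> hi" by (rule seq_hi[OF x]) blast
        have "\<forall>\<^sub>F n in sequentially. T < real (Suc n)"
          using filterlim_at_top_dense[THEN iffD1, OF filterlim_compose[OF filterlim_real_sequentially filterlim_Suc]] by blast
        with path_eventually[OF x w a(3) b T(2)]
        have "\<forall>\<^sub>F n in sequentially. \<bar>exp (- r * S n \<omega>) * u (X x (S n \<omega>) \<omega>)\<bar> < e"
        proof eventually_elim
          case (elim n)
          show ?case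
          proof (cases "T \<le> S n \<omega>")
            case True
            have "\<bar>exp (- r * S n \<omega>) * u (X x (S n \<omega>) \<omega>)\<bar> \<le> exp (- r * T) * c" unfolding abs_mult
              using uc[OF w, of n] r_pos True by (intro mult_mono) auto
            then show ?thesis using T(1) by simp
          next
            case False
            then have "S n \<omega> \<in> {0..T}" "S n \<omega> \<noteq> real (Suc n)" using P(1)[OF w, of n] elim(2) by auto
            \<comment> \<open>Up to time \<open>T\<close> the lower level is out of reach and the
              deadline has not come, so the exit is through \<open>z\<close>.\<close>
            then have "X x (S n \<omega>) \<omega> = z" using P(3,4)[OF w, of n] elim(1) by force
            then show ?thesis using u(2) e by simp
          qed
        qed
        then show "\<exists>n0. \<forall>n\<ge>n0. norm (exp (- r * S n \<omega>) * u (X x (S n \<omega>) \<omega>) - 0) < e" unfolding eventually_sequentially by simp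
      qed
    qed
  qed (use meas b1 in \<open>auto intro!: AE_I2\<close>)
  then show ?thesis by simp
qed

text \<open>The expected payoff of running up to \<open>z\<close>. The terminal term of
  \<open>inhomogeneous_dynkin\<close> disappears by \<open>hitting_limit\<close>, so the sign of the
  limit is that of \<open>K x\<close>.\<close>

lemma hitting_dynkin_limit:
  assumes \<Gamma>: "\<And>x. x \<in> I \<Longrightarrow> (\<Gamma> has_real_derivative g x * \<psi> x * sp x) (at x)"
    and g: "continuous_on I g" and x: "x \<in> I" and z: "z \<in> I" "x < z" 
    and a: "\<And>n. a n \<in> I" "\<And>n. a n < x" "(\<lambda>n. ereal (a n)) \<longlonglongrightarrow> lo"
    and c: "0 \<le> c" "\<And>q. q \<in> I \<Longrightarrow> q \<le> z \<Longrightarrow> \<bar>\<Gamma> q\<bar> \<le> c * p q"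
  obtains K where "\<And>x. x \<in> I \<Longrightarrow> (K has_real_derivative - (sc x * \<Gamma> x / (\<psi> x)\<^sup>2)) (at x)" "K z = 0"
    "\<And>n. integrable M (\<lambda>\<omega>. integral {0..exit_time (X x) (\<lambda>_. \<infinity>) (a n) z (real (Suc n)) \<omega>} (\<lambda>s. exp (- r * s) * g (X x s \<omega>)))"
    "(\<lambda>n. \<integral>\<omega>. integral {0..exit_time (X x) (\<lambda>_. \<infinity>) (a n) z (real (Suc n)) \<omega>} (\<lambda>s. exp (- r * s) * g (X x s \<omega>)) \<partial>M) \<longlonglongrightarrow> \<psi> x * K x"
proof (rule inhomogeneous_dynkin[OF \<Gamma> g z(1)])
  fix K assume K: "\<And>x. x \<in> I \<Longrightarrow> (K has_real_derivative - (sc x * \<Gamma> x / (\<psi> x)\<^sup>2)) (at x)" "K z = 0"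
    "\<And>x a b T \<tau>. a \<in> I \<Longrightarrow> b \<in> I \<Longrightarrow> a < x \<Longrightarrow> x < b \<Longrightarrow> 0 < T \<Longrightarrow> stopping_time_e M F \<tau> \<Longrightarrow>
      integrable M (\<lambda>\<omega>. integral {0..exit_time (X x) \<tau> a b T \<omega>} (\<lambda>s. exp (- r * s) * g (X x s \<omega>))) \<and>
      (\<integral>\<omega>. integral {0..exit_time (X x) \<tau> a b T \<omega>} (\<lambda>s. exp (- r * s) * g (X x s \<omega>)) \<partial>M) =
      \<psi> x * K x - (\<integral>\<omega>. exp (- r * exit_time (X x) \<tau> a b T \<omega>) * 
         (\<psi> (X x (exit_time (X x) \<tau> a b T \<omega>) \<omega>) * K (X x (exit_time (X x) \<tau> a b T \<omega>) \<omega>)) \<partial>M)"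
  have K_cont: "continuous_on I K"
    by (rule DERIV_continuous_on[OF has_field_derivative_at_within[OF K(1)]])
  have u_cont: "continuous_on I (\<lambda>q. \<psi> q * K q)" by (intro continuous_on_mult \<psi>_cont K_cont)
  have u0: "\<psi> z * K z = 0" using K(2) by simp
  have ub: "\<bar>\<psi> q * K q\<bar> \<le> c" if "q \<in> I" "q \<le> z" for q
    by (rule solution_bounded[OF K(1) K(2) z(1) c that])
  have Tn: "0 < real (Suc n)" for n by simp
  note D = K(3)[OF a(1) z(1) a(2) z(2) Tn never_stopping]
  show thesis
  proof (rule that[OF K(1,2)])
    show "integrable M (\<lambda>\<omega>. integral {0..exit_time (X x) (\<lambda>_. \<infinity>) (a n) z (real (Suc n)) \<omega>} (\<lambda>s. exp (- r * s) * g (X x s \<omega>)))" for n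
      using D by blast
    show "(\<lambda>n. \<integral>\<omega>. integral {0..exit_time (X x) (\<lambda>_. \<infinity>) (a n) z (real (Suc n)) \<omega>} (\<lambda>s. exp (- r * s) * g (X x s \<omega>)) \<partial>M) \<longlonglongrightarrow> \<psi> x * K x"
      unfolding conjunct2[OF D]
      using tendsto_diff[OF tendsto_const hitting_limit[OF x z a u_cont u0 ub], of "\<psi> x * K x"] by simp
  qed
qed

text \<open>If \<open>p_inf\<close> were positive, the decreasing solution vanishing at \<open>z\<close> would stay bounded near \<open>lo\<close>,
  i.e. \<open>lo\<close> would be attainable.\<close>
lemma p_inf_eq_0: "p_inf = 0"
proof (rule ccontr)
  assume "p_inf \<noteq> 0"
  then have L: "0 < p_inf" using p_inf_nonneg by simp
  obtain z where z: "z \<in> I" "x0 < z" by (rule I_greater[OF x0])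
  obtain a where a: "\<And>n::nat. a n \<in> I" "\<And>n. a n < x0" "(\<lambda>n. ereal (a n)) \<longlonglongrightarrow> lo" by (rule seq_lo[OF x0]) blast
  have c: "\<bar>1\<bar> \<le> 1 / p_inf * p q" if "q \<in> I" "q \<le> z" for q
    using p_inf_le[OF that(1)] L by (simp add: field_simps)
  \<comment> \<open>For \<open>g = 0\<close> the constant \<open>\<Gamma> = 1\<close> is allowed,
    and the bound \<open>1 \<le> p / p_inf\<close> is where positivity of \<open>p_inf\<close>
    enters. All payoffs are zero, so \<open>K x0 = 0\<close>, although \<open>K\<close> decreases
    strictly to \<open>K z = 0\<close>.\<close>
  show False
  proof (rule hitting_dynkin_limit[of "\<lambda>_. 1" "\<lambda>_. 0" x0 z a "1 / p_inf"])
  fix K assume K: "\<And>x. x \<in> I \<Longrightarrow> (K has_real_derivative - (sc x * 1 / (\<psi> x)\<^sup>2)) (at x)" "K z = 0"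
    "(\<lambda>n. \<integral>\<omega>. integral {0..exit_time (X x0) (\<lambda>_. \<infinity>) (a n) z (real (Suc n)) \<omega>} (\<lambda>s. exp (- r * s) * 0) \<partial>M) \<longlonglongrightarrow> \<psi> x0 * K x0"
  have "\<psi> x0 * K x0 = 0" using LIMSEQ_unique[OF K(3), of 0] by simp
  then have "K x0 = 0" using \<psi>_pos[OF x0] by simp
  moreover have "K z < K x0"
  proof (rule DERIV_neg_imp_decreasing[OF z(2)])
    fix q assume q: "x0 \<le> q" "q \<le> z"
    then have qI: "q \<in> I" using I_convex[OF x0 z(1)] by blast
    have "- (sc q * 1 / (\<psi> q)\<^sup>2) < 0" using sc_pos[of q] \<psi>_pos[OF qI] by simp
    then show "\<exists>y. (K has_real_derivative y) (at q) \<and> y < 0" using K(1)[OF qI] by blast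
  qed
  ultimately show False using K(2) by simp
  qed (use x0 z a c L in auto)
qed

end

section \<open>Discounted running payoffs\<close>

definition disc_measure :: "real \<Rightarrow> real measure" where
  "disc_measure r = density (restrict_space lborel {0..}) (\<lambda>t. ennreal (exp (- r * t)))"

lemma space_disc_measure: "space (disc_measure r) = {0..}"
  by (simp add: disc_measure_def space_restrict_space)

lemma sigma_finite_disc_measure: "sigma_finite_measure (disc_measure r)"
proof -
  interpret R: sigma_finite_measure "restrict_space lborel {0::real..}"
    by (rule sigma_finite_measure_restrict_space[OF sigma_finite_lborel]) simp
  have "(\<lambda>t. ennreal (exp (- r * t))) \<in> borel_measurable (restrict_space lborel {0..})"
    by (intro measurable_restrict_space1) measurable
  then show ?thesis unfolding disc_measure_def
    using R.sigma_finite_iff_density_finite[of "\<lambda>t. ennreal (exp (- r * t))"] by simp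
qed

lemma integral_disc_measure:
  fixes f :: "real \<Rightarrow> real"
  assumes "f \<in> borel_measurable (restrict_space lborel {0..})"
  shows "(\<integral>t. f t \<partial>disc_measure r) = (\<integral>t. indicator {0..} t * (exp (- r * t) * f t) \<partial>lborel)"
proof -
  have e: "(\<lambda>t. exp (- r * t)) \<in> borel_measurable (restrict_space lborel {0..})"
    by (intro measurable_restrict_space1) measurable
  show ?thesis unfolding disc_measure_def
    by (subst integral_density[OF assms e]) (auto simp: integral_restrict_space)
qed

context filtered_prob_space
begin

lemma stopping_time_measurable:
  assumes "stopping_time_e M F \<tau>" shows "\<tau> \<in> borel_measurable M"
  unfolding borel_measurable_iff_Iic_ereal
proof
  fix a
  have nn: "0 \<le> \<tau> \<omega>" if "\<omega> \<in> space M" for \<omega> using assms that unfolding stopping_time_e_def by blast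
  show "\<tau> -` {..a} \<inter> space M \<in> sets M"
  proof (cases a)
    case (real t)
    show ?thesis
    proof (cases "0 \<le> t")
      case True
      then have "{\<omega>\<in>space M. \<tau> \<omega> \<le> ereal t} \<in> sets M" using assms F_sub unfolding stopping_time_e_def by blast
      moreover have "\<tau> -` {..a} \<inter> space M = {\<omega>\<in>space M. \<tau> \<omega> \<le> ereal t}" using real by auto
      ultimately show ?thesis by simp
    next
      case False
      then have "\<not> \<tau> \<omega> \<le> a" if "\<omega> \<in> space M" for \<omega> using nn[OF that] real by (cases "\<tau> \<omega>") auto
      then have "\<tau> -` {..a} \<inter> space M = {}" by auto
      then show ?thesis by simp
    qed
  next
    case PInf
    then have "\<tau> -` {..a} \<inter> space M = space M" by auto
    then show ?thesis by simp
  next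
    case MInf
    have "\<not> \<tau> \<omega> \<le> a" if "\<omega> \<in> space M" for \<omega> using nn[OF that] MInf by auto
    then have "\<tau> -` {..a} \<inter> space M = {}" by auto
    then show ?thesis by simp
  qed
qed

end

context diffusion_process
begin

definition run :: "(real \<Rightarrow> real) \<Rightarrow> real \<Rightarrow> ('a \<Rightarrow> ereal) \<Rightarrow> 'a \<Rightarrow> real" where
  "run f x \<tau> \<omega> = (LINT s:{s. 0 \<le> s \<and> ereal s < \<tau> \<omega>}|lborel. exp (- r * s) * f (X x s \<omega>))"

text \<open>As one integral over paths and time the expected payoff contains \<open>\<tau>\<close>
  only in an indicator. Integrability for every \<open>\<tau>\<close> then follows from that over
  the full horizon, and payoffs for different stopping times can be compared pointwise.\<close>

lemma run_Fubini:
  fixes f :: "real \<Rightarrow> real"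
  assumes int: "integrable (M \<Otimes>\<^sub>M disc_measure r) (\<lambda>(\<omega>, t). f (X x t \<omega>))"
    and \<tau>: "\<tau> \<in> borel_measurable M"
  shows "integrable (M \<Otimes>\<^sub>M disc_measure r) (\<lambda>(\<omega>, t). indicator {t. ereal t < \<tau> \<omega>} t * f (X x t \<omega>))"
    and "integrable M (run f x \<tau>)"
    and "(\<integral>\<omega>. run f x \<tau> \<omega> \<partial>M) = (\<integral>(\<omega>, t). indicator {t. ereal t < \<tau> \<omega>} t * f (X x t \<omega>) \<partial>(M \<Otimes>\<^sub>M disc_measure r))"
proof -
  let ?N = "disc_measure r"
  interpret N: sigma_finite_measure ?N by (rule sigma_finite_disc_measure)
  interpret P: pair_sigma_finite M ?N by standard
  have [measurable]: "(\<lambda>p. ereal (snd p)) \<in> borel_measurable (M \<Otimes>\<^sub>M ?N)"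
  proof (rule measurable_compose[OF measurable_snd])
    have "(\<lambda>t. ereal t) \<in> borel_measurable (restrict_space lborel {0..})" by (intro measurable_restrict_space1) measurable
    then show "ereal \<in> borel_measurable ?N" by (simp add: disc_measure_def)
  qed
  have [measurable]: "(\<lambda>p. \<tau> (fst p)) \<in> borel_measurable (M \<Otimes>\<^sub>M ?N)"
    by (rule measurable_compose[OF measurable_fst \<tau>])
  define B where "B = {p \<in> space (M \<Otimes>\<^sub>M ?N). ereal (snd p) < \<tau> (fst p)}"
  have B: "B \<in> sets (M \<Otimes>\<^sub>M ?N)" unfolding B_def by measurable
  define g where "g = (\<lambda>(\<omega>, t). indicator {t. ereal t < \<tau> \<omega>} t * f (X x t \<omega>))"
  have gi0: "integrable (M \<Otimes>\<^sub>M ?N) (\<lambda>p. (case p of (\<omega>, t) \<Rightarrow> f (X x t \<omega>)) * indicator B p)"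
    by (rule integrable_real_mult_indicator[OF B int])
  have geq: "(case p of (\<omega>, t) \<Rightarrow> f (X x t \<omega>)) * indicator B p = g p" if "p \<in> space (M \<Otimes>\<^sub>M ?N)" for p
    using that by (auto simp: g_def B_def indicator_def split: prod.split)
  show gi: "integrable (M \<Otimes>\<^sub>M ?N) (\<lambda>(\<omega>, t). indicator {t. ereal t < \<tau> \<omega>} t * f (X x t \<omega>))"
    unfolding g_def[symmetric] by (rule Bochner_Integration.integrable_cong[THEN iffD1, rotated 2, OF gi0 refl geq])
  have gi': "integrable (M \<Otimes>\<^sub>M ?N) g" using gi by (simp add: g_def)
  have eq: "(\<integral>t. g (\<omega>, t) \<partial>?N) = run f x \<tau> \<omega>" if w: "\<omega> \<in> space M" for \<omega>
  proof -
    have "(\<lambda>t. g (\<omega>, t)) \<in> borel_measurable ?N"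
      by (rule measurable_Pair2[OF borel_measurable_integrable[OF gi'] w])
    then have "(\<lambda>t. g (\<omega>, t)) \<in> borel_measurable (restrict_space lborel {0..})" by (simp add: disc_measure_def)
    from integral_disc_measure[OF this] show ?thesis unfolding run_def set_lebesgue_integral_def
      by (simp only:) (intro Bochner_Integration.integral_cong refl, auto simp: g_def indicator_def)
  qed
  show "integrable M (run f x \<tau>)" 
    by (rule Bochner_Integration.integrable_cong[THEN iffD1, rotated 2, OF P.integrable_fst'[OF gi'] refl eq])
  have "(\<integral>\<omega>. run f x \<tau> \<omega> \<partial>M) = (\<integral>\<omega>. (\<integral>t. g (\<omega>, t) \<partial>?N) \<partial>M)"
    by (rule Bochner_Integration.integral_cong) (simp_all add: eq)
  also have "\<dots> = integral\<^sup>L (M \<Otimes>\<^sub>M ?N) g" by (rule P.integral_fst'[OF gi'])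
  finally show "(\<integral>\<omega>. run f x \<tau> \<omega> \<partial>M) = (\<integral>(\<omega>, t). indicator {t. ereal t < \<tau> \<omega>} t * f (X x t \<omega>) \<partial>(M \<Otimes>\<^sub>M ?N))"
    by (simp add: g_def)
qed

lemma run_mono:
  fixes f :: "real \<Rightarrow> real"
  assumes int: "integrable (M \<Otimes>\<^sub>M disc_measure r) (\<lambda>(\<omega>, t). f (X x t \<omega>))"
    and \<tau>: "\<tau>1 \<in> borel_measurable M" "\<tau>2 \<in> borel_measurable M" 
    and le: "\<And>\<omega>. \<omega> \<in> space M \<Longrightarrow> \<tau>1 \<omega> \<le> \<tau>2 \<omega>"
    and x: "x \<in> I" and nn: "\<And>q. q \<in> I \<Longrightarrow> 0 \<le> f q"
  shows "(\<integral>\<omega>. run f x \<tau>1 \<omega> \<partial>M) \<le> (\<integral>\<omega>. run f x \<tau>2 \<omega> \<partial>M)"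
  unfolding run_Fubini(3)[OF int \<tau>(1)] run_Fubini(3)[OF int \<tau>(2)]
proof (rule integral_mono[OF run_Fubini(1)[OF int \<tau>(1)] run_Fubini(1)[OF int \<tau>(2)]])
  fix p assume "p \<in> space (M \<Otimes>\<^sub>M disc_measure r)"
  then obtain \<omega> t where p: "p = (\<omega>, t)" "\<omega> \<in> space M" "0 \<le> t" by (auto simp: space_pair_measure space_disc_measure)
  have "indicator {t. ereal t < \<tau>1 \<omega>} t \<le> (indicator {t. ereal t < \<tau>2 \<omega>} t :: real)"
    using le[OF p(2)] by (auto simp: indicator_def)
  then show "(case p of (\<omega>, t) \<Rightarrow> indicator {t. ereal t < \<tau>1 \<omega>} t * f (X x t \<omega>))
     \<le> (case p of (\<omega>, t) \<Rightarrow> indicator {t. ereal t < \<tau>2 \<omega>} t * f (X x t \<omega>))"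
    using nn[OF X_I[OF x p(2,3)]] unfolding p(1) prod.case by (intro mult_right_mono)
qed

text \<open>\<open>run\<close> is a Lebesgue integral over times before \<open>S\<close>, Dynkin's
  formula has a gauge integral over \<open>{0..S}\<close>; the endpoint is a null set and the
  integrand is continuous along the path.\<close>

lemma run_ereal:
  assumes f: "continuous_on I f" and x: "x \<in> I" and w: "\<omega> \<in> space M" and S: "0 \<le> S \<omega>"
  shows "run f x (\<lambda>\<omega>. ereal (S \<omega>)) \<omega> = integral {0..S \<omega>} (\<lambda>s. exp (- r * s) * f (X x s \<omega>))"
    and "(\<lambda>s. exp (- r * s) * f (X x s \<omega>)) integrable_on {0..S \<omega>}"
proof -
  have c: "continuous_on {0..S \<omega>} (\<lambda>s. exp (- r * s) * f (X x s \<omega>))"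
  proof (rule continuous_on_mult)
    show "continuous_on {0..S \<omega>} (\<lambda>s. f (X x s \<omega>))"
      by (rule continuous_on_compose2[OF f continuous_on_subset[OF X_cont[OF x w]]]) (use X_I[OF x w] in auto)
  qed (intro continuous_intros)
  then show "(\<lambda>s. exp (- r * s) * f (X x s \<omega>)) integrable_on {0..S \<omega>}" by (rule integrable_continuous_real)
  have "run f x (\<lambda>\<omega>. ereal (S \<omega>)) \<omega> = (LINT s:{0..S \<omega>}|lborel. exp (- r * s) * f (X x s \<omega>))"
    unfolding run_def set_lebesgue_integral_def
  proof (rule integral_cong_AE)
    have m: "(\<lambda>s. indicator {0..S \<omega>} s *\<^sub>R (exp (- r * s) * f (X x s \<omega>))) \<in> borel_measurable lborel"
      using borel_measurable_continuous_on_indicator[OF _ c] by simp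
    then show "(\<lambda>s. indicator {0..S \<omega>} s *\<^sub>R (exp (- r * s) * f (X x s \<omega>))) \<in> borel_measurable lborel" .
    have "(\<lambda>s. indicator {..<S \<omega>} s *\<^sub>R (indicator {0..S \<omega>} s *\<^sub>R (exp (- r * s) * f (X x s \<omega>)))) \<in> borel_measurable lborel"
      by (intro borel_measurable_scaleR m) simp
    moreover have "(\<lambda>s. indicator {..<S \<omega>} s *\<^sub>R (indicator {0..S \<omega>} s *\<^sub>R (exp (- r * s) * f (X x s \<omega>))))
      = (\<lambda>s. indicator {s. 0 \<le> s \<and> ereal s < ereal (S \<omega>)} s *\<^sub>R (exp (- r * s) * f (X x s \<omega>)))"
      by (auto simp: indicator_def fun_eq_iff)
    ultimately show "(\<lambda>s. indicator {s. 0 \<le> s \<and> ereal s < ereal (S \<omega>)} s *\<^sub>R (exp (- r * s) * f (X x s \<omega>))) \<in> borel_measurable lborel"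
      by simp
    show "AE s in lborel. indicator {s. 0 \<le> s \<and> ereal s < ereal (S \<omega>)} s *\<^sub>R (exp (- r * s) * f (X x s \<omega>)) =
      indicator {0..S \<omega>} s *\<^sub>R (exp (- r * s) * f (X x s \<omega>))"
      using AE_lborel_singleton[of "S \<omega>"] by eventually_elim (auto simp: indicator_def)
  qed
  then show "run f x (\<lambda>\<omega>. ereal (S \<omega>)) \<omega> = integral {0..S \<omega>} (\<lambda>s. exp (- r * s) * f (X x s \<omega>))"
    using set_integral_eq_integral_continuous[OF c] by simp
qed

text \<open>For \<open>c = r\<close> the right side is \<open>run + exp (- r * S) - 1\<close>:
  subtracting \<open>r\<close> from the payoff accounts for the terminal discount.\<close>

lemma run_ereal_minus:
  assumes f: "continuous_on I f" and x: "x \<in> I" and w: "\<omega> \<in> space M" and S: "0 \<le> S \<omega>"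
  shows "integral {0..S \<omega>} (\<lambda>s. exp (- r * s) * (f (X x s \<omega>) - c)) = 
     run f x (\<lambda>\<omega>. ereal (S \<omega>)) \<omega> - c / r * (1 - exp (- r * S \<omega>))"
proof -
  have i: "(\<lambda>s. exp (- r * s) * c) integrable_on {0..S \<omega>}"
    by (intro integrable_continuous_real continuous_intros)
  have "integral {0..S \<omega>} (\<lambda>s. exp (- r * s) * (f (X x s \<omega>) - c)) = 
    integral {0..S \<omega>} (\<lambda>s. exp (- r * s) * f (X x s \<omega>) - exp (- r * s) * c)" by (simp add: right_diff_distrib)
  also have "\<dots> = integral {0..S \<omega>} (\<lambda>s. exp (- r * s) * f (X x s \<omega>)) - integral {0..S \<omega>} (\<lambda>s. exp (- r * s) * c)"
    by (rule Henstock_Kurzweil_Integration.integral_diff[OF run_ereal(2)[where S = S, OF f x w S] i])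
  finally show ?thesis using run_ereal(1)[where S = S, OF f x w S] integral_discount[OF r_pos S] by simp
qed

section \<open>The sign of the weighted payoff decides whether to stop at once\<close>

lemma H_const': "z \<in> I \<Longrightarrow> H (\<lambda>_. c) z = c / r * p z"
  using H_const p_inf_eq_0 by simp

text \<open>Single crossing. If \<open>g x\<close> were negative, \<open>g\<close> would be negative
  on all of \<open>I\<close> below \<open>x\<close>, and so would be \<open>H g x\<close>. Hence
  \<open>g\<close> is nonnegative from \<open>x\<close> on, and \<open>H g\<close> increases
  there.\<close>

lemma H_nonneg_after:
  assumes g: "adm g" "mono_on I g" and x: "x \<in> I" "0 \<le> H g x" and q: "q \<in> I" "x \<le> q"
  shows "0 \<le> H g q"
proof -
  have gx: "0 \<le> g x"
  proof (rule ccontr)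
    assume "\<not> 0 \<le> g x"
    then have "H g x < H (\<lambda>_. 0) x" using mono_onD[OF g(2) _ x(1)] by (intro H_less g adm_const x(1)) force+
    then show False using x(2) H_const'[OF x(1), of 0] by simp
  qed
  have "H g x \<le> H g q"
  proof (rule DERIV_nonneg_imp_nondecreasing[OF q(2)])
    fix y assume y: "x \<le> y" "y \<le> q"
    then have yI: "y \<in> I" using I_convex[OF x(1) q(1)] by blast
    have "0 \<le> g y" using gx mono_onD[OF g(2) x(1) yI y(1)] by simp
    then have "0 \<le> g y * \<psi> y * sp y" using \<psi>_pos[OF yI] sp_pos[OF yI] by simp
    then show "\<exists>z. (H g has_real_derivative z) (at y) \<and> 0 \<le> z" using H_deriv[OF g(1) yI] by blast
  qed
  then show ?thesis using x(2) by simp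
qed

text \<open>The compensated payoff \<open>f - r - \<delta>\<close>, with \<open>\<delta>\<close> chosen such that its weighted integral vanishes
  exactly at the starting point, turns \<open>\<psi> K\<close> into a smooth supersolution; no smooth fit is needed.\<close>
lemma value_ge_1:
  assumes x: "x \<in> I" and f: "continuous_on I f" "mono_on I f" "\<And>q. q \<in> I \<Longrightarrow> 0 \<le> f q"
    and int: "integrable (M \<Otimes>\<^sub>M disc_measure r) (\<lambda>(\<omega>, t). f (X x t \<omega>))"
    and Hx: "p x \<le> H f x" and \<tau>: "stopping_time_e M F \<tau>"
  shows "1 \<le> (\<integral>\<omega>. run f x \<tau> \<omega> + disc r (\<tau> \<omega>) \<partial>M)"
proof -
  \<comment> \<open>The solution of \<open>H f x - (r + \<delta>) / r * p x = 0\<close>; the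
    hypothesis \<open>p x \<le> H f x\<close> says that it is nonnegative.\<close>
  define \<delta> where "\<delta> = (H f x - p x) * r / p x"
  define c where "c = r + \<delta>"
  have \<delta>0: "0 \<le> \<delta>" using Hx p_pos[OF x] r_pos by (simp add: \<delta>_def)
  define g where "g q = f q - c" for q
  have f_adm: "adm f" by (rule adm_nonneg_mono[OF f])
  have g_adm: "adm g" unfolding g_def[abs_def] by (rule adm_diff[OF f_adm adm_const])
  have g_mono: "g a \<le> g b" if "a \<in> I" "b \<in> I" "a \<le> b" for a b
    using mono_onD[OF f(2) that] by (simp add: g_def)
  define \<Gamma> where "\<Gamma> = H g"
  have \<Gamma>x: "\<Gamma> x = 0" unfolding \<Gamma>_def g_def[abs_def] H_diff[OF f_adm adm_const x] H_const'[OF x] c_def \<delta>_def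
    using r_pos p_pos[OF x] by (simp add: field_simps)
  have \<Gamma>': "(\<Gamma> has_real_derivative g q * \<psi> q * sp q) (at q)" if "q \<in> I" for q
    unfolding \<Gamma>_def by (rule H_deriv[OF g_adm that])
  have w0: "0 \<le> g q * \<psi> q * sp q" if "q \<in> I" "0 \<le> g q" for q
    using that \<psi>_pos[OF that(1)] sp_pos[OF that(1)] by simp
  have \<Gamma>_ge: "0 \<le> \<Gamma> q" if "q \<in> I" "x \<le> q" for q
    using H_nonneg_after[OF g_adm mono_onI[OF g_mono] x _ that] \<Gamma>x by (simp add: \<Gamma>_def)
  \<comment> \<open>If \<open>g q\<close> is nonnegative, \<open>\<Gamma>\<close> grows from
    \<open>q\<close> to its zero at \<open>x\<close>; otherwise \<open>g\<close> is negative
    everywhere below \<open>q\<close>.\<close>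
  have \<Gamma>_le: "\<Gamma> q \<le> 0" if q: "q \<in> I" "q \<le> x" for q
  proof (cases "0 \<le> g q")
    case True
    have "\<Gamma> q \<le> \<Gamma> x"
    proof (rule DERIV_nonneg_imp_nondecreasing[OF q(2)])
      fix y assume y: "q \<le> y" "y \<le> x"
      then have yI: "y \<in> I" using I_convex[OF q(1) x] by blast
      show "\<exists>z. (\<Gamma> has_real_derivative z) (at y) \<and> 0 \<le> z"
        using \<Gamma>'[OF yI] w0[OF yI] True g_mono[OF q(1) yI y(1)] by (intro exI conjI) auto
    qed
    then show ?thesis using \<Gamma>x by simp
  next
    case False
    then have "H g q \<le> H (\<lambda>_. 0) q" using g_mono q by (intro H_le g_adm adm_const) force+
    then show ?thesis using H_const'[OF q(1), of 0] by (simp add: \<Gamma>_def)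
  qed
  obtain a where a: "\<And>n::nat. a n \<in> I" "\<And>n. a n < x" "(\<lambda>n. ereal (a n)) \<longlonglongrightarrow> lo" by (rule seq_lo[OF x]) blast
  obtain b where b: "\<And>n::nat. b n \<in> I" "\<And>n. x < b n" "(\<lambda>n. ereal (b n)) \<longlonglongrightarrow> hi" by (rule seq_hi[OF x]) blast
  define S where "S n = exit_time (X x) \<tau> (a n) (b n) (real (Suc n))" for n
  have Tn: "0 < real (Suc n)" for n by simp
  have P: "0 \<le> S n \<omega>" "S n \<omega> \<le> real (Suc n)" "ereal (S n \<omega>) \<le> \<tau> \<omega>"
     "S n \<omega> = real (Suc n) \<or> X x (S n \<omega>) \<omega> \<notin> {a n<..<b n} \<or> \<tau> \<omega> \<le> ereal (S n \<omega>)" if "\<omega> \<in> space M" for n \<omega>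
    unfolding S_def by (fact exit_time_facts(1,2,3,5)[OF x a(2) b(2) Tn \<tau> that])+
  have S_meas: "S n \<in> borel_measurable M" for n
    unfolding S_def by (rule exit_time_measurable(1)[OF x a(2) b(2) Tn \<tau>])
  have \<tau>_meas: "\<tau> \<in> borel_measurable M" by (rule stopping_time_measurable[OF \<tau>])
  have \<tau>0: "0 \<le> \<tau> \<omega>" if "\<omega> \<in> space M" for \<omega> using \<tau> that unfolding stopping_time_e_def by blast
  define Q where "Q n \<omega> = integral {0..S n \<omega>} (\<lambda>s. exp (- r * s) * g (X x s \<omega>))" for n \<omega>
  have Q: "integrable M (Q n) \<and> 0 \<le> (\<integral>\<omega>. Q n \<omega> \<partial>M)" for n
  proof (rule inhomogeneous_dynkin[OF \<Gamma>' adm_cont[OF g_adm] x])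
    fix K assume K: "\<And>x. x \<in> I \<Longrightarrow> (K has_real_derivative - (sc x * \<Gamma> x / (\<psi> x)\<^sup>2)) (at x)" "K x = 0"
    "\<And>x a b T \<tau>. a \<in> I \<Longrightarrow> b \<in> I \<Longrightarrow> a < x \<Longrightarrow> x < b \<Longrightarrow> 0 < T \<Longrightarrow> stopping_time_e M F \<tau> \<Longrightarrow>
      integrable M (\<lambda>\<omega>. integral {0..exit_time (X x) \<tau> a b T \<omega>} (\<lambda>s. exp (- r * s) * g (X x s \<omega>))) \<and>
      (\<integral>\<omega>. integral {0..exit_time (X x) \<tau> a b T \<omega>} (\<lambda>s. exp (- r * s) * g (X x s \<omega>)) \<partial>M) =
      \<psi> x * K x - (\<integral>\<omega>. exp (- r * exit_time (X x) \<tau> a b T \<omega>) * 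
         (\<psi> (X x (exit_time (X x) \<tau> a b T \<omega>) \<omega>) * K (X x (exit_time (X x) \<tau> a b T \<omega>) \<omega>)) \<partial>M)"
    note D = K(3)[OF a(1) b(1) a(2) b(2) Tn \<tau>, of n n n, folded S_def, folded Q_def]
    \<comment> \<open>The slope of \<open>K\<close> has the sign opposite to that of
      \<open>\<Gamma>\<close>, so \<open>K\<close> rises up to \<open>x\<close> and falls
      afterwards, with maximum \<open>K x = 0\<close>.\<close>
    have K0: "K q \<le> 0" if q: "q \<in> I" for q
    proof (cases "q \<le> x")
      case True
      have "K q \<le> K x"
      proof (rule DERIV_nonneg_imp_nondecreasing[OF True])
        fix y assume y: "q \<le> y" "y \<le> x"
        then have yI: "y \<in> I" using I_convex[OF q(1) x] by blast
        have "sc y * \<Gamma> y / (\<psi> y)\<^sup>2 \<le> 0" using \<Gamma>_le[OF yI y(2)] sc_pos[of y] \<psi>_pos[OF yI] 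
          by (simp add: mult_nonneg_nonpos divide_nonpos_pos)
        then show "\<exists>z. (K has_real_derivative z) (at y) \<and> 0 \<le> z" using K(1)[OF yI] by (intro exI conjI) auto
      qed
      then show ?thesis using K(2) by simp
    next
      case False
      then have xq: "x \<le> q" by simp
      have "K q \<le> K x"
      proof (rule DERIV_nonpos_imp_nonincreasing[OF xq])
        fix y assume y: "x \<le> y" "y \<le> q"
        then have yI: "y \<in> I" using I_convex[OF x q(1)] by blast
        have "0 \<le> sc y * \<Gamma> y / (\<psi> y)\<^sup>2" using \<Gamma>_ge[OF yI y(1)] sc_pos[of y] \<psi>_pos[OF yI] by simp
        then show "\<exists>z. (K has_real_derivative z) (at y) \<and> z \<le> 0" using K(1)[OF yI] by (intro exI conjI) auto
      qed
      then show ?thesis using K(2) by simp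
    qed
    let ?h = "\<lambda>\<omega>. exp (- r * S n \<omega>) * (\<psi> (X x (S n \<omega>) \<omega>) * K (X x (S n \<omega>) \<omega>))"
    have "0 \<le> (\<integral>\<omega>. - ?h \<omega> \<partial>M)"
    proof (rule integral_nonneg_AE, rule AE_I2)
      fix \<omega> assume w: "\<omega> \<in> space M"
      have XI: "X x (S n \<omega>) \<omega> \<in> I" by (rule X_I[OF x w P(1)[OF w]])
      show "0 \<le> - ?h \<omega>" using K0[OF XI] \<psi>_pos[OF XI] by (simp add: mult_nonneg_nonpos)
    qed
    then have "0 \<le> - (\<integral>\<omega>. ?h \<omega> \<partial>M)" by simp
    then show ?thesis using D K(2) by simp
  qed
  have run_i: "integrable M (run f x (\<lambda>\<omega>. ereal (S n \<omega>)))" for n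
    using run_Fubini(2)[OF int, of "\<lambda>\<omega>. ereal (S n \<omega>)"] S_meas by simp
  have e_i: "integrable M (\<lambda>\<omega>. exp (- r * S n \<omega>))" for n
  proof (rule integrable_const_bound[where B = 1])
    show "AE \<omega> in M. norm (exp (- r * S n \<omega>)) \<le> 1" using P(1) r_pos by (intro AE_I2) simp
  qed (use S_meas in measurable)
  have low: "1 \<le> (\<integral>\<omega>. run f x \<tau> \<omega> \<partial>M) + (\<integral>\<omega>. exp (- r * S n \<omega>) \<partial>M)" for n
  proof -
    have "(\<integral>\<omega>. 1 + Q n \<omega> \<partial>M) \<le> (\<integral>\<omega>. run f x (\<lambda>\<omega>. ereal (S n \<omega>)) \<omega> + exp (- r * S n \<omega>) \<partial>M)"
    proof (rule integral_mono)
      show "integrable M (\<lambda>\<omega>. 1 + Q n \<omega>)" using Q by simp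
      show "integrable M (\<lambda>\<omega>. run f x (\<lambda>\<omega>. ereal (S n \<omega>)) \<omega> + exp (- r * S n \<omega>))" using run_i e_i by simp
      fix \<omega> assume w: "\<omega> \<in> space M"
      have "Q n \<omega> = run f x (\<lambda>\<omega>. ereal (S n \<omega>)) \<omega> - c / r * (1 - exp (- r * S n \<omega>))"
        unfolding Q_def g_def by (rule run_ereal_minus[where S = "S n", OF f(1) x w P(1)[OF w]])
      \<comment> \<open>Passing from \<open>c\<close> back to \<open>r\<close> goes in the right
        direction, because \<open>c / r \<ge> 1\<close>.\<close>
      moreover have "1 * (1 - exp (- r * S n \<omega>)) \<le> c / r * (1 - exp (- r * S n \<omega>))"
        using \<delta>0 r_pos P(1)[OF w, of n] by (intro mult_right_mono) (auto simp: c_def)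
      ultimately show "1 + Q n \<omega> \<le> run f x (\<lambda>\<omega>. ereal (S n \<omega>)) \<omega> + exp (- r * S n \<omega>)" by simp
    qed
    moreover have "(\<integral>\<omega>. 1 + Q n \<omega> \<partial>M) = 1 + (\<integral>\<omega>. Q n \<omega> \<partial>M)" using Q by (simp add: prob_space)
    moreover have "(\<integral>\<omega>. run f x (\<lambda>\<omega>. ereal (S n \<omega>)) \<omega> + exp (- r * S n \<omega>) \<partial>M) = (\<integral>\<omega>. run f x (\<lambda>\<omega>. ereal (S n \<omega>)) \<omega> \<partial>M) + (\<integral>\<omega>. exp (- r * S n \<omega>) \<partial>M)"
      using run_i e_i by simp
    \<comment> \<open>As \<open>f\<close> is nonnegative, the payoff up to \<open>S n\<close> is at
      most that up to \<open>\<tau>\<close>; this leaves the discount as the only term that requires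
      a limit.\<close>
    moreover have "(\<integral>\<omega>. run f x (\<lambda>\<omega>. ereal (S n \<omega>)) \<omega> \<partial>M) \<le> (\<integral>\<omega>. run f x \<tau> \<omega> \<partial>M)"
      by (rule run_mono[OF int _ \<tau>_meas P(3) x f(3)]) (use S_meas in simp)
    ultimately show ?thesis using Q[of n] by linarith
  qed
  have disc_bd: "0 \<le> disc r t \<and> disc r t \<le> 1" if "0 \<le> t" for t
    using that r_pos by (cases t) (auto simp: disc_def)
  have disc_m: "(\<lambda>\<omega>. disc r (\<tau> \<omega>)) \<in> borel_measurable M"
    unfolding disc_def using \<tau>_meas by measurable
  have disc_i: "integrable M (\<lambda>\<omega>. disc r (\<tau> \<omega>))"
  proof (rule integrable_const_bound[where B = 1])
    show "AE \<omega> in M. norm (disc r (\<tau> \<omega>)) \<le> 1" using disc_bd \<tau>0 by (intro AE_I2) simp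
  qed (rule disc_m)
  \<comment> \<open>Once levels and deadline are out of reach, only \<open>\<tau>\<close> can stop
    the path before \<open>T\<close>. So \<open>S n\<close> is eventually equal to a finite
    \<open>\<tau>\<close>, and tends to infinity if \<open>\<tau>\<close> is infinite.\<close>
  have reach: "\<forall>\<^sub>F n in sequentially. T \<le> S n \<omega>" if w: "\<omega> \<in> space M" and T: "0 \<le> T" "ereal T \<le> \<tau> \<omega>" for \<omega> T
  proof -
    have "\<forall>\<^sub>F n in sequentially. T < real (Suc n)"
      using filterlim_at_top_dense[THEN iffD1, OF filterlim_compose[OF filterlim_real_sequentially filterlim_Suc]] by blast
    with path_eventually[OF x w a(3) b(3) T(1)] show ?thesis
    proof eventually_elim
      case (elim n)
      show ?case
      proof (rule ccontr)
        assume "\<not> T \<le> S n \<omega>"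
        then have lt: "S n \<omega> < T" by simp
        then have "S n \<omega> \<in> {0..T}" "S n \<omega> \<noteq> real (Suc n)" using P(1)[OF w, of n] elim(2) by auto
        then have "\<tau> \<omega> \<le> ereal (S n \<omega>)" using P(4)[OF w, of n] elim(1) by auto
        then have "ereal T \<le> ereal (S n \<omega>)" using T(2) by (rule order_trans[rotated])
        then show False using lt by simp
      qed
    qed
  qed
  have "(\<lambda>n. \<integral>\<omega>. exp (- r * S n \<omega>) \<partial>M) \<longlonglongrightarrow> (\<integral>\<omega>. disc r (\<tau> \<omega>) \<partial>M)"
  proof (rule integral_dominated_convergence[where w = "\<lambda>_. 1"])
    show "AE \<omega> in M. norm (exp (- r * S n \<omega>)) \<le> 1" for n using P(1) r_pos by (intro AE_I2) simp
    show "AE \<omega> in M. (\<lambda>n. exp (- r * S n \<omega>)) \<longlonglongrightarrow> disc r (\<tau> \<omega>)"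
    proof (rule AE_I2)
      fix \<omega> assume w: "\<omega> \<in> space M"
      show "(\<lambda>n. exp (- r * S n \<omega>)) \<longlonglongrightarrow> disc r (\<tau> \<omega>)"
      proof (cases "\<tau> \<omega>")
        case (real t)
        then have "0 \<le> t" using \<tau>0[OF w] by simp
        then have "\<forall>\<^sub>F n in sequentially. t \<le> S n \<omega>" using reach[OF w] real by simp
        then have "\<forall>\<^sub>F n in sequentially. exp (- r * S n \<omega>) = disc r (\<tau> \<omega>)"
        proof eventually_elim
          case (elim n)
          then have "S n \<omega> = t" using P(3)[OF w, of n] real by simp
          then show ?case using real by (simp add: disc_ereal)
        qed
        then show ?thesis by (rule tendsto_eventually)
      next
        case PInf
        have "filterlim (\<lambda>n. S n \<omega>) at_top sequentially"
          unfolding filterlim_at_top_ge[of _ _ 0] using reach[OF w] PInf by simp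
        moreover have "((\<lambda>t. exp (- r * t)) \<longlongrightarrow> 0) at_top" using r_pos by real_asymp
        ultimately have "(\<lambda>n. exp (- r * S n \<omega>)) \<longlonglongrightarrow> 0" by (rule filterlim_compose[rotated])
        then show ?thesis using PInf by (simp add: disc_def)
      next
        case MInf then show ?thesis using \<tau>0[OF w] by simp
      qed
    qed
  qed (use S_meas disc_m in auto)
  then have "(\<lambda>n. (\<integral>\<omega>. run f x \<tau> \<omega> \<partial>M) + (\<integral>\<omega>. exp (- r * S n \<omega>) \<partial>M)) \<longlonglongrightarrow> (\<integral>\<omega>. run f x \<tau> \<omega> \<partial>M) + (\<integral>\<omega>. disc r (\<tau> \<omega>) \<partial>M)"
    by (intro tendsto_add tendsto_const)
  then have "1 \<le> (\<integral>\<omega>. run f x \<tau> \<omega> \<partial>M) + (\<integral>\<omega>. disc r (\<tau> \<omega>) \<partial>M)"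
    by (rule LIMSEQ_le_const) (use low in auto)
  then show ?thesis using run_Fubini(2)[OF int \<tau>_meas] disc_i by simp
qed

text \<open>A negative \<open>\<Gamma> x\<close> stays negative on some \<open>{x..z}\<close>, where
  \<open>K\<close> then increases to \<open>K z = 0\<close>. Hence running up to \<open>z\<close>
  changes the cost by \<open>\<psi> x * K x < 0\<close> in the limit, and a bounded exit time close
  to the limit is already profitable.\<close>

lemma value_less_1:
  assumes x: "x \<in> I" and f: "continuous_on I f" "mono_on I f" "\<And>q. q \<in> I \<Longrightarrow> 0 \<le> f q"
    and Hx: "H f x < p x"
  obtains \<tau> where "stopping_time_e M F \<tau>" "(\<integral>\<omega>. run f x \<tau> \<omega> + disc r (\<tau> \<omega>) \<partial>M) < 1"
proof -
  define g where "g q = f q - r" for q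
  have f_adm: "adm f" by (rule adm_nonneg_mono[OF f])
  have g_adm: "adm g" unfolding g_def[abs_def] by (rule adm_diff[OF f_adm adm_const])
  define \<Gamma> where "\<Gamma> = H g"
  have \<Gamma>_eq: "\<Gamma> q = H f q - p q" if "q \<in> I" for q 
    unfolding \<Gamma>_def g_def[abs_def] H_diff[OF f_adm adm_const that] H_const'[OF that] using r_pos by simp
  have \<Gamma>': "(\<Gamma> has_real_derivative g q * \<psi> q * sp q) (at q)" if "q \<in> I" for q
    unfolding \<Gamma>_def by (rule H_deriv[OF g_adm that])
  have "isCont \<Gamma> x" using \<Gamma>'[OF x] by (rule DERIV_isCont)
  then have "\<forall>\<^sub>F q in at x. \<Gamma> q < 0"
    unfolding isCont_def by (rule order_tendstoD(2)) (use \<Gamma>_eq[OF x] Hx in simp)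
  then obtain d where d: "0 < d" "\<And>q. q \<noteq> x \<Longrightarrow> \<bar>q - x\<bar> < d \<Longrightarrow> \<Gamma> q < 0"
    unfolding eventually_at dist_real_def by blast
  obtain z0 where z0: "z0 \<in> I" "x < z0" by (rule I_greater[OF x])
  define z where "z = min z0 (x + d / 2)"
  have xz: "x < z" using z0 d by (simp add: z_def)
  have z: "z \<in> I" using I_convex[OF x z0(1), of z] xz by (simp add: z_def)
  have neg: "\<Gamma> q < 0" if "x \<le> q" "q \<le> z" for q
    using d(2)[of q] \<Gamma>_eq[OF x] Hx that d(1) by (cases "q = x") (auto simp: z_def)
  \<comment> \<open>Left of \<open>z\<close> the modulus of \<open>g\<close> is at most
    \<open>f z + r\<close>, by monotonicity and \<open>f \<ge> 0\<close>; integrating this constant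
    against the weight produces the factor \<open>p / r\<close>.\<close>
  define c where "c = (f z + r) / r"
  have fz: "0 \<le> f z" using f(3)[OF z] .
  have c0: "0 \<le> c" using fz r_pos by (simp add: c_def)
  have cb: "\<bar>\<Gamma> q\<bar> \<le> c * p q" if q: "q \<in> I" "q \<le> z" for q
  proof -
    have "g y \<le> f z + r" "- (f z + r) \<le> g y" if "y \<in> I" "y \<le> q" for y
      using mono_onD[OF f(2) that(1) z] that q f(3)[OF that(1)] fz r_pos by (auto simp: g_def)
    then have "H g q \<le> H (\<lambda>_. f z + r) q" "H (\<lambda>_. - (f z + r)) q \<le> H g q"
      using q by (auto intro!: H_le g_adm adm_const)
    moreover have "- (f z + r) / r * p q = - ((f z + r) / r * p q)" by (simp only: minus_divide_left[symmetric] mult_minus_left)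
    ultimately show ?thesis unfolding H_const'[OF q(1)] \<Gamma>_def c_def by linarith
  qed
  obtain a where a: "\<And>n::nat. a n \<in> I" "\<And>n. a n < x" "(\<lambda>n. ereal (a n)) \<longlonglongrightarrow> lo" by (rule seq_lo[OF x]) blast
  define S where "S n = exit_time (X x) (\<lambda>_. \<infinity>) (a n) z (real (Suc n))" for n
  define Q where "Q n \<omega> = integral {0..S n \<omega>} (\<lambda>s. exp (- r * s) * g (X x s \<omega>))" for n \<omega>
  have "\<exists>n. integrable M (Q n) \<and> (\<integral>\<omega>. Q n \<omega> \<partial>M) < 0"
  proof (rule hitting_dynkin_limit[OF \<Gamma>' adm_cont[OF g_adm] x z xz a c0 cb])
    fix K assume K: "\<And>x. x \<in> I \<Longrightarrow> (K has_real_derivative - (sc x * \<Gamma> x / (\<psi> x)\<^sup>2)) (at x)" "K z = 0"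
      "\<And>n. integrable M (\<lambda>\<omega>. integral {0..exit_time (X x) (\<lambda>_. \<infinity>) (a n) z (real (Suc n)) \<omega>} (\<lambda>s. exp (- r * s) * g (X x s \<omega>)))"
      "(\<lambda>n. \<integral>\<omega>. integral {0..exit_time (X x) (\<lambda>_. \<infinity>) (a n) z (real (Suc n)) \<omega>} (\<lambda>s. exp (- r * s) * g (X x s \<omega>)) \<partial>M) \<longlonglongrightarrow> \<psi> x * K x"
    have "K x < K z"
    proof (rule DERIV_pos_imp_increasing[OF xz])
      fix q assume q: "x \<le> q" "q \<le> z"
      then have qI: "q \<in> I" using I_convex[OF x z] by blast
      have "sc q * \<Gamma> q / (\<psi> q)\<^sup>2 < 0" using neg[OF q] sc_pos[of q] \<psi>_pos[OF qI] 
        by (intro divide_neg_pos mult_pos_neg) auto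
      then show "\<exists>y. (K has_real_derivative y) (at q) \<and> 0 < y" using K(1)[OF qI] by (intro exI conjI) auto
    qed
    then have "\<psi> x * K x < 0" using K(2) \<psi>_pos[OF x] by (simp add: mult_pos_neg)
    from order_tendstoD(2)[OF K(4) this] obtain n where "(\<integral>\<omega>. Q n \<omega> \<partial>M) < 0"
      unfolding Q_def S_def eventually_sequentially by blast
    moreover have "integrable M (Q n)" using K(3)[of n] unfolding Q_def[abs_def] S_def .
    ultimately show ?thesis by blast
  qed
  then obtain n where n: "integrable M (Q n)" "(\<integral>\<omega>. Q n \<omega> \<partial>M) < 0" by blast
  have Tn: "0 < real (Suc n)" by simp
  have S0: "0 \<le> S n \<omega>" if "\<omega> \<in> space M" for \<omega>
    unfolding S_def by (rule exit_time_facts(1)[OF x a(2) xz Tn never_stopping that])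
  show thesis
  proof (rule that[of "\<lambda>\<omega>. ereal (S n \<omega>)"])
    show "stopping_time_e M F (\<lambda>\<omega>. ereal (S n \<omega>))"
      unfolding stopping_time_e_def using S0 exit_time_stopping_time[OF x a(2) xz Tn never_stopping] 
      by (auto simp: S_def)
    have "run f x (\<lambda>\<omega>. ereal (S n \<omega>)) \<omega> + disc r (ereal (S n \<omega>)) = 1 + Q n \<omega>" if w: "\<omega> \<in> space M" for \<omega>
      unfolding Q_def g_def using run_ereal_minus[where S = "S n" and c = r, OF f(1) x w S0[OF w]] r_pos by (simp add: disc_ereal)
    then have "(\<integral>\<omega>. run f x (\<lambda>\<omega>. ereal (S n \<omega>)) \<omega> + disc r (ereal (S n \<omega>)) \<partial>M) = (\<integral>\<omega>. 1 + Q n \<omega> \<partial>M)"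
      by (rule Bochner_Integration.integral_cong[OF refl])
    also have "\<dots> = 1 + (\<integral>\<omega>. Q n \<omega> \<partial>M)" using n(1) by (simp add: prob_space)
    finally show "(\<integral>\<omega>. run f x (\<lambda>\<omega>. ereal (S n \<omega>)) \<omega> + disc r (ereal (S n \<omega>)) \<partial>M) < 1" using n(2) by simp
  qed
qed

end

section \<open>The free boundary and the integral equation\<close>

text \<open>The tangents at \<open>a\<close> and \<open>b\<close>, evaluated at the midpoint and
  compared with strict midpoint concavity, give \<open>(f' a - f' b) * (b - a) / 2 > 0\<close>. The
  tangent inequality itself comes from the convexity of \<open>- f\<close>.\<close>

lemma strictly_concave_deriv_strict_antimono:
  fixes f f' :: "real \<Rightarrow> real"
  assumes conc: "strictly_concave_on {0<..} f" 
    and d: "\<And>c. 0 < c \<Longrightarrow> (f has_real_derivative f' c) (at c)" and ab: "0 < a" "a < b"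
  shows "f' b < f' a"
proof -
  have conv: "convex_on {0<..} (\<lambda>x. - f x)"
  proof (rule convex_onI)
    fix t x y :: real assume A: "0 < t" "t < 1" "x \<in> {0<..}" "y \<in> {0<..}"
    show "- f ((1 - t) *\<^sub>R x + t *\<^sub>R y) \<le> (1 - t) * - f x + t * - f y"
    proof (cases "x = y")
      case True then show ?thesis by (simp add: algebra_simps)
    next
      case False
      have "f ((1 - t) * x + (1 - (1 - t)) * y) > (1 - t) * f x + (1 - (1 - t)) * f y"
        using conc[unfolded strictly_concave_on_def, rule_format, of x y "1 - t"] A False by simp
      then show ?thesis by simp
    qed
  qed simp
  have tangent: "f y \<le> f x + f' x * (y - x)" if "0 < x" "0 < y" for x y
  proof -
    have "((\<lambda>x. - f x) has_real_derivative - f' x) (at x within {0<..})"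
      by (rule DERIV_minus[OF has_field_derivative_at_within[OF d[OF that(1)]]])
    then have "- f y - - f x \<ge> - f' x * (y - x)"
      by (intro convex_on_imp_above_tangent[OF conv]) (use that in \<open>auto simp: interior_open connected_Ioi\<close>)
    then show ?thesis by simp
  qed
  define m where "m = (a + b) / 2"
  have "f (1 / 2 * a + (1 - 1 / 2) * b) > 1 / 2 * f a + (1 - 1 / 2) * f b"
    using conc[unfolded strictly_concave_on_def, rule_format, of a b "1 / 2"] ab by simp
  moreover have "1 / 2 * a + (1 - 1 / 2) * b = m" by (simp add: m_def field_simps)
  ultimately have "f a + f b < 2 * f m" by simp
  moreover have "0 < m" using ab by (simp add: m_def)
  then have "f m \<le> f a + f' a * (m - a)" "f m \<le> f b + f' b * (m - b)" using tangent[of a m] tangent[of b m] ab by simp_all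
  moreover have "f' a * (m - a) + f' b * (m - b) = (f' a - f' b) * ((b - a) / 2)" by (simp add: m_def field_simps)
  ultimately have "0 < (f' a - f' b) * ((b - a) / 2)" by linarith
  then show ?thesis using ab by (simp add: zero_less_mult_iff)
qed

locale control_problem = diffusion_process M F lo hi \<mu> \<sigma> \<psi> \<psi>1 \<psi>2 r x0 W X
  for M :: "'a measure" and F lo hi \<mu> \<sigma> \<psi> \<psi>1 \<psi>2 r x0 W X +
  fixes pic :: "real \<Rightarrow> real \<Rightarrow> real" and \<kappa> :: real
  assumes pic_cont: "continuous_on (einterval lo hi \<times> {0<..}) (\<lambda>(x, c). pic x c)"
    and pic_less: "x \<in> einterval lo hi \<Longrightarrow> 0 < c \<Longrightarrow> c < d \<Longrightarrow> pic x d < pic x c"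
    and pic_0: "x \<in> einterval lo hi \<Longrightarrow> filterlim (pic x) at_top (at_right 0)"
    and pic_inf: "x \<in> einterval lo hi \<Longrightarrow> (pic x \<longlongrightarrow> \<kappa>) at_top"
    and \<kappa>: "0 \<le> \<kappa>" "\<kappa> < r"
    and pic_int: "x \<in> einterval lo hi \<Longrightarrow> 0 < y \<Longrightarrow> integrable (M \<Otimes>\<^sub>M disc_measure r) (\<lambda>(\<omega>, t). pic (X x t \<omega>) y)"
    and pic_mono: "0 < c \<Longrightarrow> mono_on (einterval lo hi) (\<lambda>x. pic x c)"
begin

lemma pic_le: "x \<in> I \<Longrightarrow> 0 < c \<Longrightarrow> c \<le> d \<Longrightarrow> pic x d \<le> pic x c"
  using pic_less[of x c d] by (cases "c = d") auto

text \<open>The limit \<open>\<kappa>\<close> is a lower bound; the detour over \<open>c + 1\<close>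
  makes it strict, which matters when \<open>\<kappa> = 0\<close>.\<close>

lemma pic_pos: assumes "x \<in> I" "0 < c" shows "0 < pic x c"
proof -
  have "\<kappa> \<le> pic x (c + 1)"
  proof (rule tendsto_upperbound[OF pic_inf[OF assms(1)]])
    show "\<forall>\<^sub>F d in at_top. pic x d \<le> pic x (c + 1)"
      using eventually_ge_at_top[of "c + 1"] by eventually_elim (use pic_le assms in auto)
  qed simp
  moreover have "pic x (c + 1) < pic x c" using pic_less[of x c "c + 1"] assms by simp
  ultimately show ?thesis using \<kappa> by linarith
qed

lemma pic_cont_x: "0 < c \<Longrightarrow> continuous_on I (\<lambda>x. pic x c)"
  by (rule continuous_on_compose2[OF pic_cont, where f = "\<lambda>x. (x, c)", simplified]) (auto intro!: continuous_intros)

lemma pic_cont_c: "x \<in> I \<Longrightarrow> continuous_on {0<..} (pic x)"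
  by (rule continuous_on_compose2[OF pic_cont, where f = "\<lambda>c. (x, c)", simplified]) (auto intro!: continuous_intros)

lemma pic_adm: "0 < c \<Longrightarrow> adm (\<lambda>x. pic x c)"
  by (rule adm_nonneg_mono[OF pic_cont_x pic_mono]) (auto intro: less_imp_le[OF pic_pos])

lemma value_fun_eq: "value_fun M F X pic r x y = 
    (INF \<tau>\<in>{\<tau>. stopping_time_e M F \<tau>}. \<integral>\<omega>. run (\<lambda>u. pic u y) x \<tau> \<omega> + disc r (\<tau> \<omega>) \<partial>M)"
  by (simp add: value_fun_def run_def)

lemma zero_stopping: "stopping_time_e M F (\<lambda>_. 0)"
  unfolding stopping_time_e_def
proof (intro conjI allI impI ballI)
  fix t :: real assume t: "0 \<le> t"
  then interpret sigma_algebra "space M" "F t" by (rule F_algebra)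
  have "{\<omega> \<in> space M. 0 \<le> ereal t} = space M" using t by auto
  then show "{\<omega> \<in> space M. 0 \<le> ereal t} \<in> F t" by simp
qed simp

text \<open>Stopping at once costs 1, so the value is 1 exactly if no stopping time does better;
  \<open>value_less_1\<close> and \<open>value_ge_1\<close> decide that.\<close>

lemma value_eq_1_iff:
  assumes x: "x \<in> I" and y: "0 < y"
  shows "value_fun M F X pic r x y = 1 \<longleftrightarrow> p x \<le> H (\<lambda>u. pic u y) x"
proof -
  let ?f = "\<lambda>u. pic u y"
  let ?J = "\<lambda>\<tau>. \<integral>\<omega>. run ?f x \<tau> \<omega> + disc r (\<tau> \<omega>) \<partial>M"
  let ?T = "{\<tau>. stopping_time_e M F \<tau>}"
  have nn: "0 \<le> pic q y" if "q \<in> I" for q using pic_pos[OF that y] by simp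
  have J0: "?J (\<lambda>_. 0) = 1"
  proof -
    have "{s. 0 \<le> s \<and> ereal s < 0} = {}" by auto
    then show ?thesis by (simp add: run_def disc_def prob_space zero_ereal_def[symmetric] set_lebesgue_integral_def)
  qed
  \<comment> \<open>A real infimum is meaningful only for a set bounded below; nonnegative costs
    provide the bound.\<close>
  have ge0: "0 \<le> ?J \<tau>" if "\<tau> \<in> ?T" for \<tau>
  proof (rule integral_nonneg_AE, rule AE_I2)
    fix \<omega> assume w: "\<omega> \<in> space M"
    have "0 \<le> run ?f x \<tau> \<omega>" unfolding run_def set_lebesgue_integral_def
      using nn[OF X_I[OF x w]] by (intro Bochner_Integration.integral_nonneg) (auto simp: indicator_def)
    then show "0 \<le> run ?f x \<tau> \<omega> + disc r (\<tau> \<omega>)" by (simp add: disc_def)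
  qed
  have bdd: "bdd_below (?J ` ?T)" by (rule bdd_belowI[of _ 0]) (use ge0 in auto)
  show ?thesis
  proof
    assume v: "value_fun M F X pic r x y = 1"
    show "p x \<le> H ?f x"
    proof (rule ccontr)
      assume "\<not> p x \<le> H ?f x"
      then have lt: "H ?f x < p x" by simp
      obtain \<tau> where \<tau>: "stopping_time_e M F \<tau>" "?J \<tau> < 1"
        by (rule value_less_1[OF x pic_cont_x[OF y] pic_mono[OF y] nn lt]) 
      have "value_fun M F X pic r x y \<le> ?J \<tau>" unfolding value_fun_eq
        by (rule cINF_lower[OF bdd]) (use \<tau> in simp)
      then show False using v \<tau> by simp
    qed
  next
    assume le: "p x \<le> H ?f x"
    have "value_fun M F X pic r x y \<le> ?J (\<lambda>_. 0)" unfolding value_fun_eq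
      by (rule cINF_lower[OF bdd]) (simp add: zero_stopping)
    moreover have "1 \<le> value_fun M F X pic r x y" unfolding value_fun_eq
    proof (rule cINF_greatest)
      show "?T \<noteq> {}" using zero_stopping by blast
      fix \<tau> assume "\<tau> \<in> ?T"
      then show "1 \<le> ?J \<tau>"
        by (intro value_ge_1[OF x pic_cont_x[OF y] pic_mono[OF y] nn pic_int[OF x y] le]) auto
    qed
    ultimately show "value_fun M F X pic r x y = 1" using J0 by simp
  qed
qed

lemma H_pic_less: "x \<in> I \<Longrightarrow> 0 < c \<Longrightarrow> c < d \<Longrightarrow> H (\<lambda>u. pic u d) x < H (\<lambda>u. pic u c) x"
  by (rule H_less) (auto intro: pic_adm pic_less)

lemma H_pic_le: "x \<in> I \<Longrightarrow> 0 < c \<Longrightarrow> c \<le> d \<Longrightarrow> H (\<lambda>u. pic u d) x \<le> H (\<lambda>u. pic u c) x"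
  using H_pic_less[of x c d] by (cases "c = d") auto

section \<open>Existence and monotonicity of the boundary\<close>

text \<open>The intermediate value theorem in the control. For large controls Assumption A2 puts
  \<open>pic\<close> below \<open>r\<close> at \<open>x\<close>, and A3 extends this to the left.
  For small controls the blow-up of \<open>pic\<close> is used at a single point
  \<open>a < x\<close> and spread over \<open>{a..x}\<close> by A3.\<close>

lemma root_exists: 
  assumes x: "x \<in> I" obtains y where "0 < y" "H (\<lambda>u. pic u y) x = p x"
proof -
  obtain a where a: "a \<in> I" "a < x" by (rule I_less[OF x])
  have pd: "0 < p x - p a" using p_strict_mono[OF a(1) x a(2)] by simp
  \<comment> \<open>From this threshold on, the contribution of \<open>{a..x}\<close> alone, at
    least \<open>pic a c * (p x - p a) / r\<close>, reaches \<open>p x\<close>.\<close>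
  have "\<forall>\<^sub>F c in at_right 0. r * p x / (p x - p a) \<le> pic a c"
    using pic_0[OF a(1)] unfolding filterlim_at_top by blast
  with eventually_at_right_less[of "0::real"] have "\<forall>\<^sub>F c in at_right 0. 0 < c \<and> r * p x / (p x - p a) \<le> pic a c"
    by eventually_elim simp
  then obtain y1 where y1: "0 < y1" "r * p x / (p x - p a) \<le> pic a y1"
    using eventually_happens[of _ "at_right (0::real)"] by (auto simp: trivial_limit_at_right_real)
  have "\<forall>\<^sub>F c in at_top. y1 < c \<and> pic x c < r"
    using pic_inf[OF x] \<kappa> by (intro eventually_conj eventually_gt_at_top order_tendstoD(2))
  then obtain y2 where y2: "y1 < y2" "pic x y2 < r"
    using eventually_happens[of _ "at_top :: real filter"] by auto
  have h1: "p x \<le> H (\<lambda>u. pic u y1) x"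
  proof -
    let ?D = "\<lambda>q. H (\<lambda>u. pic u y1) q - pic a y1 / r * p q"
    have "?D a \<le> ?D x"
    proof (rule DERIV_nonneg_imp_nondecreasing[OF less_imp_le[OF a(2)]])
      fix q assume q: "a \<le> q" "q \<le> x"
      then have qI: "q \<in> I" using I_convex[OF a(1) x] by blast
      have "(?D has_real_derivative pic q y1 * \<psi> q * sp q - pic a y1 / r * (r * \<psi> q * sp q)) (at q)"
        by (intro DERIV_diff DERIV_cmult H_deriv pic_adm y1 p_deriv qI)
      moreover have "pic q y1 * \<psi> q * sp q - pic a y1 / r * (r * \<psi> q * sp q) = (pic q y1 - pic a y1) * (\<psi> q * sp q)"
        using r_pos by (simp add: field_simps)
      moreover have "0 \<le> (pic q y1 - pic a y1) * (\<psi> q * sp q)"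
        using mono_onD[OF pic_mono[OF y1(1)] a(1) qI q(1)] \<psi>_pos[OF qI] sp_pos[OF qI] by simp
      ultimately show "\<exists>y. (?D has_real_derivative y) (at q) \<and> 0 \<le> y" by metis
    qed
    moreover have "0 \<le> H (\<lambda>u. pic u y1) a" using H_pos[OF pic_adm[OF y1(1)] a(1)] pic_pos y1 by (simp add: less_imp_le)
    ultimately have "pic a y1 * (p x - p a) / r \<le> H (\<lambda>u. pic u y1) x" by (simp add: right_diff_distrib diff_divide_distrib)
    moreover have "r * p x \<le> pic a y1 * (p x - p a)" using y1(2) pd by (simp add: pos_divide_le_eq)
    then have "p x \<le> pic a y1 * (p x - p a) / r" using r_pos by (simp add: field_simps)
    ultimately show ?thesis by simp
  qed
  have h2: "H (\<lambda>u. pic u y2) x \<le> p x"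
  proof -
    have "H (\<lambda>u. pic u y2) x \<le> H (\<lambda>_. r) x"
    proof (rule H_le[OF _ adm_const x])
      fix q assume "q \<in> I" "q \<le> x"
      then show "pic q y2 \<le> r" using mono_onD[OF pic_mono[of y2] _ x, of q] y1 y2 by simp
    qed (use pic_adm y1 y2 in simp)
    then show ?thesis using H_const'[OF x, of r] r_pos by simp
  qed
  \<comment> \<open>Dominated convergence with the constant \<open>pic x y1\<close>, as
    \<open>pic\<close> decreases in the control and increases in the state.\<close>
  have "continuous_on {y1..y2} (\<lambda>y. H (\<lambda>u. pic u y) x)"
  proof (rule continuous_on_sequentiallyI)
    fix c :: "nat \<Rightarrow> real" and l assume c: "\<forall>n. c n \<in> {y1..y2}" "l \<in> {y1..y2}" "c \<longlonglongrightarrow> l"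
    have pos: "0 < c n" "0 < l" for n using c y1 by (auto intro: less_le_trans)
    show "(\<lambda>n. H (\<lambda>u. pic u (c n)) x) \<longlonglongrightarrow> H (\<lambda>u. pic u l) x"
    proof (rule H_tendsto[OF pic_cont_x[OF pos(1)] pic_cont_x[OF pos(2)] x])
      fix u assume u: "u \<in> I" "u \<le> x"
      show "(\<lambda>n. pic u (c n)) \<longlonglongrightarrow> pic u l"
        by (rule continuous_on_tendsto_compose[OF pic_cont_c[OF u(1)] c(3)]) (use pos in auto)
      show "\<bar>pic u (c n)\<bar> \<le> pic x y1" for n
      proof -
        have "pic u (c n) \<le> pic u y1" using c(1) y1 by (intro pic_le u) auto
        also have "\<dots> \<le> pic x y1" by (rule mono_onD[OF pic_mono[OF y1(1)] u(1) x u(2)])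
        finally show ?thesis using pic_pos[OF u(1) pos(1)[of n]] by simp
      qed
    qed
  qed
  then obtain y where y: "y1 \<le> y" "y \<le> y2" "H (\<lambda>u. pic u y) x = p x"
    using IVT2'[of "\<lambda>y. H (\<lambda>u. pic u y) x" y2 "p x" y1] h1 h2 y2 by auto
  show thesis by (rule that[OF _ y(3)]) (use y(1) y1(1) in simp)
qed

abbreviation fb where "fb \<equiv> free_boundary M F X pic r"

text \<open>Strict monotonicity in the control makes the set an interval that contains its supremum,
  which is the root.\<close>

lemma value_set_eq:
  assumes x: "x \<in> I" and y: "0 < y" "H (\<lambda>u. pic u y) x = p x"
  shows "{y. 0 < y \<and> value_fun M F X pic r x y = 1} = {0<..y}"
proof (intro equalityI subsetI)
  fix c assume "c \<in> {y. 0 < y \<and> value_fun M F X pic r x y = 1}"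
  then have c: "0 < c" "p x \<le> H (\<lambda>u. pic u c) x" using value_eq_1_iff[OF x, of c] by auto
  then show "c \<in> {0<..y}" using H_pic_less[OF x y(1), of c] y(2) by force
next
  fix c assume "c \<in> {0<..y}"
  then show "c \<in> {y. 0 < y \<and> value_fun M F X pic r x y = 1}"
    using value_eq_1_iff[OF x, of c] H_pic_le[OF x, of c y] y by auto
qed

lemma fb_root:
  assumes x: "x \<in> I"
  shows "0 < fb x" "H (\<lambda>u. pic u (fb x)) x = p x"
    "{y. 0 < y \<and> value_fun M F X pic r x y = 1} = {0<..fb x}"
proof -
  obtain y where y: "0 < y" "H (\<lambda>u. pic u y) x = p x" by (rule root_exists[OF x])
  have "fb x = y" unfolding free_boundary_def value_set_eq[OF x y] using y(1) by simp
  then show "0 < fb x" "H (\<lambda>u. pic u (fb x)) x = p x"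
    "{y. 0 < y \<and> value_fun M F X pic r x y = 1} = {0<..fb x}"
    using y value_set_eq[OF x y] by simp_all
qed

text \<open>At the control \<open>fb a\<close> the weighted integral of \<open>pic - r\<close> is
  zero at \<open>a\<close>. By single crossing it is nonnegative at \<open>b\<close>, so the value
  at \<open>b\<close> is still 1 for that control.\<close>

lemma fb_mono: "mono_on I fb"
proof (rule mono_onI)
  fix a b assume ab: "a \<in> I" "b \<in> I" "a \<le> b"
  define y where "y = fb a"
  have y: "0 < y" "H (\<lambda>u. pic u y) a = p a" using fb_root(1,2)[OF ab(1)] by (auto simp: y_def)
  have D: "H (\<lambda>u. pic u y - r) q = H (\<lambda>u. pic u y) q - p q" if "q \<in> I" for q
    using H_diff[OF pic_adm[OF y(1)] adm_const that, of r] H_const'[OF that, of r] r_pos by simp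
  have "0 \<le> H (\<lambda>u. pic u y - r) b"
  proof (rule H_nonneg_after[OF adm_diff[OF pic_adm[OF y(1)] adm_const] _ ab(1) _ ab(2,3)])
    show "mono_on I (\<lambda>u. pic u y - r)" using pic_mono[OF y(1)] by (auto simp: mono_on_def)
    show "0 \<le> H (\<lambda>u. pic u y - r) a" using D[OF ab(1)] y by simp
  qed
  then have "p b \<le> H (\<lambda>u. pic u y) b" using D[OF ab(2)] by simp
  then have "y \<in> {0<..fb b}" using fb_root(3)[OF ab(2)] value_eq_1_iff[OF ab(2) y(1)] y(1) by blast
  then show "fb a \<le> fb b" by (simp add: y_def)
qed

section \<open>The boundary solves the integral equation\<close>

lemma int_eq_lhs_eq:
  assumes x: "x \<in> I" and b: "\<And>z. z \<in> I \<Longrightarrow> 0 < b z"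
  shows "int_eq_lhs lo hi \<mu> \<sigma> x0 \<psi> pic b x = ennreal (\<psi> x) * 
    (\<integral>\<^sup>+ z\<in>einterval (ereal x) hi. ennreal (H (\<lambda>u. pic u (b z)) z * (sc z / (\<psi> z)\<^sup>2)) \<partial>lborel)"
proof -
  have "(\<integral>\<^sup>+ y\<in>{y. lo < ereal y \<and> ereal y < ereal z}. ennreal (pic y (b z) * \<psi> y * sp y) \<partial>lborel) * ennreal (sc z / (\<psi> z)\<^sup>2)
    = ennreal (H (\<lambda>u. pic u (b z)) z * (sc z / (\<psi> z)\<^sup>2))" if "z \<in> einterval (ereal x) hi" for z
  proof -
    have "lo < ereal x" using x by (simp add: einterval_def)
    then have z: "z \<in> I" using that unfolding einterval_def by (auto intro: order.strict_trans)
    have "(\<integral>\<^sup>+ y\<in>{y. lo < ereal y \<and> ereal y < ereal z}. ennreal (pic y (b z) * \<psi> y * sp y) \<partial>lborel) = ennreal (H (\<lambda>u. pic u (b z)) z)"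
      using nn_integral_H[OF pic_adm[OF b[OF z]] z] pic_pos b[OF z] by (simp add: einterval_def less_imp_le)
    moreover have "0 \<le> H (\<lambda>u. pic u (b z)) z"
      using H_pos[OF pic_adm[OF b[OF z]] z] pic_pos b[OF z] by (simp add: less_imp_le)
    ultimately show ?thesis by (simp only: ennreal_mult')
  qed
  then have "(\<integral>\<^sup>+ z\<in>einterval (ereal x) hi. 
        (\<integral>\<^sup>+ y\<in>{y. lo < ereal y \<and> ereal y < ereal z}. ennreal (pic y (b z) * \<psi> y * sp y) \<partial>lborel) * ennreal (sc z / (\<psi> z)\<^sup>2) \<partial>lborel) 
    = (\<integral>\<^sup>+ z\<in>einterval (ereal x) hi. ennreal (H (\<lambda>u. pic u (b z)) z * (sc z / (\<psi> z)\<^sup>2)) \<partial>lborel)"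
    by (intro nn_integral_cong) (simp add: indicator_def)
  then show ?thesis unfolding int_eq_lhs_def einterval_def by simp
qed

lemma sup_I: assumes "x \<in> I" shows "einterval (ereal x) hi \<subseteq> I"
proof
  fix z assume z: "z \<in> einterval (ereal x) hi"
  have "lo < ereal x" using assms by (simp add: einterval_def)
  moreover have "ereal x < ereal z" "ereal z < hi" using z by (auto simp: einterval_def)
  ultimately show "z \<in> I" unfolding einterval_def mem_Collect_eq by (metis order.strict_trans)
qed

lemma p_weight: "z \<in> I \<Longrightarrow> p z * (sc z / (\<psi> z)\<^sup>2) = \<psi>1 z / (\<psi> z)\<^sup>2"
  using sc_pos[of z] by (simp add: p_def)

text \<open>Since \<open>p * sc = \<psi>1\<close>, the integrand is the derivative of
  \<open>- 1 / \<psi>\<close>, and \<open>\<psi>_unbounded\<close> removes the boundary term at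
  \<open>hi\<close>.\<close>

lemma tail_integral:
  assumes x: "x \<in> I"
  shows "(\<integral>\<^sup>+ z\<in>einterval (ereal x) hi. ennreal (p z * (sc z / (\<psi> z)\<^sup>2)) \<partial>lborel) = ennreal (1 / \<psi> x)"
proof -
  have xh: "ereal x < hi" using x by (simp add: einterval_def)
  let ?f = "\<lambda>z. p z * (sc z / (\<psi> z)\<^sup>2)"
  let ?F = "\<lambda>z. - (1 / \<psi> z)"
  have zI: "z \<in> I" if "ereal x < ereal z" "ereal z < hi" for z using sup_I[OF x] that by (auto simp: einterval_def)
  have F: "(?F has_real_derivative ?f z) (at z)" if "z \<in> I" for z
    unfolding p_weight[OF that]
    using DERIV_minus[OF DERIV_divide[OF DERIV_const[of 1] \<psi>_deriv[OF that]]] \<psi>_pos[OF that]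
    by (simp add: power2_eq_square)
  have "\<psi> z \<noteq> 0" if "z \<in> I" for z using \<psi>_pos[OF that] by simp
  then have fc: "continuous_on I ?f" by (intro continuous_intros p_cont sc_cont \<psi>_cont) auto
  then have cont: "isCont ?f z" if "z \<in> I" for z using that open_I continuous_on_eq_continuous_at by blast
  have f0: "0 \<le> ?f z" if "z \<in> I" for z using p_pos[OF that] sc_pos[of z] by simp
  have nn: "AE z in lborel. ereal x < ereal z \<longrightarrow> ereal z < hi \<longrightarrow> 0 \<le> ?f z"
    using zI f0 by (intro AE_I2) blast
  have "isCont ?F x" using F[OF x] by (rule DERIV_isCont)
  then have A: "((?F \<circ> real_of_ereal) \<longlongrightarrow> - (1 / \<psi> x)) (at_right (ereal x))"
    unfolding ereal_tendsto_simps by (simp add: isCont_def filterlim_at_split)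
  have B: "((?F \<circ> real_of_ereal) \<longlongrightarrow> 0) (at_left hi)"
  proof -
    have ev: "\<forall>\<^sub>F t in at_left hi. real_of_ereal t \<in> I \<and> w < real_of_ereal t" if w: "w \<in> I" for w
    proof -
      have wh: "ereal w < hi" using w by (simp add: einterval_def)
      have "real_of_ereal t \<in> I \<and> w < real_of_ereal t" if t: "ereal w < t" "t < hi" for t
      proof -
        obtain t' where t': "t = ereal t'" using t by (cases t) auto
        then have "t' \<in> einterval (ereal w) hi" using t by (simp add: einterval_def)
        then show ?thesis using sup_I[OF w] t t' by auto
      qed
      then show ?thesis unfolding eventually_at_left[OF wh] using wh by blast
    qed
    show ?thesis
    proof (rule order_tendstoI)
      fix c :: real assume c: "c < 0"
      obtain w where w: "w \<in> I" "1 / - c < \<psi> w" using \<psi>_unbounded by blast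
      show "\<forall>\<^sub>F t in at_left hi. c < (?F \<circ> real_of_ereal) t"
        using ev[OF w(1)]
      proof eventually_elim
        case (elim t)
        have "1 / - c < \<psi> (real_of_ereal t)" using w(2) \<psi>_le[OF w(1), of "real_of_ereal t"] elim by simp
        then have "1 < \<psi> (real_of_ereal t) * - c" using c by (simp only: pos_divide_less_eq neg_0_less_iff_less)
        then show ?case using \<psi>_pos[of "real_of_ereal t"] elim by (simp add: field_simps)
      qed
    next
      fix c :: real assume c: "0 < c"
      show "\<forall>\<^sub>F t in at_left hi. (?F \<circ> real_of_ereal) t < c"
        using ev[OF x]
      proof eventually_elim
        case (elim t)
        then have "0 < 1 / \<psi> (real_of_ereal t)" using \<psi>_pos by simp
        then show ?case using c unfolding o_def by linarith
      qed
    qed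
  qed
  have I: "set_integrable lborel (einterval (ereal x) hi) ?f" "(LBINT z=ereal x..hi. ?f z) = 0 - - (1 / \<psi> x)"
    by (rule interval_integral_FTC_nonneg[OF xh F[OF zI] cont[OF zI] nn A B]; assumption)+
  have "(\<integral>\<^sup>+ z\<in>einterval (ereal x) hi. ennreal (?f z) \<partial>lborel) = (\<integral>\<^sup>+ z. ennreal (indicator (einterval (ereal x) hi) z *\<^sub>R ?f z) \<partial>lborel)"
    by (intro nn_integral_cong) (simp add: indicator_def)
  also have "\<dots> = ennreal (LINT z:einterval (ereal x) hi|lborel. ?f z)"
    unfolding set_lebesgue_integral_def using I(1) f0 sup_I[OF x]
    by (intro nn_integral_eq_integral) (auto simp: set_integrable_def indicator_def intro!: AE_I2)
  also have "(LINT z:einterval (ereal x) hi|lborel. ?f z) = 1 / \<psi> x"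
    using I(2) xh by (simp add: interval_lebesgue_integral_le_eq less_imp_le)
  finally show ?thesis .
qed

lemma fb_solves: assumes x: "x \<in> I" shows "int_eq_lhs lo hi \<mu> \<sigma> x0 \<psi> pic fb x = 1"
proof -
  have *: "(\<integral>\<^sup>+ z\<in>einterval (ereal x) hi. ennreal (H (\<lambda>u. pic u (fb z)) z * (sc z / (\<psi> z)\<^sup>2)) \<partial>lborel)
     = (\<integral>\<^sup>+ z\<in>einterval (ereal x) hi. ennreal (p z * (sc z / (\<psi> z)\<^sup>2)) \<partial>lborel)"
    using fb_root(2) sup_I[OF x] by (intro nn_integral_cong) (auto simp: indicator_def)
  have "int_eq_lhs lo hi \<mu> \<sigma> x0 \<psi> pic fb x = ennreal (\<psi> x) * ennreal (1 / \<psi> x)"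
    using int_eq_lhs_eq[where b = fb, OF x fb_root(1)] by (simp only: * tail_integral[OF x])
  then show ?thesis using \<psi>_pos[OF x] by (simp add: ennreal_mult'[symmetric] ennreal_1[symmetric] del: ennreal_1)
qed

section \<open>Uniqueness among nondecreasing solutions\<close>

text \<open>A competitor is only monotone, so the inner integral need not be continuous in
  \<open>z\<close>. Its measurability comes from a kernel measurable in both variables, all
  ingredients being extended by zero outside their domains.\<close>

lemma H_pic_measurable:
  assumes b: "\<And>z. z \<in> I \<Longrightarrow> 0 < b z" "mono_on I b"
  shows "(\<lambda>z. indicator I z * H (\<lambda>u. pic u (b z)) z) \<in> borel_measurable borel"
proof -
  define b' where "b' z = indicator I z *\<^sub>R b z" for z
  have b'[measurable]: "b' \<in> borel_measurable borel"
  proof -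
    have "b \<in> borel_measurable (restrict_space borel I)" by (rule borel_measurable_mono_on_fnc[OF b(2)])
    then show ?thesis unfolding b'_def[abs_def] by (subst (asm) borel_measurable_restrict_space_iff) auto
  qed
  define P where "P = (\<lambda>q :: real \<times> real. indicator (I \<times> {0<..}) q *\<^sub>R (case q of (u, c) \<Rightarrow> pic u c))"
  have P[measurable]: "P \<in> borel_measurable borel" unfolding P_def
    by (rule borel_measurable_continuous_on_indicator[OF _ pic_cont]) (intro borel_open open_Times, auto)
  define w where "w u = indicator I u *\<^sub>R (\<psi> u * sp u)" for u
  have w[measurable]: "w \<in> borel_measurable borel" unfolding w_def[abs_def]
    by (rule borel_measurable_continuous_on_indicator) (auto intro!: continuous_intros \<psi>_cont sp_cont)
  define k where "k = (\<lambda>(z, u). indicator {q. snd q < fst q} (z, u) * (P (u, b' z) * w u))"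
  have [measurable]: "(\<lambda>q. P (snd q, b' (fst q))) \<in> borel_measurable (borel \<Otimes>\<^sub>M lborel)"
  proof (rule measurable_compose[OF _ P])
    have "(\<lambda>q. (snd q, b' (fst q))) \<in> borel \<Otimes>\<^sub>M lborel \<rightarrow>\<^sub>M borel \<Otimes>\<^sub>M borel" by measurable
    then show "(\<lambda>q. (snd q, b' (fst q))) \<in> borel \<Otimes>\<^sub>M lborel \<rightarrow>\<^sub>M borel" by (simp add: borel_prod)
  qed
  have k[measurable]: "k \<in> borel_measurable (borel \<Otimes>\<^sub>M lborel)"
  proof -
    have "(\<lambda>q. indicator {q. snd q < fst q} q * (P (snd q, b' (fst q)) * w (snd q))) \<in> borel_measurable (borel \<Otimes>\<^sub>M lborel)"
      by (intro borel_measurable_times) measurable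
    then show ?thesis unfolding k_def by (simp add: case_prod_beta')
  qed
  have "(\<lambda>z. \<integral>u. k (z, u) \<partial>lborel) \<in> borel_measurable borel"
    using lborel.borel_measurable_lebesgue_integral[of "\<lambda>z u. k (z, u)" borel] k by simp
  then have "(\<lambda>z. indicator I z * (\<integral>u. k (z, u) \<partial>lborel)) \<in> borel_measurable borel" by (intro borel_measurable_times) auto
  moreover have "indicator I z * (\<integral>u. k (z, u) \<partial>lborel) = indicator I z * H (\<lambda>u. pic u (b z)) z" for z
  proof (cases "z \<in> I")
    case True
    have "k (z, u) = indicator (einterval lo (ereal z)) u *\<^sub>R (pic u (b z) * (\<psi> u * sp u))" for u
    proof (cases "u \<in> einterval lo (ereal z)")
      case u: True
      then have "u \<in> I" "u < z" using sub_I[OF True] by (auto simp: einterval_def)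
      then show ?thesis using u True b(1)[OF True] by (simp add: k_def P_def w_def b'_def)
    next
      case u: False
      have "\<not> (u \<in> I \<and> u < z)" using u by (auto simp: einterval_def)
      then show ?thesis using u by (auto simp: k_def w_def)
    qed
    then show ?thesis by (simp add: H_def set_lebesgue_integral_def)
  qed simp
  ultimately show ?thesis by simp
qed

text \<open>Divided by \<open>\<psi>\<close>, the equation gives the tail integral from each point
  of \<open>I\<close>; subtracting two finite tails localises it. Measurability of the integrand is
  needed to split the tail.\<close>

lemma int_eq_interval:
  assumes b: "\<And>z. z \<in> I \<Longrightarrow> 0 < b z" "mono_on I b"
    and eq: "\<And>x. x \<in> I \<Longrightarrow> int_eq_lhs lo hi \<mu> \<sigma> x0 \<psi> pic b x = 1" and xy: "x \<in> I" "y \<in> I" "x < y"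
  shows "(\<integral>\<^sup>+ z\<in>{x<..y}. ennreal (H (\<lambda>u. pic u (b z)) z * (sc z / (\<psi> z)\<^sup>2)) \<partial>lborel) = ennreal (1 / \<psi> x - 1 / \<psi> y)"
proof -
  let ?g = "\<lambda>z. ennreal (H (\<lambda>u. pic u (b z)) z * (sc z / (\<psi> z)\<^sup>2))"
  let ?T = "\<lambda>x. \<integral>\<^sup>+ z\<in>einterval (ereal x) hi. ?g z \<partial>lborel"
  have T: "?T q = ennreal (1 / \<psi> q)" if q: "q \<in> I" for q
  proof -
    have "ennreal (\<psi> q) * ?T q = 1" using eq[OF q] int_eq_lhs_eq[OF q b(1)] by simp
    then have "ennreal (1 / \<psi> q) * (ennreal (\<psi> q) * ?T q) = ennreal (1 / \<psi> q)" by simp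
    moreover have "ennreal (1 / \<psi> q) * ennreal (\<psi> q) = 1" using \<psi>_pos[OF q] by (simp add: ennreal_mult'[symmetric])
    ultimately show ?thesis by (simp add: mult.assoc[symmetric])
  qed
  have weight: "(\<lambda>z. indicator I z *\<^sub>R (sc z / (\<psi> z)\<^sup>2)) \<in> borel_measurable borel"
  proof (rule borel_measurable_continuous_on_indicator)
    have "\<psi> z \<noteq> 0" if "z \<in> I" for z using \<psi>_pos[OF that] by simp
    then show "continuous_on I (\<lambda>z. sc z / (\<psi> z)\<^sup>2)" by (intro continuous_intros sc_cont \<psi>_cont) auto
  qed simp
  have m: "(\<lambda>z. ?g z * indicator S z) \<in> borel_measurable lborel" if S: "S \<subseteq> I" "S \<in> sets borel" for S
  proof -
    have "(\<lambda>z. ennreal ((indicator I z * H (\<lambda>u. pic u (b z)) z) * (indicator I z *\<^sub>R (sc z / (\<psi> z)\<^sup>2))) * indicator S z) \<in> borel_measurable borel"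
      using H_pic_measurable[OF b] weight S(2) by measurable
    moreover have "ennreal ((indicator I z * H (\<lambda>u. pic u (b z)) z) * (indicator I z *\<^sub>R (sc z / (\<psi> z)\<^sup>2))) * indicator S z = ?g z * indicator S z" for z
      using S(1) by (auto simp: indicator_def)
    ultimately show ?thesis by simp
  qed
  have "y \<in> einterval (ereal x) hi" using xy by (auto simp: einterval_def)
  then have split: "einterval (ereal x) hi = {x<..y} \<union> einterval (ereal y) hi" "{x<..y} \<inter> einterval (ereal y) hi = {}"
    using xy(3) by (auto simp: einterval_def not_less intro: order.strict_trans1[of "ereal _" "ereal y"])
  have sub: "{x<..y} \<subseteq> I" using I_Icc[OF xy(1,2)] by auto
  have "?T x = (\<integral>\<^sup>+ z. ?g z * indicator {x<..y} z + ?g z * indicator (einterval (ereal y) hi) z \<partial>lborel)"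
    unfolding split(1) using split(2) by (intro nn_integral_cong) (auto simp: indicator_def)
  also have "\<dots> = (\<integral>\<^sup>+ z\<in>{x<..y}. ?g z \<partial>lborel) + ?T y"
    using m[OF sub] m[OF sup_I[OF xy(2)]] by (intro nn_integral_add) auto
  finally have *: "ennreal (1 / \<psi> x) = (\<integral>\<^sup>+ z\<in>{x<..y}. ?g z \<partial>lborel) + ennreal (1 / \<psi> y)" using T xy by simp
  have "(\<integral>\<^sup>+ z\<in>{x<..y}. ?g z \<partial>lborel) = ennreal (1 / \<psi> x) - ennreal (1 / \<psi> y)" unfolding * by simp
  also have "\<dots> = ennreal (1 / \<psi> x - 1 / \<psi> y)" using \<psi>_pos[OF xy(2)] by (intro ennreal_minus) simp
  finally show ?thesis .
qed

text \<open>Two solutions share the same finite integral over \<open>{x<..y}\<close>, so their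
  integrands cannot be strictly ordered on a set of positive measure. The symmetric form allows the
  free boundary to take either role.\<close>

lemma int_eq_solution_not_separated:
  assumes b: "\<And>z. z \<in> I \<Longrightarrow> 0 < b z" "mono_on I b" "\<And>x. x \<in> I \<Longrightarrow> int_eq_lhs lo hi \<mu> \<sigma> x0 \<psi> pic b x = 1"
    and c: "\<And>z. z \<in> I \<Longrightarrow> 0 < c z" "mono_on I c" "\<And>x. x \<in> I \<Longrightarrow> int_eq_lhs lo hi \<mu> \<sigma> x0 \<psi> pic c x = 1" 
    and xy: "x \<in> I" "y \<in> I" "x < y"
    and less: "\<And>z. x < z \<Longrightarrow> z < y \<Longrightarrow> H (\<lambda>u. pic u (b z)) z < H (\<lambda>u. pic u (c z)) z"
  shows False
proof -
  \<comment> \<open>The indicators make the integrand measurable on the whole line; leaving out the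
    endpoint \<open>y\<close> changes it on a null set only.\<close>
  let ?g = "\<lambda>b z. ennreal (indicator {x<..<y} z * (indicator I z * H (\<lambda>u. pic u (b z)) z) * (indicator I z *\<^sub>R (sc z / (\<psi> z)\<^sup>2)))"
  have weight: "(\<lambda>z. indicator I z *\<^sub>R (sc z / (\<psi> z)\<^sup>2)) \<in> borel_measurable borel"
  proof (rule borel_measurable_continuous_on_indicator)
    have "\<psi> z \<noteq> 0" if "z \<in> I" for z using \<psi>_pos[OF that] by simp
    then show "continuous_on I (\<lambda>z. sc z / (\<psi> z)\<^sup>2)" by (intro continuous_intros sc_cont \<psi>_cont) auto
  qed simp
  have sub: "{x..y} \<subseteq> I" by (rule I_Icc[OF xy(1,2)])
  have e: "(\<integral>\<^sup>+ z. ?g a z \<partial>lborel) = ennreal (1 / \<psi> x - 1 / \<psi> y)" 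
    if a: "\<And>z. z \<in> I \<Longrightarrow> 0 < a z" "mono_on I a" "\<And>x. x \<in> I \<Longrightarrow> int_eq_lhs lo hi \<mu> \<sigma> x0 \<psi> pic a x = 1" for a
  proof -
    have "(\<integral>\<^sup>+ z. ?g a z \<partial>lborel) = (\<integral>\<^sup>+ z\<in>{x<..y}. ennreal (H (\<lambda>u. pic u (a z)) z * (sc z / (\<psi> z)\<^sup>2)) \<partial>lborel)"
    proof (rule nn_integral_cong_AE)
      show "AE z in lborel. ?g a z = ennreal (H (\<lambda>u. pic u (a z)) z * (sc z / (\<psi> z)\<^sup>2)) * indicator {x<..y} z"
        using AE_lborel_singleton[of y] by eventually_elim (use subsetD[OF sub] in \<open>auto simp: indicator_def\<close>)
    qed
    then show ?thesis using int_eq_interval[OF a xy] by simp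
  qed
  have gm: "?g a \<in> borel_measurable lborel" if "\<And>z. z \<in> I \<Longrightarrow> 0 < a z" "mono_on I a" for a
    using H_pic_measurable[OF that] weight by measurable
  have lt: "?g b z < ?g c z" if "x < z" "z < y" for z
  proof -
    have z: "z \<in> I" using sub that by auto
    have "0 < sc z / (\<psi> z)\<^sup>2" using sc_pos[of z] \<psi>_pos[OF z] by simp
    then have "H (\<lambda>u. pic u (b z)) z * (sc z / (\<psi> z)\<^sup>2) < H (\<lambda>u. pic u (c z)) z * (sc z / (\<psi> z)\<^sup>2)"
      by (rule mult_strict_right_mono[OF less[OF that]])
    moreover have "0 \<le> H (\<lambda>u. pic u (b z)) z * (sc z / (\<psi> z)\<^sup>2)"
      using H_pos[OF pic_adm[OF b(1)[OF z]] z] pic_pos b(1)[OF z] sc_pos[of z] by simp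
    ultimately have "ennreal (H (\<lambda>u. pic u (b z)) z * (sc z / (\<psi> z)\<^sup>2)) < ennreal (H (\<lambda>u. pic u (c z)) z * (sc z / (\<psi> z)\<^sup>2))"
      by (simp only: ennreal_less_iff)
    then show ?thesis using z that by simp
  qed
  have "(\<integral>\<^sup>+ z. ?g b z \<partial>lborel) < (\<integral>\<^sup>+ z. ?g c z \<partial>lborel)"
  proof (rule nn_integral_less[OF gm[OF b(1,2)] gm[OF c(1,2)]])
    show "(\<integral>\<^sup>+ z. ?g b z \<partial>lborel) \<noteq> \<infinity>" using e[of b, OF b] by simp
    show "AE z in lborel. ?g b z \<le> ?g c z"
    proof (rule AE_I2)
      fix z show "?g b z \<le> ?g c z" using lt[of z] by (cases "x < z \<and> z < y") (auto simp: indicator_def less_imp_le)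
    qed
    show "\<not> (AE z in lborel. ?g c z \<le> ?g b z)"
    proof
      assume "AE z in lborel. ?g c z \<le> ?g b z"
      then have "AE z in lborel. z \<notin> {x<..<y}" 
        by eventually_elim (use lt in \<open>auto simp: not_less[symmetric] simp del: not_less\<close>)
      then have "emeasure lborel {x<..<y} = 0" by (subst (asm) AE_iff_measurable[of "{x<..<y}"]) auto
      then show False using xy(3) by simp
    qed
  qed
  then show False using e[of b, OF b] e[of c, OF c] by simp
qed

lemma int_eq_unique:
  assumes b: "\<And>z. z \<in> I \<Longrightarrow> 0 < b z" "mono_on I b" "\<And>x. x \<in> I \<Longrightarrow> int_eq_lhs lo hi \<mu> \<sigma> x0 \<psi> pic b x = 1" 
    and x: "x \<in> I"
  shows "b x = fb x"
proof (rule ccontr)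
  assume ne: "b x \<noteq> fb x"
  define y where "y = b x"
  have y: "0 < y" using b(1)[OF x] by (simp add: y_def)
  define D where "D q = H (\<lambda>u. pic u y) q - p q" for q
  have "isCont (H (\<lambda>u. pic u y)) x" "isCont p x"
    using DERIV_isCont[OF H_deriv[OF pic_adm[OF y] x]] DERIV_isCont[OF p_deriv[OF x]] by auto
  then have D: "(D \<longlongrightarrow> D x) (at x)" unfolding D_def[abs_def] isCont_def by (intro tendsto_diff)
  obtain l where l: "l \<in> I" "l < x" by (rule I_less[OF x])
  obtain u where u: "u \<in> I" "x < u" by (rule I_greater[OF x])
  consider "fb x < y" | "y < fb x" using ne y_def by linarith
  then show False
  proof cases
    case 1
    then have "D x < 0" using H_pic_less[OF x fb_root(1)[OF x] 1] fb_root(2)[OF x] by (simp add: D_def)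
    then have "\<forall>\<^sub>F q in at x. D q < 0" using order_tendstoD(2)[OF D] by blast
    then obtain d where d: "0 < d" "\<And>q. q \<noteq> x \<Longrightarrow> \<bar>q - x\<bar> < d \<Longrightarrow> D q < 0"
      unfolding eventually_at dist_real_def by blast
    define v where "v = min u (x + d)"
    have v: "x < v" "v \<le> u" using u d by (auto simp: v_def)
    have vI: "v \<in> I" using I_convex[OF x u(1), of v] v by simp
    show False
    proof (rule int_eq_solution_not_separated[OF b fb_root(1) fb_mono fb_solves x vI v(1)])
      fix z assume z: "x < z" "z < v"
      have zI: "z \<in> I" using I_convex[OF x vI, of z] z by simp
      have "D z < 0" using z d by (auto simp: v_def)
      moreover have "H (\<lambda>u. pic u (b z)) z \<le> H (\<lambda>u. pic u y) z"
        using mono_onD[OF b(2) x zI] z y by (intro H_pic_le zI) (auto simp: y_def)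
      ultimately show "H (\<lambda>u. pic u (b z)) z < H (\<lambda>u. pic u (fb z)) z"
        using fb_root(2)[OF zI] by (simp add: D_def)
    qed
  next
    case 2
    then have "0 < D x" using H_pic_less[OF x y 2] fb_root(2)[OF x] by (simp add: D_def)
    then have "\<forall>\<^sub>F q in at x. 0 < D q" using order_tendstoD(1)[OF D] by blast
    then obtain d where d: "0 < d" "\<And>q. q \<noteq> x \<Longrightarrow> \<bar>q - x\<bar> < d \<Longrightarrow> 0 < D q"
      unfolding eventually_at dist_real_def by blast
    define v where "v = max l (x - d)"
    have v: "v < x" "l \<le> v" using l d by (auto simp: v_def)
    have vI: "v \<in> I" using I_convex[OF l(1) x, of v] v by simp
    show False
    proof (rule int_eq_solution_not_separated[OF fb_root(1) fb_mono fb_solves b vI x v(1)])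
      fix z assume z: "v < z" "z < x"
      have zI: "z \<in> I" using I_convex[OF vI x, of z] z by simp
      have "0 < D z" using z d by (auto simp: v_def)
      moreover have "H (\<lambda>u. pic u y) z \<le> H (\<lambda>u. pic u (b z)) z"
        using mono_onD[OF b(2) zI x] z b(1)[OF zI] by (intro H_pic_le zI) (auto simp: y_def)
      ultimately show "H (\<lambda>u. pic u (fb z)) z < H (\<lambda>u. pic u (b z)) z"
        using fb_root(2)[OF zI] by (simp add: D_def)
    qed
  qed
qed

end

section \<open>From the hypotheses of the theorem to the locales\<close>

text \<open>Continuity of \<open>h\<close> at 0 has to be extracted from the divergent integral: if
  \<open>h\<close> stayed above some \<open>e > 0\<close>, then \<open>1 / h^2\<close> would be at
  most \<open>1 / e^2\<close> and have a finite integral over \<open>{0<..1}\<close>.\<close>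

lemma modulus_continuous_on:
  fixes \<sigma> h :: "real \<Rightarrow> real"
  assumes h: "strict_mono_on {0..} h" "h 0 = 0"
    and h_int: "(\<integral>\<^sup>+ u\<in>{0<..1}. ennreal (1 / (h u)\<^sup>2) \<partial>lborel) = \<infinity>"
    and \<sigma>: "\<And>x y. x \<in> I \<Longrightarrow> y \<in> I \<Longrightarrow> \<bar>\<sigma> x - \<sigma> y\<bar> \<le> h \<bar>x - y\<bar>"
  shows "continuous_on I \<sigma>"
proof -
  have small: "\<exists>d>0. h d < e" if e: "0 < e" for e
  proof (rule ccontr)
    assume "\<not> (\<exists>d>0. h d < e)"
    then have le: "e \<le> h u" if "0 < u" for u using that by force
    have "(\<integral>\<^sup>+ u\<in>{0<..1}. ennreal (1 / (h u)\<^sup>2) \<partial>lborel) \<le> (\<integral>\<^sup>+ u\<in>{0<..1::real}. ennreal (1 / e\<^sup>2) \<partial>lborel)"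
    proof (rule nn_integral_mono)
      fix u :: real
      have "1 / (h u)\<^sup>2 \<le> 1 / e\<^sup>2" if "0 < u"
        using le[OF that] e by (intro divide_left_mono power_mono) auto
      then show "ennreal (1 / (h u)\<^sup>2) * indicator {0<..1} u \<le> ennreal (1 / e\<^sup>2) * indicator {0<..1} u"
        by (auto simp: indicator_def intro!: ennreal_leI)
    qed
    also have "\<dots> < \<infinity>" by (simp add: nn_integral_cmult_indicator ennreal_mult_less_top)
    finally show False using h_int by simp
  qed
  show ?thesis unfolding continuous_on_iff dist_real_def
  proof (intro ballI allI impI)
    fix x e assume x: "x \<in> I" and e: "(0::real) < e"
    obtain d where d: "0 < d" "h d < e" using small[OF e] by blast
    have "\<bar>\<sigma> y - \<sigma> x\<bar> < e" if y: "y \<in> I" "\<bar>y - x\<bar> < d" for y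
    proof -
      have "h \<bar>y - x\<bar> < h d" using y d by (intro strict_mono_onD[OF h(1)]) auto
      then show ?thesis using \<sigma>[OF y(1) x] d(2) by linarith
    qed
    then show "\<exists>d>0. \<forall>x'\<in>I. \<bar>x' - x\<bar> < d \<longrightarrow> \<bar>\<sigma> x' - \<sigma> x\<bar> < e" using d(1) by blast
  qed
qed

lemma aug_filtration_filtered:
  assumes "prob_space M" "brownian_motion M W"
  shows "filtered_prob_space M (aug_filtration M W)"
proof -
  interpret prob_space M by fact
  have gen: "(\<Union>s\<in>{0..t}. {W s -` B \<inter> space M | B. B \<in> sets borel}) \<union> null_sets M \<subseteq> sets M" for t
    using assms(2) unfolding brownian_motion_def by (auto dest: measurable_sets)
  show ?thesis
  proof (intro filtered_prob_space.intro filtered_prob_space_axioms.intro)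
    show "prob_space M" by fact
    fix s t :: real
    show "sigma_algebra (space M) (aug_filtration M W t)" unfolding aug_filtration_def
      by (rule sigma_algebra_sigma_sets) (use gen[of t] sets.space_closed in blast)
    show "aug_filtration M W t \<subseteq> sets M" unfolding aug_filtration_def
      by (rule sets.sigma_sets_subset[OF gen])
    assume "s \<le> t"
    then show "aug_filtration M W s \<subseteq> aug_filtration M W t" unfolding aug_filtration_def
      by (intro sigma_sets_mono' Un_mono UN_mono) auto
  qed
qed

theorem theorem3p7:
  fixes M :: "'a measure" and W :: "real \<Rightarrow> 'a \<Rightarrow> real"
    and lo hi :: ereal and \<mu> \<sigma> h :: "real \<Rightarrow> real"
    and X :: "real \<Rightarrow> real \<Rightarrow> 'a \<Rightarrow> real"
    and \<pi> pic :: "real \<Rightarrow> real \<Rightarrow> real" and \<kappa> r :: real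
    and \<psi> :: "real \<Rightarrow> real" and x0 :: real
  defines "I \<equiv> state_int lo hi"
      and "F \<equiv> aug_filtration M W"
  assumes prob: "prob_space M"
    and bm: "brownian_motion M W"
    and lohi: "lo < hi"
    (* coefficients *)
    and mu_lip: "\<exists>L. L-lipschitz_on I \<mu>"
    and sigma_pos: "\<forall>x\<in>I. 0 < \<sigma> x"
    and h_mono: "strict_mono_on {0..} h" and h0: "h 0 = 0"
    and h_int: "\<forall>\<epsilon>>0. (\<integral>\<^sup>+ u\<in>{0<..\<epsilon>}. ennreal (1 / (h u)\<^sup>2) \<partial>lborel) = \<infinity>"
    and sigma_h: "\<forall>x\<in>I. \<forall>y\<in>I. \<bar>\<sigma> x - \<sigma> y\<bar> \<le> h \<bar>x - y\<bar>"
    (* the diffusion *)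
    and X_sol: "\<forall>x\<in>I. strong_solution M F W I \<mu> \<sigma> x (X x)"
    (* \<psi>_r: positive strictly increasing solution of G u = r u, i.e. the increasing
       fundamental solution: E[e^{-r \<tau>_y}] = \<psi>(x)/\<psi>(y) for x \<le> y *)
    and r_pos: "0 < r"
    and psi_pos: "\<forall>x\<in>I. 0 < \<psi> x"
    and psi_mono: "strict_mono_on I \<psi>"
    and psi_ode: "\<exists>\<psi>' \<psi>''. \<forall>x\<in>I. (\<psi> has_real_derivative \<psi>' x) (at x) \<and>
                      (\<psi>' has_real_derivative \<psi>'' x) (at x) \<and>
                      (\<sigma> x)\<^sup>2 / 2 * \<psi>'' x + \<mu> x * \<psi>' x = r * \<psi> x"
    and psi_hit: "\<forall>x\<in>I. \<forall>y\<in>I. x \<le> y \<longrightarrow>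
                    (\<integral>\<omega>. disc r (hitting_time (X x) y \<omega>) \<partial>M) = \<psi> x / \<psi> y"
    and x0: "x0 \<in> I"
    (* Assumption A1 *)
    and pi_incr: "\<forall>x\<in>I. strict_mono_on {0<..} (\<pi> x)"
    and pi_conc: "\<forall>x\<in>I. strictly_concave_on {0<..} (\<pi> x)"
    and pi_deriv: "\<forall>x\<in>I. \<forall>c>0. ((\<pi> x) has_real_derivative pic x c) (at c)"
    and pic_cont: "continuous_on (I \<times> {0<..}) (\<lambda>(x, c). pic x c)"
    and pic_0: "\<forall>x\<in>I. filterlim (pic x) at_top (at_right 0)"
    and pic_inf: "\<forall>x\<in>I. (pic x \<longlongrightarrow> \<kappa>) at_top"
    and kappa: "0 \<le> \<kappa>"
    and pic_int: "\<forall>x\<in>I. \<forall>y>0. integrable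
                   (M \<Otimes>\<^sub>M density (restrict_space lborel {0..}) (\<lambda>t. ennreal (exp (- r * t))))
                   (\<lambda>(\<omega>, t). pic (X x t \<omega>) y)"
    (* Assumption A2 *)
    and A2: "r > \<kappa>"
    (* Assumption A3 *)
    and A3: "\<forall>c>0. mono_on I (\<lambda>x. pic x c)"
  shows "(\<forall>x\<in>I. {y. 0 < y \<and> value_fun M F X pic r x y = 1} \<noteq> {} \<and>
                bdd_above {y. 0 < y \<and> value_fun M F X pic r x y = 1}) \<and>
         (\<forall>x\<in>I. 0 < free_boundary M F X pic r x) \<and>
         mono_on I (free_boundary M F X pic r) \<and>
         (\<forall>x\<in>I. int_eq_lhs lo hi \<mu> \<sigma> x0 \<psi> pic (free_boundary M F X pic r) x = 1) \<and>
         (\<forall>b. (\<forall>x\<in>I. 0 < b x) \<and> mono_on I b \<and>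
              (\<forall>x\<in>I. int_eq_lhs lo hi \<mu> \<sigma> x0 \<psi> pic b x = 1)
              \<longrightarrow> (\<forall>x\<in>I. b x = free_boundary M F X pic r x))"
proof -
  have I_eq: "I = einterval lo hi" by (simp add: I_def state_int_def einterval_def)
  interpret filtered_prob_space M F
    unfolding F_def by (rule aug_filtration_filtered[OF prob bm])
  obtain \<psi>1 \<psi>2 where ode: "\<forall>x\<in>I. (\<psi> has_real_derivative \<psi>1 x) (at x) \<and>
      (\<psi>1 has_real_derivative \<psi>2 x) (at x) \<and> (\<sigma> x)\<^sup>2 / 2 * \<psi>2 x + \<mu> x * \<psi>1 x = r * \<psi> x"
    using psi_ode by blast
  obtain L where "L-lipschitz_on I \<mu>" using mu_lip by blast
  then have \<mu>_cont: "continuous_on I \<mu>" by (rule lipschitz_on_continuous_on)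
  have \<sigma>_cont: "continuous_on I \<sigma>"
    by (rule modulus_continuous_on[OF h_mono h0]) (use h_int sigma_h in auto)
  interpret control_problem M F lo hi \<mu> \<sigma> \<psi> \<psi>1 \<psi>2 r x0 W X pic \<kappa>
  proof (unfold_locales, fold I_eq)
    fix x y c d
    \<comment> \<open>Strict concavity of the profit in the control is passed on as strict decrease
      of its derivative.\<close>
    show "pic x d < pic x c" if "x \<in> I" "0 < c" "c < d"
      by (rule strictly_concave_deriv_strict_antimono[of "\<pi> x" "pic x"]) (use pi_conc pi_deriv that in auto)
    show "integrable (M \<Otimes>\<^sub>M disc_measure r) (\<lambda>(\<omega>, t). pic (X x t \<omega>) y)" if "x \<in> I" "0 < y"
      unfolding disc_measure_def using pic_int that by blast
  qed (use \<mu>_cont \<sigma>_cont sigma_pos r_pos psi_pos psi_mono ode x0 X_sol psi_hit pic_cont pic_0 pic_inf kappa A2 A3 in auto)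
  show ?thesis
  proof (intro conjI ballI allI impI)
    fix x assume x: "x \<in> I"
    then have xI: "x \<in> einterval lo hi" by (simp add: I_eq)
    \<comment> \<open>Nonemptiness and boundedness certify that \<open>Sup\<close> in
      \<open>free_boundary\<close> is a genuine supremum and not an unspecified value.\<close>
    show "{y. 0 < y \<and> value_fun M F X pic r x y = 1} \<noteq> {}" "bdd_above {y. 0 < y \<and> value_fun M F X pic r x y = 1}"
      unfolding fb_root(3)[OF xI] using fb_root(1)[OF xI] by simp_all
    show "0 < free_boundary M F X pic r x" by (rule fb_root(1)[OF xI])
    show "int_eq_lhs lo hi \<mu> \<sigma> x0 \<psi> pic (free_boundary M F X pic r) x = 1" by (rule fb_solves[OF xI])
    fix b assume "(\<forall>x\<in>I. 0 < b x) \<and> mono_on I b \<and> (\<forall>x\<in>I. int_eq_lhs lo hi \<mu> \<sigma> x0 \<psi> pic b x = 1)"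
    then show "b x = free_boundary M F X pic r x"
      by (intro int_eq_unique xI) (auto simp: I_eq)
  next
    show "mono_on I (free_boundary M F X pic r)" unfolding I_eq by (rule fb_mono)
  qed
qed

end
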